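(* Let $A$ be a dga over a field $R$ (of any characteristic) such that each $H^k(A)$ is finite dimensional. Then there is an $A_\infty$ algebra structure $\mu=(\mu_1,\mu_2,\dots)$ with $\mu_1=0$ on $H=H(A)$ which is quasi-isomorphic to $A$. Therefore the Massey products of $A$ are, under the identification of cohomologies induced by the quasi-isomorphism, given as follows. Let $n\ge3$, let $x_{1,1},\dots,x_{n,n}\in H$ be homogeneous, put $\deg(p,q)=\sum_{k=p}^{q}|\underline{x_{k,k}}|$, and let $\{\underline{b^k_i}\}_i$ be a basis of $\underline H^k$ for each $k$. For scalars $c_{p,q,\ell}\in R$ ($1\le p<q\le n$, $(p,q)\ne(1,n)$) put $\underline{x_{p,q}}=\sum_\ell c_{p,q,\ell}\,\underline{b^{\deg(p,q)}_\ell}$. Then $$\langle x_{1,1},\dots,x_{n,n}\rangle=\Big\{[\mathcal S^{1,n}]\ \Big|\ \text{all scalars } c_{p,q,\ell} \text{ with } \mathcal S^{p,q}=0 \text{ for all } 1\le p<q\le n,\ (p,q)\ne(1,n)\Big\},$$ where $$\underline{\mathcal S^{p,q}}=\sum_{r\ge2}\ \sum_{p\le j_1<j_2<\dots<j_{r-1}<q}\underline{\mu_r}(\underline{x_{p,j_1}},\underline{x_{j_1+1,j_2}},\dots,\underline{x_{j_{r-1}+1,q}});$$ the conditions $\mathcal S^{p,q}=0$ are polynomial conditions in the variables $c_{i,j,\ell}$ and $\mathcal S^{1,n}$ is polynomial in these variables.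
   Context: For a graded $R$-module $A=\bigoplus_{k\ge0}A_k$, $\underline A$ is $A$ shifted down by one, $|\underline a|=|a|-1$. An $A_\infty$ algebra has maps $\mu_k:A^{\otimes k}\to A$ ($k\ge1$) of degree $2-k$ whose shifts, $\underline{\mu_k}(\underline{a_1},\dots,\underline{a_k})=(-1)^{\sum_i(k-i)|\underline{a_i}|}\,\underline{\mu_k(a_1,\dots,a_k)}$ (of degree $1$), satisfy $\sum_{k+\ell-1=n}\sum_{i+j+1=k}\underline{\mu_k}\circ(id^{\otimes i}\otimes\underline{\mu_\ell}\otimes id^{\otimes j})=0$ for all $n\ge1$ (Koszul sign rule). $d=\mu_1$. A dga is an $A_\infty$ algebra with $\mu_k=0$ for $k\ge3$. A morphism $f:(A,\mu)\to(B,\nu)$ consists of maps $f_k:A^{\otimes k}\to B$ of degree $1-k$ whose shifts satisfy $\sum_{k+\ell-1=n}\sum_{i+j+1=k}\underline{f_k}(id^{\otimes i}\otimes\underline{\mu_\ell}\otimes id^{\otimes j})=\sum_{\ell_1+\dots+\ell_k=n}\underline{\nu_k}(\underline{f_{\ell_1}}\otimes\dots\otimes\underline{f_{\ell_k}})$ for all $n\ge1$; it is a quasi-isomorphism if $(f_1)_*:H(A)\to H(B)$ is an isomorphism. "Quasi-isomorphic to $A$" means that there is an $A_\infty$ quasi-isomorphism $f:(H,\mu)\to A$; the identification of cohomologies is $(f_1)_*$. Massey products. In any $A_\infty$ algebra, for elements $x_{1,1},\dots,x_{n,n}$ ($n\ge3$), a defining system is a collection of homogeneous $x_{i,j}$,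 $1\le i\le j\le n$, $(i,j)\ne(1,n)$, with the given diagonal entries, with $|\underline{x_{i,j}}|=|\underline{x_{i,i}}|+\dots+|\underline{x_{j,j}}|$ and $d(x_{i,j})=-\mathcal S^{i,j}$ for all $(i,j)\ne(1,n)$, where $\mathcal S^{i,j}$ is given by the formula in the claim (with $\mathcal S^{i,i}=0$). The Massey product $\langle x_{1,1},\dots,x_{n,n}\rangle$ is the set of cohomology classes $[\mathcal S^{1,n}]$ over all defining systems, and depends only on the classes of the $x_{i,i}$. *)

theory Defs
  imports "HOL-Algebra.Indexed_Polynomials" "Jordan_Normal_Form.Missing_VectorSpace"
begin

text \<open>
  A graded \<open>R\<close>-module is the family \<open>A\<close> of its homogeneous components \<open>A k\<close>, with \<open>A k = 0\<close> for
  \<open>k < 0\<close>. A homogeneous element travels as a pair \<open>(k, a)\<close> with \<open>a\<close> in \<open>A k\<close>, since \<open>a\<close> alone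
  need not determine its degree. An operation with one component per arity (\<open>\<mu>\<close> or \<open>f\<close>) is a
  function on lists of such pairs, whose length is the arity; its value on the empty list is
  irrelevant. Since a \<open>k\<close>-linear map on a direct sum is determined by its restriction to
  homogeneous elements, nothing else has to be recorded.
\<close>

type_synonym ('r, 'a) graded = "int \<Rightarrow> ('r, 'a) module"

definition graded_module :: "('r, 's) ring_scheme \<Rightarrow> ('r, 'a) graded \<Rightarrow> bool" where
  "graded_module R A \<longleftrightarrow>
     (\<forall>k. module R (A k)) \<and> (\<forall>k<0. carrier (A k) = {\<zero>\<^bsub>A k\<^esub>})"

definition homog :: "('r, 'a) graded \<Rightarrow> (int \<times> 'a) list \<Rightarrow> bool" where
  "homog A xs \<longleftrightarrow> (\<forall>(k, a) \<in> set xs. a \<in> carrier (A k))"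

text \<open>
  The degree of the value on \<open>xs\<close> of an operation whose arity \<open>k\<close> component has degree \<open>e - k\<close>:
  \<open>e = 2\<close> for \<open>A\<^sub>\<infinity>\<close> structures and \<open>e = 1\<close> for morphisms.
\<close>

definition out_deg :: "int \<Rightarrow> (int \<times> 'a) list \<Rightarrow> int" where
  "out_deg e xs = e - int (length xs) + (\<Sum>u\<leftarrow>xs. fst u)"

definition graded_multilinear ::
  "('r, 's) ring_scheme \<Rightarrow> ('r, 'a) graded \<Rightarrow> ('r, 'b) graded \<Rightarrow> int \<Rightarrow>
   ((int \<times> 'a) list \<Rightarrow> 'b) \<Rightarrow> bool" where
  "graded_multilinear R A B e \<phi> \<longleftrightarrow>
     (\<forall>xs. xs \<noteq> [] \<and> homog A xs \<longrightarrow> \<phi> xs \<in> carrier (B (out_deg e xs))) \<and>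
     (\<forall>xs k a b ys. homog A (xs @ (k, a) # ys) \<and> b \<in> carrier (A k) \<longrightarrow>
        \<phi> (xs @ (k, a \<oplus>\<^bsub>A k\<^esub> b) # ys) =
        \<phi> (xs @ (k, a) # ys) \<oplus>\<^bsub>B (out_deg e (xs @ (k, a) # ys))\<^esub> \<phi> (xs @ (k, b) # ys)) \<and>
     (\<forall>xs k a c ys. homog A (xs @ (k, a) # ys) \<and> c \<in> carrier R \<longrightarrow>
        \<phi> (xs @ (k, c \<odot>\<^bsub>A k\<^esub> a) # ys) =
        c \<odot>\<^bsub>B (out_deg e (xs @ (k, a) # ys))\<^esub> \<phi> (xs @ (k, a) # ys))"

text \<open>
  \<open>signed M n v\<close> is \<open>(-1)\<^sup>n v\<close>. The pairs \<open>(k, a)\<close> always carry the unshifted degree \<open>k = |a|\<close>;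
  the degree of the shifted element is \<open>sdeg (k, a) = k - 1\<close>. The shift enters only through signs:
  \<open>shifted B e \<phi>\<close> is the shift of the operation \<open>\<phi>\<close> (with values in \<open>B\<close>), returned together with
  the unshifted degree of its value. The same formula serves for \<open>\<mu>\<^sub>k\<close> and for \<open>f\<^sub>k\<close>. With 0-based
  positions, the coefficient \<open>k - i\<close> becomes \<open>length xs - Suc i\<close>.
\<close>

definition signed :: "('a, 'm) ring_scheme \<Rightarrow> int \<Rightarrow> 'a \<Rightarrow> 'a" where
  "signed M n v = (if even n then v else \<ominus>\<^bsub>M\<^esub> v)"

definition sdeg :: "int \<times> 'a \<Rightarrow> int" where
  "sdeg u = fst u - 1"

definition shifted ::
  "('r, 'b) graded \<Rightarrow> int \<Rightarrow> ((int \<times> 'a) list \<Rightarrow> 'b) \<Rightarrow> (int \<times> 'a) list \<Rightarrow> int \<times> 'b" where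
  "shifted B e \<phi> xs =
     (out_deg e xs,
      signed (B (out_deg e xs))
        (\<Sum>i<length xs. int (length xs - Suc i) * sdeg (xs ! i)) (\<phi> xs))"

text \<open>
  The sum over \<open>k + l = n + 1\<close> and \<open>i + j + 1 = k\<close> of the terms \<open>\<phi>\<^sub>k (id\<^sup>i \<otimes> \<mu>\<^sub>l \<otimes> id\<^sup>j)\<close> (shifted),
  evaluated on \<open>xs\<close> of length \<open>n\<close>: the summation runs over all ways of cutting \<open>xs\<close> into pieces of
  lengths \<open>i\<close>, \<open>l \<ge> 1\<close>, \<open>j\<close>. The Koszul sign comes from moving the shifted \<open>\<mu>\<^sub>l\<close>, of degree 1,
  past \<open>us\<close>.
\<close>

definition insertion_sum ::
  "('r, 'b) graded \<Rightarrow> int \<Rightarrow> ((int \<times> 'a) list \<Rightarrow> 'b) \<Rightarrow>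
   ('r, 'a) graded \<Rightarrow> ((int \<times> 'a) list \<Rightarrow> 'a) \<Rightarrow> (int \<times> 'a) list \<Rightarrow> 'b" where
  "insertion_sum B e \<phi> A \<mu> xs =
     (\<Oplus>\<^bsub>B (out_deg (e + 1) xs)\<^esub> t \<in> {(us, vs, ws). us @ vs @ ws = xs \<and> vs \<noteq> []}.
        (case t of (us, vs, ws) \<Rightarrow>
           signed (B (out_deg (e + 1) xs)) (\<Sum>u\<leftarrow>us. sdeg u)
             (snd (shifted B e \<phi> (us @ shifted A 2 \<mu> vs # ws)))))"

definition a_inf_algebra ::
  "('r, 's) ring_scheme \<Rightarrow> ('r, 'a) graded \<Rightarrow> ((int \<times> 'a) list \<Rightarrow> 'a) \<Rightarrow> bool" where
  "a_inf_algebra R A \<mu> \<longleftrightarrow>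
     graded_module R A \<and> graded_multilinear R A A 2 \<mu> \<and>
     (\<forall>xs. xs \<noteq> [] \<and> homog A xs \<longrightarrow> insertion_sum A 2 \<mu> A \<mu> xs = \<zero>\<^bsub>A (out_deg 3 xs)\<^esub>)"

definition dga ::
  "('r, 's) ring_scheme \<Rightarrow> ('r, 'a) graded \<Rightarrow> ((int \<times> 'a) list \<Rightarrow> 'a) \<Rightarrow> bool" where
  "dga R A \<mu> \<longleftrightarrow>
     a_inf_algebra R A \<mu> \<and>
     (\<forall>xs. 3 \<le> length xs \<and> homog A xs \<longrightarrow> \<mu> xs = \<zero>\<^bsub>A (out_deg 2 xs)\<^esub>)"

definition zero_differential ::
  "('r, 'a) graded \<Rightarrow> ((int \<times> 'a) list \<Rightarrow> 'a) \<Rightarrow> bool" where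
  "zero_differential A \<mu> \<longleftrightarrow> (\<forall>k. \<forall>a \<in> carrier (A k). \<mu> [(k, a)] = \<zero>\<^bsub>A (k + 1)\<^esub>)"

text \<open>
  On the right-hand side of the morphism equation, the compositions \<open>l\<^sub>1 + \<dots> + l\<^sub>k = n\<close> correspond
  to the ways of cutting \<open>xs\<close> into nonempty blocks. The shifted \<open>f\<^sub>l\<close> have degree 0, so no Koszul
  sign appears.
\<close>

definition a_inf_morphism ::
  "('r, 's) ring_scheme \<Rightarrow> ('r, 'a) graded \<Rightarrow> ((int \<times> 'a) list \<Rightarrow> 'a) \<Rightarrow>
   ('r, 'b) graded \<Rightarrow> ((int \<times> 'b) list \<Rightarrow> 'b) \<Rightarrow> ((int \<times> 'a) list \<Rightarrow> 'b) \<Rightarrow> bool" where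
  "a_inf_morphism R A \<mu> B \<nu> f \<longleftrightarrow>
     graded_multilinear R A B 1 f \<and>
     (\<forall>xs. xs \<noteq> [] \<and> homog A xs \<longrightarrow>
        insertion_sum B 1 f A \<mu> xs =
        (\<Oplus>\<^bsub>B (out_deg 2 xs)\<^esub> yss \<in> {yss. concat yss = xs \<and> [] \<notin> set yss}.
           snd (shifted B 2 \<nu> (map (shifted B 1 f) yss))))"

definition cocycles ::
  "('r, 'a) graded \<Rightarrow> ((int \<times> 'a) list \<Rightarrow> 'a) \<Rightarrow> int \<Rightarrow> 'a set" where
  "cocycles A \<mu> k = {a \<in> carrier (A k). \<mu> [(k, a)] = \<zero>\<^bsub>A (k + 1)\<^esub>}"

definition coboundaries ::
  "('r, 'a) graded \<Rightarrow> ((int \<times> 'a) list \<Rightarrow> 'a) \<Rightarrow> int \<Rightarrow> 'a set" where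
  "coboundaries A \<mu> k = (\<lambda>a. \<mu> [(k - 1, a)]) ` carrier (A (k - 1))"

definition coh_class ::
  "('r, 'a) graded \<Rightarrow> ((int \<times> 'a) list \<Rightarrow> 'a) \<Rightarrow> int \<Rightarrow> 'a \<Rightarrow> 'a set" where
  "coh_class A \<mu> k a = coboundaries A \<mu> k +>\<^bsub>A k\<^esub> a"

text \<open>
  Cohomology as the graded module of cosets. The multiplicative fields of the module record play
  no role for modules. In \<open>smult\<close> and in \<open>coh_map\<close> all members of the union coincide.
\<close>

definition cohomology ::
  "('r, 'a) graded \<Rightarrow> ((int \<times> 'a) list \<Rightarrow> 'a) \<Rightarrow> ('r, 'a set) graded" where
  "cohomology A \<mu> k =
     \<lparr>carrier = coh_class A \<mu> k ` cocycles A \<mu> k,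
      monoid.mult = undefined, one = undefined,
      zero = coboundaries A \<mu> k,
      add = set_add (A k),
      smult = (\<lambda>c C. \<Union>a\<in>C. coh_class A \<mu> k (c \<odot>\<^bsub>A k\<^esub> a))\<rparr>"

definition coh_map ::
  "('r, 'b) graded \<Rightarrow> ((int \<times> 'b) list \<Rightarrow> 'b) \<Rightarrow> ((int \<times> 'a) list \<Rightarrow> 'b) \<Rightarrow>
   int \<Rightarrow> 'a set \<Rightarrow> 'b set" where
  "coh_map B \<nu> f k C = (\<Union>a\<in>C. coh_class B \<nu> k (f [(k, a)]))"

definition a_inf_quasi_iso ::
  "('r, 's) ring_scheme \<Rightarrow> ('r, 'a) graded \<Rightarrow> ((int \<times> 'a) list \<Rightarrow> 'a) \<Rightarrow>
   ('r, 'b) graded \<Rightarrow> ((int \<times> 'b) list \<Rightarrow> 'b) \<Rightarrow> ((int \<times> 'a) list \<Rightarrow> 'b) \<Rightarrow> bool" where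
  "a_inf_quasi_iso R A \<mu> B \<nu> f \<longleftrightarrow>
     a_inf_morphism R A \<mu> B \<nu> f \<and>
     (\<forall>k. coh_map B \<nu> f k \<in> module_hom R (cohomology A \<mu> k) (cohomology B \<nu> k) \<and>
          bij_betw (coh_map B \<nu> f k) (carrier (cohomology A \<mu> k)) (carrier (cohomology B \<nu> k)))"

text \<open>
  For entries \<open>x\<^sub>1\<^sub>1, \<dots>, x\<^sub>n\<^sub>n\<close> of (unshifted) degrees \<open>d 1, \<dots>, d n\<close>, the shifted degree of \<open>x\<^sub>p\<^sub>q\<close> is
  the sum of the \<open>d k - 1\<close>; \<open>massey_deg d p q\<close> is the unshifted degree. The list \<open>js\<close> holds
  \<open>j\<^sub>1 < \<dots> < j\<^sub>r\<^sub>-\<^sub>1\<close>, so that the arguments below are \<open>x\<^bsub>p,j1\<^esub>, x\<^bsub>j1+1,j2\<^esub>, \<dots>, x\<^bsub>j(r-1)+1,q\<^esub>\<close>;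
  requiring \<open>js \<noteq> []\<close> is requiring \<open>r \<ge> 2\<close>. For \<open>p = q\<close> the sum is empty.
\<close>

definition massey_deg :: "(nat \<Rightarrow> int) \<Rightarrow> nat \<Rightarrow> nat \<Rightarrow> int" where
  "massey_deg d p q = (\<Sum>k=p..q. (d k - 1)) + 1"

definition massey_sum ::
  "('r, 'a) graded \<Rightarrow> ((int \<times> 'a) list \<Rightarrow> 'a) \<Rightarrow> (nat \<Rightarrow> int) \<Rightarrow>
   (nat \<Rightarrow> nat \<Rightarrow> 'a) \<Rightarrow> nat \<Rightarrow> nat \<Rightarrow> 'a" where
  "massey_sum A \<mu> d x p q =
     (\<Oplus>\<^bsub>A (massey_deg d p q + 1)\<^esub>
        js \<in> {js. js \<noteq> [] \<and> sorted_wrt (<) js \<and> set js \<subseteq> {p..<q}}.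
        snd (shifted A 2 \<mu>
          (map2 (\<lambda>i j. (massey_deg d i j, x i j)) (p # map Suc js) (js @ [q]))))"

definition defining_system ::
  "('r, 'a) graded \<Rightarrow> ((int \<times> 'a) list \<Rightarrow> 'a) \<Rightarrow> nat \<Rightarrow> (nat \<Rightarrow> int) \<Rightarrow>
   (nat \<Rightarrow> 'a) \<Rightarrow> (nat \<Rightarrow> nat \<Rightarrow> 'a) \<Rightarrow> bool" where
  "defining_system A \<mu> n d a x \<longleftrightarrow>
     (\<forall>i\<in>{1..n}. x i i = a i) \<and>
     (\<forall>i j. 1 \<le> i \<and> i \<le> j \<and> j \<le> n \<and> (i, j) \<noteq> (1, n) \<longrightarrow>
        x i j \<in> carrier (A (massey_deg d i j)) \<and>
        \<mu> [(massey_deg d i j, x i j)] =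
          \<ominus>\<^bsub>A (massey_deg d i j + 1)\<^esub> massey_sum A \<mu> d x i j)"

definition massey_product ::
  "('r, 'a) graded \<Rightarrow> ((int \<times> 'a) list \<Rightarrow> 'a) \<Rightarrow> nat \<Rightarrow> (nat \<Rightarrow> int) \<Rightarrow>
   (nat \<Rightarrow> 'a) \<Rightarrow> 'a set set" where
  "massey_product A \<mu> n d a =
     {coh_class A \<mu> (massey_deg d 1 n + 1) (massey_sum A \<mu> d x 1 n) | x.
        defining_system A \<mu> n d a x}"

text \<open>
  A basis of each component is given as a set \<open>Bs k\<close>, and the scalar \<open>c\<^sub>p\<^sub>q\<^sub>l\<close> is indexed by the basis
  element in place of its number \<open>l\<close>. The basis of the shifted component of degree \<open>deg(p,q)\<close> is
  \<open>Bs (massey_deg d p q)\<close>.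
\<close>

definition massey_vars ::
  "nat \<Rightarrow> (nat \<Rightarrow> int) \<Rightarrow> (int \<Rightarrow> 'a set) \<Rightarrow> (nat \<times> nat \<times> 'a) set" where
  "massey_vars n d Bs =
     {(p, q, b). 1 \<le> p \<and> p < q \<and> q \<le> n \<and> (p, q) \<noteq> (1, n) \<and> b \<in> Bs (massey_deg d p q)}"

definition massey_entry ::
  "('r, 'a) graded \<Rightarrow> (nat \<Rightarrow> int) \<Rightarrow> (int \<Rightarrow> 'a set) \<Rightarrow> (nat \<Rightarrow> 'a) \<Rightarrow>
   (nat \<times> nat \<times> 'a \<Rightarrow> 'r) \<Rightarrow> nat \<Rightarrow> nat \<Rightarrow> 'a" where
  "massey_entry H d Bs x c p q =
     (if p = q then x p
      else module.lincomb (H (massey_deg d p q)) (\<lambda>b. c (p, q, b)) (Bs (massey_deg d p q)))"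

definition indexed_value ::
  "('r, 's) ring_scheme \<Rightarrow> ('v multiset \<Rightarrow> 'r) \<Rightarrow> ('v \<Rightarrow> 'r) \<Rightarrow> 'r" where
  "indexed_value R P c =
     (\<Oplus>\<^bsub>R\<^esub> m \<in> {m. P m \<noteq> \<zero>\<^bsub>R\<^esub>}.
        P m \<otimes>\<^bsub>R\<^esub> (\<Otimes>\<^bsub>R\<^esub> v \<in> set_mset m. c v [^]\<^bsub>R\<^esub> count m v))"

end

theory Submission
  imports Defs
begin

text \<open>
  Over a field, the complex \<open>A\<close> contracts onto \<open>H(A)\<close>: there are a section \<open>i\<close> of the cocycles, a
  projection \<open>p\<close> and a homotopy \<open>h\<close> with \<open>dh + hd = ip - 1\<close>. With the product as the only
  higher operation, \<open>F = i + h \<circ> quad F\<close> determines \<open>F\<close> by recursion on the number of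
  arguments, and \<open>\<mu> = p \<circ> quad F\<close> is the minimal structure for which \<open>F\<close> is a morphism.

  In the dga a defining system is a solution \<open>y\<close> of \<open>dy = - curv y\<close> on the proper intervals of
  \<open>{1..n}\<close>. A morphism \<open>F\<close> sends a system \<open>x\<close> over \<open>H\<close> to the sums over all partitions of an
  interval of \<open>F\<close> applied to the entries of \<open>x\<close>. Conversely, a system in the dga is gauge
  equivalent to such an image: its entries are built by induction on the length of the interval,
  and since \<open>F\<close> is a quasi-isomorphism, each obstruction vanishes and each difference is
  a cocycle that the next entry of \<open>x\<close> and of the gauge transformation absorb. The curvatures of
  gauge equivalent systems are cohomologous on the full interval.
\<close>

section \<open>Homotopy transfer\<close>

text \<open>The condition \<open>dy = - curv y\<close> is the Maurer-Cartan equation for upper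
  triangular matrices with entries in the dga, the corner of the full interval being left out; the
  class of the curvature at that corner is the element of the Massey product. Gauge transformations
  are unavoidable because a given system is rarely a literal image: its diagonal represents the
  right classes only up to coboundaries. The Massey statement concerns every minimal model and not
  just the transferred one, so the comparison may use of \<open>F\<close> only that it is an A_inf
  morphism with F_1 bijective on cohomology. Shifting gives structure maps degree 1 and morphisms
  degree 0, so the sign of a term is that of moving one map of degree 1 past the arguments on its
  left. The homotopy is normalised by dh + hd = ip - 1 so that the recursion for \<open>F\<close>
  carries no sign: dF = ipQ - Q - h dQ for Q = quad F. The components of \<open>A\<close> may have
  infinite dimension, so the complements behind i, p and h come from Zorn's lemma.\<close>

definition alt :: "int \<Rightarrow> 'a::ab_group_add \<Rightarrow> 'a" where
  "alt n T = (if even n then T else - T)"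

lemma alt_simps [simp]:
  "alt n 0 = 0" "alt 0 T = T" "alt m (alt n T) = alt (m + n) T"
  "alt (2 * n) T = T" "alt (n + 1) T = - alt n T" "alt (n - 1) T = - alt n T"
  by (auto simp: alt_def)

lemma alt_add: "alt n (T + Y) = alt n T + alt n Y"
  and alt_minus: "alt n (- T) = - alt n T"
  and alt_diff: "alt n (T - Y) = alt n T - alt n Y"
  by (auto simp: alt_def)

lemma alt_sum: "alt n (sum f S) = (\<Sum>x\<in>S. alt n (f x))"
  by (auto simp: alt_def sum_negf)

lemma (in additive) alt: "f (alt n T) = alt n (f T)"
  by (simp add: alt_def minus)

section \<open>Total degrees and cuts of argument lists\<close>

definition tdeg :: "(int \<times> 'a) list \<Rightarrow> int" where
  "tdeg xs = (\<Sum>u\<leftarrow>xs. fst u)"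

lemma tdeg_simps [simp]:
  "tdeg [] = 0" "tdeg (x # xs) = fst x + tdeg xs" "tdeg (xs @ ys) = tdeg xs + tdeg ys"
  by (auto simp: tdeg_def)

definition splits2 :: "'x list \<Rightarrow> ('x list \<times> 'x list) set" where
  "splits2 xs = {(ys, zs). ys @ zs = xs \<and> ys \<noteq> [] \<and> zs \<noteq> []}"

definition splits3 :: "'x list \<Rightarrow> ('x list \<times> 'x list \<times> 'x list) set" where
  "splits3 xs = {(us, vs, ws). us @ vs @ ws = xs \<and> vs \<noteq> []}"

lemma finite_appends: "finite {(ys, zs). ys @ zs = xs}"
proof (rule finite_subset)
  show "{(ys, zs). ys @ zs = xs} \<subseteq> (\<lambda>k. (take k xs, drop k xs)) ` {..length xs}"
  proof clarify
    fix ys zs assume "xs = ys @ zs"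
    then show "(ys, zs) \<in> (\<lambda>k. (take k (ys @ zs), drop k (ys @ zs))) ` {..length (ys @ zs)}"
      by (intro image_eqI[of _ _ "length ys"]) auto
  qed
qed simp

lemma finite_splits2 [simp]: "finite (splits2 xs)"
  by (rule finite_subset[OF _ finite_appends[of xs]]) (auto simp: splits2_def)

lemma finite_splits3 [simp]: "finite (splits3 xs)"
proof (rule finite_subset)
  show "splits3 xs \<subseteq> (\<lambda>(j, k). (take j xs, take k (drop j xs), drop k (drop j xs))) `
          ({..length xs} \<times> {..length xs})"
  proof
    fix t assume "t \<in> splits3 xs"
    then obtain us vs ws where t: "t = (us, vs, ws)" "us @ vs @ ws = xs"
      by (auto simp: splits3_def)
    then have "t = (\<lambda>(j, k). (take j xs, take k (drop j xs), drop k (drop j xs))) (length us, length vs)"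
      by auto
    moreover have "(length us, length vs) \<in> {..length xs} \<times> {..length xs}" using t by auto
    ultimately show "t \<in> (\<lambda>(j, k). (take j xs, take k (drop j xs), drop k (drop j xs))) `
          ({..length xs} \<times> {..length xs})" by (rule image_eqI)
  qed
qed simp

text \<open>A cut lies either to the right or to the left of the marked entry \<open>x\<close>. The
  piece that contains \<open>x\<close> is automatically nonempty, so only the other piece carries a
  condition. This case distinction is behind the Leibniz rule and behind linearity in one
  entry.\<close>

lemma splits2_middle:
  "splits2 (us @ x # ws) =
     (\<lambda>(w1, w2). (us @ x # w1, w2)) ` {(w1, w2). w1 @ w2 = ws \<and> w2 \<noteq> []} \<union>
     (\<lambda>(u1, u2). (u1, u2 @ x # ws)) ` {(u1, u2). u1 @ u2 = us \<and> u1 \<noteq> []}"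
  (is "_ = ?A \<union> ?B")
proof
  show "splits2 (us @ x # ws) \<subseteq> ?A \<union> ?B"
  proof
    fix t assume "t \<in> splits2 (us @ x # ws)"
    then obtain ys zs where t: "t = (ys, zs)" "ys @ zs = us @ x # ws" "ys \<noteq> []" "zs \<noteq> []"
      by (auto simp: splits2_def)
    from t(2) consider ts where "ys = us @ ts" "ts @ zs = x # ws"
      | ts where "ys @ ts = us" "zs = ts @ x # ws"
      by (auto simp: append_eq_append_conv2)
    then show "t \<in> ?A \<union> ?B"
    proof cases
      case 1
      show ?thesis
      proof (cases ts)
        case Nil
        then have "t = (\<lambda>(u1, u2). (u1, u2 @ x # ws)) (us, [])" "us \<noteq> []" using 1 t by auto
        then show ?thesis by (force simp: image_iff)
      next
        case (Cons a w1)
        then have "t = (\<lambda>(w1, w2). (us @ x # w1, w2)) (w1, zs)" "w1 @ zs = ws" using 1 t by auto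
        then show ?thesis using t by (force simp: image_iff)
      qed
    next
      case 2
      then have "t = (\<lambda>(u1, u2). (u1, u2 @ x # ws)) (ys, ts)" using t by auto
      then show ?thesis using 2 t by (force simp: image_iff)
    qed
  qed
qed (auto simp: splits2_def)

lemma sum_splits2_middle:
  fixes G :: "'x list \<times> 'x list \<Rightarrow> 'b::ab_group_add"
  shows "sum G (splits2 (us @ x # ws)) =
     (\<Sum>(w1, w2)\<in>{(w1, w2). w1 @ w2 = ws \<and> w2 \<noteq> []}. G (us @ x # w1, w2)) +
     (\<Sum>(u1, u2)\<in>{(u1, u2). u1 @ u2 = us \<and> u1 \<noteq> []}. G (u1, u2 @ x # ws))"
proof -
  let ?I = "{(w1, w2). w1 @ w2 = ws \<and> w2 \<noteq> []}" and ?J = "{(u1, u2). u1 @ u2 = us \<and> u1 \<noteq> []}"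
  let ?f = "\<lambda>(w1, w2). (us @ x # w1, w2)" and ?g = "\<lambda>(u1, u2). (u1, u2 @ x # ws)"
  have fin: "finite ?I" "finite ?J"
    by (rule finite_subset[OF _ finite_appends[of ws]], force,
        rule finite_subset[OF _ finite_appends[of us]], force)
  have "?f ` ?I \<inter> ?g ` ?J = {}"
  proof -
    \<comment> \<open>A second piece cut off to the right of \<open>x\<close> fits into
      \<open>ws\<close>, whereas one that contains \<open>x\<close> and all of \<open>ws\<close> is
      strictly longer.\<close>
    have False if "w1 @ w2 = ws" "w2 = u2 @ x # ws" for w1 w2 u2
    proof -
      have "length w2 \<le> length ws" using that(1) by auto
      then show False using that(2) by simp
    qed
    then show ?thesis by auto
  qed
  then have "sum G (splits2 (us @ x # ws)) = sum G (?f ` ?I) + sum G (?g ` ?J)"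
    unfolding splits2_middle using fin by (intro sum.union_disjoint) auto
  also have "sum G (?f ` ?I) = sum (G \<circ> ?f) ?I" by (intro sum.reindex) (auto simp: inj_on_def)
  also have "sum G (?g ` ?J) = sum (G \<circ> ?g) ?J" by (intro sum.reindex) (auto simp: inj_on_def)
  finally show ?thesis by (simp add: o_def case_prod_unfold)
qed

text \<open>The composite of \<open>\<Phi>\<close> with the coderivation of the tensor coalgebra
  that \<open>M\<close> induces. \<open>M\<close> has shifted degree 1, whence the degree of the
  inserted entry and the sign from moving \<open>M\<close> past \<open>us\<close>. The left-hand
  sides of the A_inf equation and of the morphism equation both have this form.\<close>

definition insertion ::
  "((int \<times> 'h) list \<Rightarrow> 'b::ab_group_add) \<Rightarrow> ((int \<times> 'h) list \<Rightarrow> 'h) \<Rightarrow> (int \<times> 'h) list \<Rightarrow> 'b" where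
  "insertion \<Phi> M xs =
     (\<Sum>(us, vs, ws)\<in>splits3 xs. alt (tdeg us) (\<Phi> (us @ (tdeg vs + 1, M vs) # ws)))"

text \<open>
  The degrees are shifted ones and are passed to the operations, so that the Koszul signs are
  signs in a single abelian group and elements need no degree of their own.
\<close>

locale shifted_dga =
  fixes b1 :: "int \<Rightarrow> 'a::ab_group_add \<Rightarrow> 'a"
    and b2 :: "int \<Rightarrow> int \<Rightarrow> 'a \<Rightarrow> 'a \<Rightarrow> 'a"
  assumes b1_add: "additive (b1 s)"
    and b2_left: "additive (\<lambda>T. b2 s t T Y)"
    and b2_right: "additive (b2 s t T)"
    and b1_b1: "b1 (s + 1) (b1 s T) = 0"
    and b1_b2: "b1 (s + t + 1) (b2 s t T Y) + b2 (s + 1) t (b1 s T) Y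
                  + alt s (b2 s (t + 1) T (b1 t Y)) = 0"
    and b2_b2: "b2 (s + t + 1) r (b2 s t T Y) Z + alt s (b2 s (t + r + 1) T (b2 t r Y Z)) = 0"
begin

text \<open>The part of the right-hand side of the morphism equation that involves the product of
  the target. No sign appears because \<open>F\<close> has shifted degree 0.\<close>

definition quad :: "((int \<times> 'h) list \<Rightarrow> 'a) \<Rightarrow> (int \<times> 'h) list \<Rightarrow> 'a" where
  "quad F xs = (\<Sum>(ys, zs)\<in>splits2 xs. b2 (tdeg ys) (tdeg zs) (F ys) (F zs))"

lemma quad_single [simp]: "quad F [x] = 0"
proof -
  have "splits2 [x] = {}" by (auto simp: splits2_def append_eq_Cons_conv)
  then show ?thesis by (simp add: quad_def)
qed

text \<open>Both kinds of terms run over the cuts of \<open>xs\<close> into three nonempty pieces,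
  once bracketed to the left and once to the right; by \<open>b2_b2\<close> corresponding terms are
  opposite.\<close>

lemma quad_b2_assoc:
  "(\<Sum>(ys, zs)\<in>splits2 xs. b2 (tdeg ys + 1) (tdeg zs) (quad F ys) (F zs)
      + alt (tdeg ys) (b2 (tdeg ys) (tdeg zs + 1) (F ys) (quad F zs))) = 0"
proof -
  let ?I = "\<lambda>t. splits2 (fst t)" and ?J = "\<lambda>t. splits2 (snd t)"
  let ?g = "\<lambda>a b c. b2 (tdeg a + tdeg b + 1) (tdeg c) (b2 (tdeg a) (tdeg b) (F a) (F b)) (F c)"
  have 1: "(\<Sum>(ys, zs)\<in>splits2 xs. b2 (tdeg ys + 1) (tdeg zs) (quad F ys) (F zs))
     = (\<Sum>(t, u)\<in>Sigma (splits2 xs) ?I. ?g (fst u) (snd u) (snd t))"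
  proof (subst sum.Sigma[symmetric], simp, simp, rule sum.cong[OF refl], clarsimp)
    fix ys zs assume "(ys, zs) \<in> splits2 xs"
    show "b2 (tdeg ys + 1) (tdeg zs) (quad F ys) (F zs) = (\<Sum>u\<in>splits2 ys. ?g (fst u) (snd u) zs)"
      unfolding quad_def additive.sum[OF b2_left] case_prod_unfold
      by (intro sum.cong) (auto simp: splits2_def)
  qed
  have *: "alt (tdeg a) (b2 (tdeg a) (tdeg b + tdeg c + 1) (F a) (b2 (tdeg b) (tdeg c) (F b) (F c)))
        = - ?g a b c" for a b c
    using b2_b2[of "tdeg a" "tdeg b" "tdeg c"] by (simp add: eq_neg_iff_add_eq_0 add.commute)
  have 2: "(\<Sum>(ys, zs)\<in>splits2 xs. alt (tdeg ys) (b2 (tdeg ys) (tdeg zs + 1) (F ys) (quad F zs)))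
     = (\<Sum>(t, u)\<in>Sigma (splits2 xs) ?J. - ?g (fst t) (fst u) (snd u))"
  proof (subst sum.Sigma[symmetric], simp, simp, rule sum.cong[OF refl], clarsimp)
    fix ys zs assume "(ys, zs) \<in> splits2 xs"
    show "alt (tdeg ys) (b2 (tdeg ys) (tdeg zs + 1) (F ys) (quad F zs))
        = (\<Sum>u\<in>splits2 zs. - ?g ys (fst u) (snd u))"
      unfolding quad_def additive.sum[OF b2_right] alt_sum case_prod_unfold *[symmetric]
      by (intro sum.cong) (auto simp: splits2_def)
  qed
  \<comment> \<open>Rebracketing of three consecutive pieces: a second cut of the right piece
    becomes a second cut of the left piece.\<close>
  have "(\<Sum>(t, u)\<in>Sigma (splits2 xs) ?J. - ?g (fst t) (fst u) (snd u))
     = (\<Sum>(t, u)\<in>Sigma (splits2 xs) ?I. - ?g (fst u) (snd u) (snd t))"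
    by (rule sum.reindex_bij_witness[where
          i = "\<lambda>(t, u). ((fst u, snd u @ snd t), (snd u, snd t))" and
          j = "\<lambda>(t, u). ((fst t @ fst u, snd u), (fst t, fst u))"])
       (auto simp: splits2_def)
  with 1 2 show ?thesis
    by (simp add: sum.distrib case_prod_unfold sum_negf)
qed

text \<open>\<open>M\<close> acts as a coderivation: the inserted value falls into the left or into
  the right factor of the product. In the second case \<open>M\<close> has passed the whole left
  factor, which accounts for \<open>alt (tdeg ys)\<close>; the sign from the part of the right
  factor before the insertion is contained in \<open>insertion F M zs\<close>.\<close>

lemma insertion_quad:
  "insertion (quad F) M xs =
     (\<Sum>(ys, zs)\<in>splits2 xs. b2 (tdeg ys + 1) (tdeg zs) (insertion F M ys) (F zs)
        + alt (tdeg ys) (b2 (tdeg ys) (tdeg zs + 1) (F ys) (insertion F M zs)))"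
proof -
  let ?m = "\<lambda>vs. (tdeg vs + 1, M vs)"
  let ?P = "\<lambda>us vs w1 w2. alt (tdeg us)
      (b2 (tdeg us + tdeg vs + tdeg w1 + 1) (tdeg w2) (F (us @ ?m vs # w1)) (F w2))"
  let ?Q = "\<lambda>u1 u2 vs ws. alt (tdeg u1 + tdeg u2)
      (b2 (tdeg u1) (tdeg u2 + tdeg vs + tdeg ws + 1) (F u1) (F (u2 @ ?m vs # ws)))"
  let ?A = "\<lambda>ws. {(w1, w2). w1 @ w2 = ws \<and> w2 \<noteq> []}"
  let ?B = "\<lambda>us. {(u1, u2). u1 @ u2 = us \<and> u1 \<noteq> []}"
  have fin: "finite (?A ws)" "finite (?B ws)" for ws :: "(int \<times> 'b) list"
    by (rule finite_subset[OF _ finite_appends[of ws]], force)+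
  have "insertion (quad F) M xs =
      (\<Sum>(us, vs, ws)\<in>splits3 xs. (\<Sum>(w1, w2)\<in>?A ws. ?P us vs w1 w2)) +
      (\<Sum>(us, vs, ws)\<in>splits3 xs. (\<Sum>(u1, u2)\<in>?B us. ?Q u1 u2 vs ws))"
    unfolding insertion_def quad_def sum_splits2_middle case_prod_unfold sum.distrib[symmetric]
    by (intro sum.cong arg_cong2[of _ _ _ _ "(+)"])
       (auto simp: alt_add alt_sum ac_simps intro!: sum.cong arg_cong2[of _ _ _ _ "(+)"])
  also have "(\<Sum>(us, vs, ws)\<in>splits3 xs. (\<Sum>(w1, w2)\<in>?A ws. ?P us vs w1 w2)) =
      (\<Sum>(t, u)\<in>Sigma (splits3 xs) (\<lambda>t. ?A (snd (snd t))). ?P (fst t) (fst (snd t)) (fst u) (snd u))"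
    using fin by (subst sum.Sigma[symmetric]) (auto simp: case_prod_unfold)
  \<comment> \<open>Choosing the insertion first and then a cut to its right is the same as cutting
    first and inserting into the left piece.\<close>
  also have "\<dots> = (\<Sum>(t, u)\<in>Sigma (splits2 xs) (\<lambda>t. splits3 (fst t)).
                     ?P (fst u) (fst (snd u)) (snd (snd u)) (snd t))"
    by (rule sum.reindex_bij_witness[where
          i = "\<lambda>(t, u). ((fst u, fst (snd u), snd (snd u) @ snd t), (snd (snd u), snd t))" and
          j = "\<lambda>(t, u). ((fst t @ fst (snd t) @ fst u, snd u), (fst t, fst (snd t), fst u))"])
       (auto simp: splits2_def splits3_def)
  also have "\<dots> = (\<Sum>(ys, zs)\<in>splits2 xs. b2 (tdeg ys + 1) (tdeg zs) (insertion F M ys) (F zs))"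
  proof (subst sum.Sigma[symmetric], simp, simp, rule sum.cong[OF refl], clarsimp)
    fix ys zs assume "(ys, zs) \<in> splits2 xs"
    show "(\<Sum>u\<in>splits3 ys. ?P (fst u) (fst (snd u)) (snd (snd u)) zs)
        = b2 (tdeg ys + 1) (tdeg zs) (insertion F M ys) (F zs)"
      unfolding insertion_def additive.sum[OF b2_left] case_prod_unfold
      by (intro sum.cong) (auto simp: splits3_def additive.alt[OF b2_left] add.assoc)
  qed
  also have "(\<Sum>(us, vs, ws)\<in>splits3 xs. (\<Sum>(u1, u2)\<in>?B us. ?Q u1 u2 vs ws)) =
      (\<Sum>(t, u)\<in>Sigma (splits3 xs) (\<lambda>t. ?B (fst t)). ?Q (fst u) (snd u) (fst (snd t)) (snd (snd t)))"
    using fin by (subst sum.Sigma[symmetric]) (auto simp: case_prod_unfold)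
  also have "\<dots> = (\<Sum>(t, u)\<in>Sigma (splits2 xs) (\<lambda>t. splits3 (snd t)).
                     ?Q (fst t) (fst u) (fst (snd u)) (snd (snd u)))"
    by (rule sum.reindex_bij_witness[where
          i = "\<lambda>(t, u). ((fst t @ fst u, fst (snd u), snd (snd u)), (fst t, fst u))" and
          j = "\<lambda>(t, u). ((fst u, snd u @ fst (snd t) @ snd (snd t)), (snd u, fst (snd t), snd (snd t)))"])
       (auto simp: splits2_def splits3_def)
  also have "\<dots> = (\<Sum>(ys, zs)\<in>splits2 xs.
      alt (tdeg ys) (b2 (tdeg ys) (tdeg zs + 1) (F ys) (insertion F M zs)))"
  proof (subst sum.Sigma[symmetric], simp, simp, rule sum.cong[OF refl], clarsimp)
    fix ys zs assume "(ys, zs) \<in> splits2 xs"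
    show "(\<Sum>u\<in>splits3 zs. ?Q ys (fst u) (fst (snd u)) (snd (snd u)))
        = alt (tdeg ys) (b2 (tdeg ys) (tdeg zs + 1) (F ys) (insertion F M zs))"
      unfolding insertion_def additive.sum[OF b2_right] alt_sum case_prod_unfold
      by (intro sum.cong) (auto simp: splits3_def additive.alt[OF b2_right] add.assoc)
  qed
  finally show ?thesis by (simp add: sum.distrib case_prod_unfold)
qed

text \<open>The Leibniz rule moves \<open>b1\<close> into the two factors, where the hypothesis
  replaces it by an insertion minus \<open>quad F\<close>. The insertions cancel against
  \<open>insertion_quad\<close>, and the terms with \<open>quad F\<close> cancel by associativity.
  Both factors are shorter than \<open>xs\<close>, so the hypothesis has the form that an induction
  on length supplies.\<close>

lemma b1_quad:
  assumes "\<And>ys. length ys < length xs \<Longrightarrow> ys \<noteq> [] \<Longrightarrow> b1 (tdeg ys) (F ys) + quad F ys = insertion F M ys"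
  shows "b1 (tdeg xs + 1) (quad F xs) + insertion (quad F) M xs = 0"
proof -
  have short: "insertion F M ys = b1 (tdeg ys) (F ys) + quad F ys"
              "insertion F M zs = b1 (tdeg zs) (F zs) + quad F zs"
    if "(ys, zs) \<in> splits2 xs" for ys zs
    using that assms[of ys] assms[of zs] by (force simp: splits2_def)+
  have leib: "b1 (tdeg xs + 1) (b2 (tdeg ys) (tdeg zs) T Y) =
     - b2 (tdeg ys + 1) (tdeg zs) (b1 (tdeg ys) T) Y
     - alt (tdeg ys) (b2 (tdeg ys) (tdeg zs + 1) T (b1 (tdeg zs) Y))"
    if "(ys, zs) \<in> splits2 xs" for ys zs T Y
    using that b1_b2[of "tdeg ys" "tdeg zs" T Y]
    by (auto simp: splits2_def algebra_simps eq_neg_iff_add_eq_0)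
  have "b1 (tdeg xs + 1) (quad F xs) + insertion (quad F) M xs =
    (\<Sum>(ys, zs)\<in>splits2 xs. b2 (tdeg ys + 1) (tdeg zs) (quad F ys) (F zs)
      + alt (tdeg ys) (b2 (tdeg ys) (tdeg zs + 1) (F ys) (quad F zs)))"
    unfolding insertion_quad
    by (subst (1) quad_def)
       (auto simp: additive.sum[OF b1_add] leib short sum.distrib[symmetric] additive.add[OF b2_left]
          additive.add[OF b2_right] alt_add intro!: sum.cong)
  then show ?thesis using quad_b2_assoc by simp
qed

end

section \<open>Transfer along a contraction\<close>

locale contraction = shifted_dga b1 b2
  for b1 :: "int \<Rightarrow> 'a::ab_group_add \<Rightarrow> 'a" and b2 :: "int \<Rightarrow> int \<Rightarrow> 'a \<Rightarrow> 'a \<Rightarrow> 'a" +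
  fixes i :: "int \<Rightarrow> 'h::ab_group_add \<Rightarrow> 'a" and p :: "int \<Rightarrow> 'a \<Rightarrow> 'h" and h :: "int \<Rightarrow> 'a \<Rightarrow> 'a"
  assumes i_add: "additive (i s)" and p_add: "additive (p s)" and h_add: "additive (h s)"
    and b1_i: "b1 s (i s V) = 0"
    and p_b1: "p (s + 1) (b1 s T) = 0"
    and homotopy: "b1 (s + t) (h (s + t + 1) (b2 s t T Y))
           + h (s + t + 2) (b1 (s + t + 1) (b2 s t T Y))
         = i (s + t + 1) (p (s + t + 1) (b2 s t T Y)) - b2 s t T Y"
begin

definition unary :: "(int \<times> 'h) list \<Rightarrow> 'a" where
  "unary xs = (case xs of [u] \<Rightarrow> i (fst u) (snd u) | _ \<Rightarrow> 0)"

text \<open>Unfolding the recursion gives a sum over planar binary trees, with \<open>i\<close> at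
  the leaves, the product at the vertices and \<open>h\<close> after each product. The quadratic
  part is spelled out instead of being written as \<open>quad transfer_mor\<close>, so that the
  recursive calls are visibly on the two proper pieces of a cut.\<close>

function transfer_mor :: "(int \<times> 'h) list \<Rightarrow> 'a" where
  "transfer_mor xs = unary xs + h (tdeg xs + 1) (\<Sum>t\<in>splits2 xs.
     b2 (tdeg (fst t)) (tdeg (snd t)) (transfer_mor (fst t)) (transfer_mor (snd t)))"
  by auto
termination
  by (relation "measure length") (auto simp: splits2_def)

declare transfer_mor.simps [simp del]

lemma transfer_mor: "transfer_mor xs = unary xs + h (tdeg xs + 1) (quad transfer_mor xs)"
  by (subst transfer_mor.simps) (simp add: quad_def case_prod_unfold)

text \<open>The same trees with \<open>p\<close> in place of \<open>h\<close> at the root. A single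
  argument admits no product, which makes the structure minimal.\<close>

definition transfer_mu :: "(int \<times> 'h) list \<Rightarrow> 'h" where
  "transfer_mu xs = p (tdeg xs + 1) (quad transfer_mor xs)"

lemma unary_simps [simp]: "unary [] = 0" "unary [u] = i (fst u) (snd u)" "unary (u # v # xs) = 0"
  by (auto simp: unary_def)

lemma transfer_mor_single: "transfer_mor [u] = i (fst u) (snd u)"
  by (simp add: transfer_mor additive.zero[OF h_add])

lemma transfer_mu_single: "transfer_mu [u] = 0"
  by (simp add: transfer_mu_def additive.zero[OF p_add])

text \<open>The contraction assumes the homotopy identity on values of the product, because
  \<open>i\<close>, \<open>p\<close> and \<open>h\<close> will read only one homogeneous component
  of their argument and the identity may fail for elements with further components. By additivity it
  extends to \<open>quad F\<close>.\<close>

lemma quad_homotopy: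
  "b1 (tdeg xs) (h (tdeg xs + 1) (quad F xs)) + h (tdeg xs + 2) (b1 (tdeg xs + 1) (quad F xs))
     = i (tdeg xs + 1) (p (tdeg xs + 1) (quad F xs)) - quad F xs"
  unfolding quad_def additive.sum[OF b1_add] additive.sum[OF h_add] additive.sum[OF i_add]
    additive.sum[OF p_add] sum.distrib[symmetric] sum_subtractf[symmetric]
  by (intro sum.cong refl) (use homotopy in \<open>auto simp: splits2_def add.assoc\<close>)

lemma unary_nontrivial:
  assumes "us \<noteq> [] \<or> ws \<noteq> []"
  shows "unary (us @ v # ws) = 0"
  using assms by (cases us; cases "tl us"; cases ws) (auto simp: unary_def)

text \<open>The linear part accepts a single argument, so only the insertion that swallows all of
  \<open>xs\<close> survives.\<close>

lemma insertion_unary: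
  assumes "xs \<noteq> []"
  shows "insertion unary M xs = i (tdeg xs + 1) (M xs)"
proof -
  have "insertion unary M xs = (\<Sum>t\<in>{([], xs, [])}. case t of (us, vs, ws) \<Rightarrow>
          alt (tdeg us) (unary (us @ (tdeg vs + 1, M vs) # ws)))"
    unfolding insertion_def
  proof (rule sum.mono_neutral_right)
    show "\<forall>t\<in>splits3 xs - {([], xs, [])}. (case t of (us, vs, ws) \<Rightarrow>
          alt (tdeg us) (unary (us @ (tdeg vs + 1, M vs) # ws))) = 0"
    proof
      fix t assume "t \<in> splits3 xs - {([], xs, [])}"
      then obtain us vs ws where t: "t = (us, vs, ws)" "us @ vs @ ws = xs" "t \<noteq> ([], xs, [])"
        by (auto simp: splits3_def)
      then have "us \<noteq> [] \<or> ws \<noteq> []" by auto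
      then show "(case t of (us, vs, ws) \<Rightarrow> alt (tdeg us) (unary (us @ (tdeg vs + 1, M vs) # ws))) = 0"
        by (simp add: t(1) unary_nontrivial)
    qed
  qed (use assms in \<open>simp, simp add: splits3_def\<close>)
  then show ?thesis by simp
qed

text \<open>F = i + h Q is inserted into term by term. An insertion raises the total degree by one,
  which turns the index \<open>tdeg xs + 1\<close> of \<open>h\<close> into
  \<open>tdeg xs + 2\<close>.\<close>

lemma insertion_transfer_mor:
  assumes "xs \<noteq> []"
  shows "insertion transfer_mor M xs =
    i (tdeg xs + 1) (M xs) + h (tdeg xs + 2) (insertion (quad transfer_mor) M xs)"
proof -
  have "insertion transfer_mor M xs =
     insertion unary M xs + h (tdeg xs + 2) (insertion (quad transfer_mor) M xs)"
    unfolding insertion_def additive.sum[OF h_add] sum.distrib[symmetric]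
    by (intro sum.cong refl, subst transfer_mor)
       (auto simp: splits3_def alt_add additive.alt[OF h_add] ac_simps)
  then show ?thesis by (simp add: insertion_unary[OF assms])
qed

text \<open>Put Q = quad F. Since \<open>b1\<close> kills the image of \<open>i\<close>, the
  homotopy identity gives dF = dhQ = ipQ - Q - h dQ. By induction \<open>b1_quad\<close> applies, so
  dQ is minus the insertion of \<open>transfer_mu\<close> into Q. Hence dF + Q is \<open>i\<close>
  of \<open>transfer_mu\<close> plus \<open>h\<close> of that insertion, which is the insertion into
  F.\<close>

theorem transfer_mor_equation:
  "xs \<noteq> [] \<Longrightarrow> b1 (tdeg xs) (transfer_mor xs) + quad transfer_mor xs
      = insertion transfer_mor transfer_mu xs"
proof (induction xs rule: length_induct)
  case (1 xs)
  then have quad: "b1 (tdeg xs + 1) (quad transfer_mor xs)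
      + insertion (quad transfer_mor) transfer_mu xs = 0"
    by (intro b1_quad) auto
  have "b1 (tdeg xs) (unary xs) = 0"
    by (auto simp: b1_i additive.zero[OF b1_add] unary_def split: list.split)
  then have "b1 (tdeg xs) (transfer_mor xs) = b1 (tdeg xs) (h (tdeg xs + 1) (quad transfer_mor xs))"
    by (simp add: transfer_mor[of xs] additive.add[OF b1_add])
  then show ?case
    using quad quad_homotopy[of xs transfer_mor] insertion_transfer_mor[OF 1(2), of transfer_mu]
    by (simp add: transfer_mu_def[of xs] eq_neg_iff_add_eq_0[symmetric] additive.minus[OF h_add] diff_eq_eq)
qed

text \<open>As the structure is pQ, inserting it into itself is \<open>p\<close> of the insertion
  into Q, that is, \<open>p\<close> of -dQ, and \<open>p\<close> kills the image of
  \<open>b1\<close>.\<close>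

theorem transfer_mu_equation:
  assumes "xs \<noteq> []"
  shows "insertion transfer_mu transfer_mu xs = 0"
proof -
  have "insertion transfer_mu transfer_mu xs = p (tdeg xs + 2) (insertion (quad transfer_mor) transfer_mu xs)"
    unfolding insertion_def additive.sum[OF p_add]
    by (intro sum.cong refl)
       (auto simp: splits3_def transfer_mu_def[of "_ @ _"] additive.alt[OF p_add] ac_simps)
  also have "insertion (quad transfer_mor) transfer_mu xs = - b1 (tdeg xs + 1) (quad transfer_mor xs)"
    using b1_quad[of xs transfer_mor transfer_mu] transfer_mor_equation
    by (simp add: eq_neg_iff_add_eq_0 add.commute)
  also have "p (tdeg xs + 2) \<dots> = 0"
    using p_b1[of "tdeg xs + 1"] by (simp add: additive.minus[OF p_add] add.assoc)
  finally show ?thesis .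
qed

text \<open>\<open>c\<close> and \<open>c'\<close> stand for multiplication by one scalar on the two
  sides; additivity and homogeneity are combined so that a single induction covers both. In each cut
  the marked entry lies in exactly one factor, and the product is linear in that factor.\<close>

lemma transfer_linear:
  assumes scal: "\<And>s T Y. i s (c T + Y) = c' (i s T) + i s Y"
      "\<And>s T Y. p s (c' T + Y) = c (p s T) + p s Y"
      "\<And>s T Y. h s (c' T + Y) = c' (h s T) + h s Y"
      "\<And>s t T T' Y. b2 s t (c' T + T') Y = c' (b2 s t T Y) + b2 s t T' Y"
      "\<And>s t T Y Y'. b2 s t T (c' Y + Y') = c' (b2 s t T Y) + b2 s t T Y'"
    and c: "additive c" "additive c'"
  shows "transfer_mor (us @ (s, c T + Y) # ws) =
           c' (transfer_mor (us @ (s, T) # ws)) + transfer_mor (us @ (s, Y) # ws)" (is ?A)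
    and "transfer_mu (us @ (s, c T + Y) # ws) =
           c (transfer_mu (us @ (s, T) # ws)) + transfer_mu (us @ (s, Y) # ws)" (is ?B)
proof -
  have un: "unary (us @ (s, c T + Y) # ws) =
     c' (unary (us @ (s, T) # ws)) + unary (us @ (s, Y) # ws)" for us ws
  proof (cases "us = [] \<and> ws = []")
    case False
    then show ?thesis by (simp add: unary_nontrivial additive.zero[OF c(2)])
  qed (simp add: scal)
  have quad: "quad transfer_mor (us @ (s, c T + Y) # ws) =
      c' (quad transfer_mor (us @ (s, T) # ws)) + quad transfer_mor (us @ (s, Y) # ws)"
    if IH: "\<And>us' ws'. length (us' @ ws') < length (us @ ws) \<Longrightarrow>
       transfer_mor (us' @ (s, c T + Y) # ws') =
         c' (transfer_mor (us' @ (s, T) # ws')) + transfer_mor (us' @ (s, Y) # ws')" for us ws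
  proof -
    have "(\<Sum>t | fst t @ snd t = ws \<and> snd t \<noteq> []. b2 (s + (tdeg us + tdeg (fst t))) (tdeg (snd t))
              (transfer_mor (us @ (s, c T + Y) # fst t)) (transfer_mor (snd t))) =
          (\<Sum>t | fst t @ snd t = ws \<and> snd t \<noteq> [].
             c' (b2 (s + (tdeg us + tdeg (fst t))) (tdeg (snd t))
                   (transfer_mor (us @ (s, T) # fst t)) (transfer_mor (snd t))) +
             b2 (s + (tdeg us + tdeg (fst t))) (tdeg (snd t))
                   (transfer_mor (us @ (s, Y) # fst t)) (transfer_mor (snd t)))"
      by (intro sum.cong refl) (auto simp: IH scal)
    moreover have "(\<Sum>t | fst t @ snd t = us \<and> fst t \<noteq> []. b2 (tdeg (fst t)) (s + (tdeg ws + tdeg (snd t)))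
              (transfer_mor (fst t)) (transfer_mor (snd t @ (s, c T + Y) # ws))) =
          (\<Sum>t | fst t @ snd t = us \<and> fst t \<noteq> [].
             c' (b2 (tdeg (fst t)) (s + (tdeg ws + tdeg (snd t)))
                   (transfer_mor (fst t)) (transfer_mor (snd t @ (s, T) # ws))) +
             b2 (tdeg (fst t)) (s + (tdeg ws + tdeg (snd t)))
                   (transfer_mor (fst t)) (transfer_mor (snd t @ (s, Y) # ws)))"
      by (intro sum.cong refl) (auto simp: IH scal)
    ultimately show ?thesis
      unfolding quad_def sum_splits2_middle additive.add[OF c(2)] additive.sum[OF c(2)] case_prod_unfold
      by (simp add: sum.distrib ac_simps)
  qed
  have A: "transfer_mor (us @ (s, c T + Y) # ws) =
           c' (transfer_mor (us @ (s, T) # ws)) + transfer_mor (us @ (s, Y) # ws)" for us ws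
  proof (induction "us @ ws" arbitrary: us ws rule: length_induct)
    case 1
    have q: "quad transfer_mor (us @ (s, c T + Y) # ws) =
      c' (quad transfer_mor (us @ (s, T) # ws)) + quad transfer_mor (us @ (s, Y) # ws)"
      by (rule quad) (use 1 in blast)
    show ?case
      unfolding transfer_mor[of "_ @ _"] un q tdeg_simps fst_conv scal additive.add[OF c(2)] by simp
  qed
  then show ?A .
  show ?B
    unfolding transfer_mu_def quad[OF A] tdeg_simps fst_conv scal ..
qed

end

section \<open>Massey sums and gauge equivalence\<close>

text \<open>The closed intervals (i, j) of the list tile, in order, the half-open interval from
  \<open>p\<close> to \<open>r\<close>. With an excluded right end, empty lists and concatenations
  need no special treatment; hence the \<open>Suc q\<close> in \<open>parts\<close>.\<close>

fun chain :: "nat \<Rightarrow> (nat \<times> nat) list \<Rightarrow> nat \<Rightarrow> bool" where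
  "chain p [] r \<longleftrightarrow> p = r"
| "chain p ((i, j) # L) r \<longleftrightarrow> i = p \<and> i \<le> j \<and> chain (Suc j) L r"

definition parts :: "nat \<Rightarrow> nat \<Rightarrow> (nat \<times> nat) list set" where
  "parts p q = {L. chain p L (Suc q)}"

lemma chain_append: "chain p (L @ M) r \<longleftrightarrow> (\<exists>k. chain p L k \<and> chain k M r)"
  by (induction p L r rule: chain.induct) auto

lemma chain_le: "chain p L r \<Longrightarrow> p \<le> r"
  by (induction p L r rule: chain.induct) auto

lemma chain_less: "chain p L r \<Longrightarrow> L \<noteq> [] \<Longrightarrow> p < r"
  by (cases L) (fastforce dest: chain_le)+

lemma chain_refl: "chain p L p \<longleftrightarrow> L = []"
  using chain_less by fastforce

lemma chain_length: "chain p L r \<Longrightarrow> p + length L \<le> r"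
  by (induction p L r rule: chain.induct) auto

lemma chain_entries: "chain p L r \<Longrightarrow> (i, j) \<in> set L \<Longrightarrow> p \<le> i \<and> i \<le> j \<and> j < r"
  by (induction p L r rule: chain.induct) (auto dest: chain_le)

lemma chain_full: "chain p L (Suc q) \<Longrightarrow> (p, q) \<in> set L \<Longrightarrow> L = [(p, q)]"
proof (induction p L "Suc q" rule: chain.induct)
  case (2 p i j L)
  show ?case
  proof (cases "(p, q) \<in> set L")
    case True
    then show ?thesis using 2 chain_entries[of "Suc j" L "Suc q" p q] by auto
  next
    case False
    then show ?thesis using 2 by (auto simp: chain_refl)
  qed
qed auto

lemma finite_chains [simp]: "finite {L. chain p L r}"
proof (rule finite_subset)
  show "{L. chain p L r} \<subseteq> {L. set L \<subseteq> {p..r} \<times> {p..r} \<and> length L \<le> r}"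
    using chain_length chain_entries by fastforce
qed (simp add: finite_lists_length_le)

lemma finite_parts [simp]: "finite (parts p q)"
  by (simp add: parts_def)

lemma parts_ne_Nil: "p \<le> q \<Longrightarrow> L \<in> parts p q \<Longrightarrow> L \<noteq> []"
  by (auto simp: parts_def)

lemma parts_same: "parts p p = {[(p, p)]}"
proof -
  have "L = [(p, p)]" if "chain p L (Suc p)" for L
  proof -
    have "L \<noteq> []" using that by auto
    then obtain i j M where "L = (i, j) # M" by (metis neq_Nil_conv surj_pair)
    then have L: "L = (p, j) # M" "p \<le> j" "chain (Suc j) M (Suc p)" using that by auto
    then have "j = p" using chain_le by fastforce
    then show ?thesis using L chain_refl by simp
  qed
  then show ?thesis by (auto simp: parts_def)
qed

text \<open>The reason why a Massey sum over an interval sees only entries on strictly smaller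
  intervals, so that systems can be built by induction on length.\<close>

lemma parts_proper:
  assumes "L \<in> parts p q" "L \<noteq> [(p, q)]" "(i, j) \<in> set L"
  shows "p \<le> i \<and> i \<le> j \<and> j \<le> q \<and> (i, j) \<noteq> (p, q)"
  using assms chain_entries[of p L "Suc q" i j] chain_full[of p L q] by (auto simp: parts_def)

section \<open>Sums indexed by interval partitions\<close>

definition args :: "(nat \<Rightarrow> nat \<Rightarrow> int) \<Rightarrow> (nat \<Rightarrow> nat \<Rightarrow> 'h) \<Rightarrow> (nat \<times> nat) list \<Rightarrow> (int \<times> 'h) list" where
  "args s x L = map (\<lambda>(i, j). (s i j, x i j)) L"

lemma args_simps [simp]: "args s x [] = []" "args s x ((i, j) # L) = (s i j, x i j) # args s x L"
  "args s x (L @ M) = args s x L @ args s x M" "args s x L = [] \<longleftrightarrow> L = []"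
  "length (args s x L) = length L"
  by (auto simp: args_def)

lemma args_cong: "(\<And>i j. (i, j) \<in> set L \<Longrightarrow> x i j = y i j) \<Longrightarrow> args s x L = args s y L"
  by (auto simp: args_def)

text \<open>Degrees that add along adjacent intervals make the total degree independent of the
  partition, so all terms of a Massey sum live in one component.\<close>

lemma tdeg_args:
  assumes "\<And>p j q. p \<le> j \<Longrightarrow> j < q \<Longrightarrow> s p q = s p j + s (Suc j) q"
  shows "chain p L (Suc q) \<Longrightarrow> p \<le> q \<Longrightarrow> tdeg (args s x L) = s p q"
proof (induction p L "Suc q" rule: chain.induct)
  case (2 p i j L)
  show ?case
  proof (cases "L = []")
    case False
    then have "j < q" using 2 chain_less by fastforce
    then show ?thesis using 2 assms[of p j q] by auto
  qed (use 2 in auto)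
qed auto

text \<open>Generic in the operation: \<open>m\<close> gives the sums S of the minimal model, the
  operation of the dga gives the curvature, and \<open>F\<close> gives the nonlinear part of the
  image of a system.\<close>

definition massey :: "((int \<times> 'h) list \<Rightarrow> 'b::ab_group_add) \<Rightarrow> (nat \<Rightarrow> nat \<Rightarrow> int) \<Rightarrow>
    (nat \<Rightarrow> nat \<Rightarrow> 'h) \<Rightarrow> nat \<Rightarrow> nat \<Rightarrow> 'b" where
  "massey \<Phi> s x p q = (\<Sum>L\<in>parts p q - {[(p, q)]}. \<Phi> (args s x L))"

lemma massey_cong:
  assumes "\<And>i j. p \<le> i \<Longrightarrow> i \<le> j \<Longrightarrow> j \<le> q \<Longrightarrow> (i, j) \<noteq> (p, q) \<Longrightarrow> x i j = y i j"
  shows "massey \<Phi> s x p q = massey \<Phi> s y p q"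
  unfolding massey_def
  by (intro sum.cong refl arg_cong[of _ _ \<Phi>] args_cong assms) (auto dest: parts_proper)

lemma massey_same: "massey \<Phi> s x p p = 0"
  by (simp add: massey_def parts_same)

lemma sum_parts:
  assumes "p \<le> q"
  shows "(\<Sum>L\<in>parts p q. \<Phi> (args s x L)) = \<Phi> [(s p q, x p q)] + massey \<Phi> s x p q"
  unfolding massey_def using assms
  by (subst sum.remove[of _ "[(p, q)]"]) (auto simp: parts_def)

text \<open>Cutting a partition into two nonempty pieces amounts to choosing the last index
  \<open>j\<close> of the left piece, which is the right end of its last block, and a partition on
  either side.\<close>

lemma sum_split_parts:
  fixes G :: "(nat \<times> nat) list \<Rightarrow> (nat \<times> nat) list \<Rightarrow> 'b::comm_monoid_add"
  shows "(\<Sum>L\<in>parts p q. \<Sum>(U, V)\<in>splits2 L. G U V) =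
    (\<Sum>j\<in>{p..<q}. \<Sum>U\<in>parts p j. \<Sum>V\<in>parts (Suc j) q. G U V)"
proof -
  have "(\<Sum>L\<in>parts p q. \<Sum>(U, V)\<in>splits2 L. G U V) =
      (\<Sum>(L, U, V)\<in>Sigma (parts p q) splits2. G U V)"
    by (subst sum.Sigma) auto
  also have "\<dots> = (\<Sum>(j, U, V)\<in>Sigma {p..<q} (\<lambda>j. parts p j \<times> parts (Suc j) q). G U V)"
  proof (rule sum.reindex_bij_witness[where
        j = "\<lambda>(L, U, V). (snd (last U), U, V)" and i = "\<lambda>(j, U, V). (U @ V, U, V)"])
    fix t assume "t \<in> Sigma (parts p q) splits2"
    then obtain U V k where t: "t = (U @ V, U, V)" "U \<noteq> []" "V \<noteq> []" "chain p U k" "chain k V (Suc q)"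
      by (auto simp: splits2_def parts_def chain_append)
    obtain U' a b where U: "U = U' @ [(a, b)]" using t(2) by (metis rev_exhaust surj_pair)
    then have k: "k = Suc b" "p \<le> b" using t(4) chain_le by (fastforce simp: chain_append)+
    have "b < q" using chain_less[OF t(5,3)] k by auto
    with t U k show "(case case t of (L, U, V) \<Rightarrow> (snd (last U), U, V) of (j, U, V) \<Rightarrow> (U @ V, U, V)) = t"
      "(case t of (L, U, V) \<Rightarrow> (snd (last U), U, V)) \<in> Sigma {p..<q} (\<lambda>j. parts p j \<times> parts (Suc j) q)"
      "(case case t of (L, U, V) \<Rightarrow> (snd (last U), U, V) of (j, U, V) \<Rightarrow> G U V) = (case t of (L, U, V) \<Rightarrow> G U V)"
      by (auto simp: parts_def)
  next
    fix t assume "t \<in> Sigma {p..<q} (\<lambda>j. parts p j \<times> parts (Suc j) q)"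
    then obtain j U V where t: "t = (j, U, V)" "p \<le> j" "j < q" "chain p U (Suc j)" "chain (Suc j) V (Suc q)"
      by (auto simp: parts_def)
    have "U \<noteq> []" "V \<noteq> []" using t by auto
    obtain U' a b where U: "U = U' @ [(a, b)]" using \<open>U \<noteq> []\<close> by (metis rev_exhaust surj_pair)
    then have "b = j" using t(4) by (auto simp: chain_append)
    with t U \<open>V \<noteq> []\<close> show "(case case t of (j, U, V) \<Rightarrow> (U @ V, U, V) of (L, U, V) \<Rightarrow> (snd (last U), U, V)) = t"
      by auto
    show "(case t of (j, U, V) \<Rightarrow> (U @ V, U, V)) \<in> Sigma (parts p q) splits2"
      using t \<open>U \<noteq> []\<close> \<open>V \<noteq> []\<close> by (auto simp: parts_def splits2_def chain_append simp del: append_assoc)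
  qed
  also have "\<dots> = (\<Sum>j\<in>{p..<q}. \<Sum>(U, V)\<in>parts p j \<times> parts (Suc j) q. G U V)"
    by (subst sum.Sigma) (auto simp: case_prod_unfold)
  finally show ?thesis by (simp add: sum.cartesian_product)
qed

lemma sum_splits2_map:
  "sum G (splits2 (map f L)) = (\<Sum>(U, V)\<in>splits2 L. G (map f U, map f V))"
proof -
  have "splits2 (map f L) = (\<lambda>(U, V). (map f U, map f V)) ` splits2 L"
    by (force simp: splits2_def append_eq_map_conv)
  moreover have "inj_on (\<lambda>(U, V). (map f U, map f V)) (splits2 L)"
    by (auto simp: inj_on_def splits2_def dest: map_eq_imp_length_eq)
  ultimately show ?thesis by (simp add: sum.reindex case_prod_unfold)
qed

lemma sum_splits3_map:
  "sum G (splits3 (map f L)) = (\<Sum>(U, V, W)\<in>splits3 L. G (map f U, map f V, map f W))"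
proof -
  have "splits3 (map f L) = (\<lambda>(U, V, W). (map f U, map f V, map f W)) ` splits3 L"
  proof
    show "splits3 (map f L) \<subseteq> (\<lambda>(U, V, W). (map f U, map f V, map f W)) ` splits3 L"
    proof
      fix t assume "t \<in> splits3 (map f L)"
      then obtain us vs ws where t: "t = (us, vs, ws)" "us @ vs @ ws = map f L" "vs \<noteq> []"
        by (auto simp: splits3_def)
      then obtain U V W where "L = U @ V @ W" "us = map f U" "vs = map f V" "ws = map f W"
        by (auto simp: append_eq_map_conv)
      with t show "t \<in> (\<lambda>(U, V, W). (map f U, map f V, map f W)) ` splits3 L"
        by (intro image_eqI[of _ _ "(U, V, W)"]) (auto simp: splits3_def)
    qed
  qed (auto simp: splits3_def)
  moreover have "inj_on (\<lambda>(U, V, W). (map f U, map f V, map f W)) (splits3 L)"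
  proof (clarsimp simp: inj_on_def splits3_def)
    fix U V W U' V' W'
    assume "U' @ V' @ W' = U @ V @ W" "map f U = map f U'" "map f V = map f V'"
    moreover from this have "length U' = length U" "length V' = length V" by (metis length_map)+
    ultimately show "U = U' \<and> V = V' \<and> W = W'" by simp
  qed
  ultimately show ?thesis by (simp add: sum.reindex case_prod_unfold)
qed

text \<open>Regrouping by what an insertion leaves untouched: for fixed \<open>U\<close> and
  \<open>W\<close> the middle piece ranges over all partitions of the interval from \<open>a\<close>
  to \<open>b\<close> between them. Summing an operation over these is what produces the Massey sum
  of that interval.\<close>

lemma sum_splits3_parts:
  fixes G :: "(nat \<times> nat) list \<Rightarrow> (nat \<times> nat) list \<Rightarrow> (nat \<times> nat) list \<Rightarrow> 'b::comm_monoid_add"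
  shows "(\<Sum>L\<in>parts p q. \<Sum>(U, V, W)\<in>splits3 L. G U V W) =
    (\<Sum>(a, b, U, W)\<in>{(a, b, U, W). chain p U a \<and> a \<le> b \<and> chain (Suc b) W (Suc q)}.
       \<Sum>V\<in>parts a b. G U V W)" (is "_ = (\<Sum>(a, b, U, W)\<in>?Q. _)")
proof -
  let ?j = "\<lambda>(L :: (nat \<times> nat) list, U :: (nat \<times> nat) list, V :: (nat \<times> nat) list, W :: (nat \<times> nat) list).
      ((fst (hd V), snd (last V), U, W), V)"
  let ?i = "\<lambda>((a :: nat, b :: nat, U :: (nat \<times> nat) list, W :: (nat \<times> nat) list), V :: (nat \<times> nat) list).
      (U @ V @ W, U, V, W)"
  have fin: "finite ?Q"
  proof -
    have "chain p U a \<and> a \<le> b \<and> chain (Suc b) W (Suc q) \<Longrightarrow> a \<le> q \<and> b \<le> q" for U W a b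
      using chain_le[of "Suc b" W "Suc q"] by auto
    then have "?Q \<subseteq> Sigma {..q} (\<lambda>a. Sigma {..q} (\<lambda>b. {U. chain p U a} \<times> {W. chain (Suc b) W (Suc q)}))"
      by auto
    then show ?thesis by (rule finite_subset) auto
  qed
  have "(\<Sum>L\<in>parts p q. \<Sum>(U, V, W)\<in>splits3 L. G U V W) =
      (\<Sum>(L, U, V, W)\<in>Sigma (parts p q) splits3. G U V W)"
    by (subst sum.Sigma) auto
  also have "\<dots> = (\<Sum>((a, b, U, W), V)\<in>Sigma ?Q (\<lambda>(a, b, U, W). parts a b). G U V W)"
  proof (rule sum.reindex_bij_witness[where j = ?j and i = ?i])
    fix t assume "t \<in> Sigma (parts p q) splits3"
    then obtain U V W a k where t: "t = (U @ V @ W, U, V, W)" "V \<noteq> []" "chain p U a" "chain a V k"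
        "chain k W (Suc q)"
      by (auto simp: splits3_def parts_def chain_append)
    obtain V' c b where V: "V = V' @ [(c, b)]" using t(2) by (metis rev_exhaust surj_pair)
    have k: "k = Suc b" "a \<le> b" using t(4) V chain_le by (fastforce simp: chain_append)+
    have "fst (hd V) = a" using t(2,4) by (cases V) auto
    with t V k show "?i (?j t) = t" "?j t \<in> Sigma ?Q (\<lambda>(a, b, U, W). parts a b)"
      "(\<lambda>((a, b, U, W), V). G U V W) (?j t) = (case t of (L, U, V, W) \<Rightarrow> G U V W)"
      by (auto simp: parts_def)
  next
    fix t assume "t \<in> Sigma ?Q (\<lambda>(a, b, U, W). parts a b)"
    then obtain a b U V W where t: "t = ((a, b, U, W), V)" "chain p U a" "a \<le> b"
        "chain (Suc b) W (Suc q)" "chain a V (Suc b)"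
      by (auto simp: parts_def)
    have "V \<noteq> []" using t by auto
    obtain V' c e where V: "V = V' @ [(c, e)]" using \<open>V \<noteq> []\<close> by (metis rev_exhaust surj_pair)
    then have "e = b" using t(5) by (auto simp: chain_append)
    moreover have "fst (hd V) = a" using t(5) \<open>V \<noteq> []\<close> by (cases V) auto
    ultimately show "?j (?i t) = t"
      using t V by auto
    show "?i t \<in> Sigma (parts p q) splits3"
      using t \<open>V \<noteq> []\<close> by (auto simp: parts_def splits3_def chain_append simp del: append_assoc)
  qed
  also have "\<dots> = (\<Sum>(a, b, U, W)\<in>?Q. \<Sum>V\<in>parts a b. G U V W)"
  proof -
    have "(\<Sum>t\<in>?Q. \<Sum>V\<in>(\<lambda>(a, b, U, W). parts a b) t. (\<lambda>(a, b, U, W) V. G U V W) t V) =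
       (\<Sum>(t, V)\<in>Sigma ?Q (\<lambda>(a, b, U, W). parts a b). (\<lambda>(a, b, U, W) V. G U V W) t V)"
      using fin by (intro sum.Sigma) auto
    then show ?thesis by (simp add: case_prod_unfold)
  qed
  finally show ?thesis .
qed

lemma triangle_sum:
  "(\<Sum>j\<in>{p..<q}. \<Sum>k\<in>{p..<j}. G k j) = (\<Sum>k\<in>{p..<q::nat}. \<Sum>j\<in>{Suc k..<q}. (G k j :: 'b::comm_monoid_add))"
  by (subst (1 2) sum.Sigma) (auto intro!: sum.reindex_bij_witness[of _ prod.swap prod.swap])

section \<open>Curvature and gauge transformations\<close>

context shifted_dga
begin

text \<open>An entry of the square of the matrix \<open>y\<close>, the quadratic term of the
  Maurer-Cartan equation.\<close>

definition curv :: "(nat \<Rightarrow> nat \<Rightarrow> int) \<Rightarrow> (nat \<Rightarrow> nat \<Rightarrow> 'a) \<Rightarrow> nat \<Rightarrow> nat \<Rightarrow> 'a" where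
  "curv s y p q = (\<Sum>j\<in>{p..<q}. b2 (s p j) (s (Suc j) q) (y p j) (y (Suc j) q))"

text \<open>
  Up to signs, in the algebra of upper triangular matrices \<open>y'\<close> is the gauge transform of \<open>y\<close>
  by \<open>g\<close> when \<open>y' = y + dg + y g + g y'\<close>; the last two terms, which involve shorter intervals
  only, are the gauge term below.
\<close>

definition gauge :: "(nat \<Rightarrow> nat \<Rightarrow> int) \<Rightarrow> (nat \<Rightarrow> nat \<Rightarrow> 'a) \<Rightarrow> (nat \<Rightarrow> nat \<Rightarrow> 'a) \<Rightarrow>
    (nat \<Rightarrow> nat \<Rightarrow> 'a) \<Rightarrow> nat \<Rightarrow> nat \<Rightarrow> 'a" where
  "gauge s g y y' p q = (\<Sum>j\<in>{p..<q}.
     alt (s p j) (b2 (s p j) (s (Suc j) q - 1) (y p j) (g (Suc j) q)) +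
     b2 (s p j - 1) (s (Suc j) q) (g p j) (y' (Suc j) q))"

lemma curv_same [simp]: "curv s y p p = 0" and gauge_same [simp]: "gauge s g y y' p p = 0"
  by (auto simp: curv_def gauge_def)

lemma curv_cong:
  assumes "\<And>i j. p \<le> i \<Longrightarrow> i \<le> j \<Longrightarrow> j \<le> q \<Longrightarrow> (i, j) \<noteq> (p, q) \<Longrightarrow> x i j = y i j"
  shows "curv s x p q = curv s y p q"
  unfolding curv_def using assms by (intro sum.cong refl) simp

lemma gauge_cong:
  assumes "\<And>i j. p \<le> i \<Longrightarrow> i \<le> j \<Longrightarrow> j \<le> q \<Longrightarrow> (i, j) \<noteq> (p, q) \<Longrightarrow> g i j = h i j"
    and "\<And>i j. p \<le> i \<Longrightarrow> i \<le> j \<Longrightarrow> j \<le> q \<Longrightarrow> (i, j) \<noteq> (p, q) \<Longrightarrow> y i j = z i j"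
    and "\<And>i j. p \<le> i \<Longrightarrow> i \<le> j \<Longrightarrow> j \<le> q \<Longrightarrow> (i, j) \<noteq> (p, q) \<Longrightarrow> y' i j = z' i j"
  shows "gauge s g y y' p q = gauge s h z z' p q"
  unfolding gauge_def using assms by (intro sum.cong refl) simp

text \<open>In matrix notation and up to signs, put G = yg + gy', so that y' = y + dg + G. Then y'y'
  - yy = y(y' - y) + (y' - y)y'. Substituting for y' - y leaves y dg + dg y' + yyg + gy'y', because
  the two terms y g y' cancel, and this is -dG by the Leibniz rule and the equations for y and y'.
  At (p, q) the equation of \<open>y\<close> enters on initial intervals and that of
  \<open>y'\<close> on final ones.\<close>

lemma gauge_curv:
  assumes s: "\<And>p j q. p \<le> j \<Longrightarrow> j < q \<Longrightarrow> s p q = s p j + s (Suc j) q"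
    and mc: "\<And>j. p \<le> j \<Longrightarrow> j < q \<Longrightarrow> b1 (s p j) (y p j) = - curv s y p j"
    and mc': "\<And>j. p \<le> j \<Longrightarrow> j < q \<Longrightarrow> b1 (s (Suc j) q) (y' (Suc j) q) = - curv s y' (Suc j) q"
    and left: "\<And>j. p \<le> j \<Longrightarrow> j < q \<Longrightarrow>
        y' p j = y p j + b1 (s p j - 1) (g p j) + gauge s g y y' p j"
    and right: "\<And>j. p \<le> j \<Longrightarrow> j < q \<Longrightarrow>
        y' (Suc j) q = y (Suc j) q + b1 (s (Suc j) q - 1) (g (Suc j) q) + gauge s g y y' (Suc j) q"
  shows "b1 (s p q) (gauge s g y y' p q) + curv s y' p q = curv s y p q"
proof -
  let ?I = "{p..<q}"
  \<comment> \<open>The three triple products are bracketed to the left; \<open>b2_b2\<close> brings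
    the opposite bracketing, which arises from \<open>y\<close> times a gauge term and from
    \<open>g\<close> times a curvature, to this form.\<close>
  define yyg where "yyg k j = b2 (s p j + 1) (s (Suc j) q - 1)
      (b2 (s p k) (s (Suc k) j) (y p k) (y (Suc k) j)) (g (Suc j) q)" for k j
  define ygy where "ygy k j = b2 (s p j) (s (Suc j) q)
      (b2 (s p k) (s (Suc k) j - 1) (y p k) (g (Suc k) j)) (y' (Suc j) q)" for k j
  define gyy where "gyy k j = b2 (s p j) (s (Suc j) q)
      (b2 (s p k - 1) (s (Suc k) j) (g p k) (y' (Suc k) j)) (y' (Suc j) q)" for k j
  have b1g: "b1 (s p q) (gauge s g y y' p q) =
      (\<Sum>j\<in>?I. alt (s p j) (\<Sum>k\<in>{p..<j}. yyg k j)
        - b2 (s p j) (s (Suc j) q) (y p j) (b1 (s (Suc j) q - 1) (g (Suc j) q))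
        - b2 (s p j) (s (Suc j) q) (b1 (s p j - 1) (g p j)) (y' (Suc j) q)
        - alt (s p j) (\<Sum>k\<in>{Suc j..<q}. b2 (s p j - 1) (s (Suc j) q + 1) (g p j)
             (b2 (s (Suc j) k) (s (Suc k) q) (y' (Suc j) k) (y' (Suc k) q))))"
    unfolding gauge_def additive.sum[OF b1_add] additive.add[OF b1_add] additive.alt[OF b1_add]
  proof (intro sum.cong refl)
    fix j assume "j \<in> ?I"
    then have j: "p \<le> j" "j < q" by auto
    have e: "s p q = s p j + s (Suc j) q" using s j by blast
    have 1: "b1 (s p q) (b2 (s p j) (s (Suc j) q - 1) (y p j) (g (Suc j) q)) =
        (\<Sum>k\<in>{p..<j}. yyg k j)
        - alt (s p j) (b2 (s p j) (s (Suc j) q) (y p j) (b1 (s (Suc j) q - 1) (g (Suc j) q)))"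
      using b1_b2[of "s p j" "s (Suc j) q - 1" "y p j" "g (Suc j) q"]
      unfolding mc[OF j] curv_def yyg_def
      by (simp add: e additive.minus[OF b2_left] additive.sum[OF b2_left] add_eq_0_iff2 algebra_simps)
    have 2: "b1 (s p q) (b2 (s p j - 1) (s (Suc j) q) (g p j) (y' (Suc j) q)) =
        - b2 (s p j) (s (Suc j) q) (b1 (s p j - 1) (g p j)) (y' (Suc j) q)
        - alt (s p j) (\<Sum>k\<in>{Suc j..<q}. b2 (s p j - 1) (s (Suc j) q + 1) (g p j)
             (b2 (s (Suc j) k) (s (Suc k) q) (y' (Suc j) k) (y' (Suc k) q)))"
      using b1_b2[of "s p j - 1" "s (Suc j) q" "g p j" "y' (Suc j) q"]
      unfolding mc'[OF j] curv_def
      by (simp add: e additive.minus[OF b2_right] additive.sum[OF b2_right] alt_minus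
            eq_diff_eq eq_neg_iff_add_eq_0 ac_simps)
    show "alt (s p j) (b1 (s p q) (b2 (s p j) (s (Suc j) q - 1) (y p j) (g (Suc j) q))) +
      b1 (s p q) (b2 (s p j - 1) (s (Suc j) q) (g p j) (y' (Suc j) q)) =
        alt (s p j) (\<Sum>k\<in>{p..<j}. yyg k j)
        - b2 (s p j) (s (Suc j) q) (y p j) (b1 (s (Suc j) q - 1) (g (Suc j) q))
        - b2 (s p j) (s (Suc j) q) (b1 (s p j - 1) (g p j)) (y' (Suc j) q)
        - alt (s p j) (\<Sum>k\<in>{Suc j..<q}. b2 (s p j - 1) (s (Suc j) q + 1) (g p j)
             (b2 (s (Suc j) k) (s (Suc k) q) (y' (Suc j) k) (y' (Suc k) q)))"
      unfolding 1 2 by (simp add: alt_diff)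
  qed
  have c1: "curv s y' p q - curv s y p q =
     (\<Sum>j\<in>?I. b2 (s p j) (s (Suc j) q) (y p j) (b1 (s (Suc j) q - 1) (g (Suc j) q))
        + b2 (s p j) (s (Suc j) q) (b1 (s p j - 1) (g p j)) (y' (Suc j) q)
        + b2 (s p j) (s (Suc j) q) (y p j) (gauge s g y y' (Suc j) q)
        + b2 (s p j) (s (Suc j) q) (gauge s g y y' p j) (y' (Suc j) q))"
    unfolding curv_def sum_subtractf[symmetric]
  proof (intro sum.cong refl)
    fix j assume "j \<in> ?I"
    then have j: "p \<le> j" "j < q" by auto
    have r: "b2 (s p j) (s (Suc j) q) (y p j) (y' (Suc j) q) = b2 (s p j) (s (Suc j) q) (y p j) (y (Suc j) q)
       + b2 (s p j) (s (Suc j) q) (y p j) (b1 (s (Suc j) q - 1) (g (Suc j) q))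
       + b2 (s p j) (s (Suc j) q) (y p j) (gauge s g y y' (Suc j) q)"
      by (subst right[OF j]) (simp add: additive.add[OF b2_right])
    show "b2 (s p j) (s (Suc j) q) (y' p j) (y' (Suc j) q) - b2 (s p j) (s (Suc j) q) (y p j) (y (Suc j) q)
      = b2 (s p j) (s (Suc j) q) (y p j) (b1 (s (Suc j) q - 1) (g (Suc j) q))
        + b2 (s p j) (s (Suc j) q) (b1 (s p j - 1) (g p j)) (y' (Suc j) q)
        + b2 (s p j) (s (Suc j) q) (y p j) (gauge s g y y' (Suc j) q)
        + b2 (s p j) (s (Suc j) q) (gauge s g y y' p j) (y' (Suc j) q)"
      by (subst left[OF j]) (simp add: additive.add[OF b2_left] r)
  qed
  have right_gauge: "(\<Sum>j\<in>?I. b2 (s p j) (s (Suc j) q) (y p j) (gauge s g y y' (Suc j) q)) =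
     (\<Sum>j\<in>?I. \<Sum>k\<in>{Suc j..<q}. - alt (s p k) (yyg j k) - alt (s p j) (ygy j k))"
    unfolding gauge_def additive.sum[OF b2_right]
  proof (intro sum.cong refl)
    fix j k assume "j \<in> ?I" "k \<in> {Suc j..<q}"
    then have e: "s p k = s p j + s (Suc j) k" "s (Suc j) q = s (Suc j) k + s (Suc k) q"
      using s[of p j k] s[of "Suc j" k q] by auto
    have 1: "b2 (s p j) (s (Suc j) q) (y p j) (b2 (s (Suc j) k) (s (Suc k) q - 1) (y (Suc j) k) (g (Suc k) q))
       = - alt (s p j) (yyg j k)"
      using arg_cong[OF b2_b2[of "s p j" "s (Suc j) k" "s (Suc k) q - 1" "y p j" "y (Suc j) k" "g (Suc k) q"],
          of "alt (s p j)"]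
      by (simp add: yyg_def e alt_add add_eq_0_iff2)
    have 2: "b2 (s p j) (s (Suc j) q) (y p j) (b2 (s (Suc j) k - 1) (s (Suc k) q) (g (Suc j) k) (y' (Suc k) q))
       = - alt (s p j) (ygy j k)"
      using arg_cong[OF b2_b2[of "s p j" "s (Suc j) k - 1" "s (Suc k) q" "y p j" "g (Suc j) k" "y' (Suc k) q"],
          of "alt (s p j)"]
      by (simp add: ygy_def e alt_add add_eq_0_iff2)
    show "b2 (s p j) (s (Suc j) q) (y p j)
          (alt (s (Suc j) k) (b2 (s (Suc j) k) (s (Suc k) q - 1) (y (Suc j) k) (g (Suc k) q)) +
           b2 (s (Suc j) k - 1) (s (Suc k) q) (g (Suc j) k) (y' (Suc k) q))
       = - alt (s p k) (yyg j k) - alt (s p j) (ygy j k)"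
      by (simp add: additive.add[OF b2_right] additive.alt[OF b2_right] 1 2 alt_minus e(1) add.commute)
  qed
  have left_gauge: "(\<Sum>j\<in>?I. b2 (s p j) (s (Suc j) q) (gauge s g y y' p j) (y' (Suc j) q)) =
     (\<Sum>j\<in>?I. \<Sum>k\<in>{p..<j}. alt (s p k) (ygy k j) + gyy k j)"
    unfolding gauge_def additive.sum[OF b2_left] additive.add[OF b2_left] additive.alt[OF b2_left]
      ygy_def gyy_def ..
  have last: "(\<Sum>j\<in>?I. alt (s p j) (\<Sum>k\<in>{Suc j..<q}. b2 (s p j - 1) (s (Suc j) q + 1) (g p j)
             (b2 (s (Suc j) k) (s (Suc k) q) (y' (Suc j) k) (y' (Suc k) q)))) =
     (\<Sum>j\<in>?I. \<Sum>k\<in>{Suc j..<q}. gyy j k)"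
    unfolding alt_sum
  proof (intro sum.cong refl)
    fix j k assume "j \<in> ?I" "k \<in> {Suc j..<q}"
    then have e: "s p k = s p j + s (Suc j) k" "s (Suc j) q = s (Suc j) k + s (Suc k) q"
      using s[of p j k] s[of "Suc j" k q] by auto
    show "alt (s p j) (b2 (s p j - 1) (s (Suc j) q + 1) (g p j)
             (b2 (s (Suc j) k) (s (Suc k) q) (y' (Suc j) k) (y' (Suc k) q))) = gyy j k"
      using b2_b2[of "s p j - 1" "s (Suc j) k" "s (Suc k) q" "g p j" "y' (Suc j) k" "y' (Suc k) q"]
      by (simp add: gyy_def e)
  qed
  let ?y = "\<Sum>j\<in>?I. b2 (s p j) (s (Suc j) q) (y p j) (b1 (s (Suc j) q - 1) (g (Suc j) q))"
    and ?g = "\<Sum>j\<in>?I. b2 (s p j) (s (Suc j) q) (b1 (s p j - 1) (g p j)) (y' (Suc j) q)"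
    and ?yyg = "\<Sum>j\<in>?I. \<Sum>k\<in>{Suc j..<q}. alt (s p k) (yyg j k)"
    and ?gyy = "\<Sum>j\<in>?I. \<Sum>k\<in>{Suc j..<q}. gyy j k"
  have e1: "curv s y' p q = curv s y p q + (?y + ?g - ?yyg + ?gyy)"
    using c1 unfolding sum.distrib right_gauge left_gauge triangle_sum
    by (simp add: sum.distrib sum_subtractf sum_negf diff_eq_eq)
  have e2: "b1 (s p q) (gauge s g y y' p q) = ?yyg - ?y - ?g - ?gyy"
    unfolding b1g sum_subtractf last by (simp add: alt_sum triangle_sum)
  show ?thesis unfolding e1 e2 by simp
qed

end

section \<open>Defining systems along a morphism into a dga\<close>

locale a_inf_into_dga = shifted_dga b1 b2
  for b1 :: "int \<Rightarrow> 'a::ab_group_add \<Rightarrow> 'a" and b2 :: "int \<Rightarrow> int \<Rightarrow> 'a \<Rightarrow> 'a \<Rightarrow> 'a" +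
  fixes m :: "(int \<times> 'h::ab_group_add) list \<Rightarrow> 'h" and F :: "(int \<times> 'h) list \<Rightarrow> 'a"
  assumes F_add: "additive (\<lambda>T. F (us @ (s, T) # ws))"
    and m_single: "m [u] = 0"
    and morphism: "xs \<noteq> [] \<Longrightarrow> insertion F m xs = b1 (tdeg xs) (F xs) + quad F xs"
begin

lemma F_zero: "F (us @ (s, 0) # ws) = 0"
  by (rule additive.zero[OF F_add])

lemma F1_zero: "F [(s, 0)] = 0"
  using F_zero[of "[]" s "[]"] by simp

text \<open>On one argument the morphism equation says that F_1 commutes with the differentials, and
  that of the source is zero.\<close>

lemma b1_F1: "b1 s (F [(s, T)]) = 0"
proof -
  have "splits3 [(s, T)] = {([], [(s, T)], [])}"
    by (auto simp: splits3_def append_eq_Cons_conv)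
  then show ?thesis using morphism[of "[(s, T)]"] by (simp add: insertion_def m_single F1_zero)
qed

text \<open>The entry \<open>x p q\<close> itself enters through the linear term alone; the rest
  depends on smaller intervals. An inductive construction can therefore adjust the image at (p, q)
  by a value of F_1.\<close>

definition push :: "(nat \<Rightarrow> nat \<Rightarrow> int) \<Rightarrow> (nat \<Rightarrow> nat \<Rightarrow> 'h) \<Rightarrow> nat \<Rightarrow> nat \<Rightarrow> 'a" where
  "push s x p q = F [(s p q, x p q)] + massey F s x p q"

lemma push_same: "push s x p p = F [(s p p, x p p)]"
  by (simp add: push_def massey_same)

lemma push_sum: "p \<le> q \<Longrightarrow> push s x p q = (\<Sum>L\<in>parts p q. F (args s x L))"
  by (simp add: push_def sum_parts)

lemma massey_m: "p \<le> q \<Longrightarrow> (\<Sum>L\<in>parts p q. m (args s x L)) = massey m s x p q"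
  by (simp add: sum_parts m_single)

text \<open>The morphism equation is summed over all partitions of the interval. The target side
  adds up to the differential of \<open>push\<close> plus its curvature. On the source side the
  inserted values add up to the Massey sums of subintervals; those of proper subintervals vanish,
  which leaves F_1 of the Massey sum of the whole interval.\<close>

lemma push_equation:
  assumes s: "\<And>p j q. p \<le> j \<Longrightarrow> j < q \<Longrightarrow> s p q = s p j + s (Suc j) q"
    and "p \<le> q"
    and zero: "\<And>i j. p \<le> i \<Longrightarrow> i < j \<Longrightarrow> j \<le> q \<Longrightarrow> (i, j) \<noteq> (p, q) \<Longrightarrow> massey m s x i j = 0"
  shows "b1 (s p q) (push s x p q) + curv s (push s x) p q = F [(s p q + 1, massey m s x p q)]"
proof -
  let ?Q = "{(a, b, U, W). chain p U a \<and> a \<le> b \<and> chain (Suc b) W (Suc q)}"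
  let ?G = "\<lambda>a b U W. alt (tdeg (args s x U)) (F (args s x U @ (s a b + 1, massey m s x a b) # args s x W))"
  have deg: "tdeg (args s x L) = s a b" if "L \<in> parts a b" "a \<le> b" for L a b
    using tdeg_args[of s, OF s] that by (simp add: parts_def)
  have "b1 (s p q) (push s x p q) + curv s (push s x) p q =
      (\<Sum>L\<in>parts p q. b1 (tdeg (args s x L)) (F (args s x L)) + quad F (args s x L))"
  proof -
    have "b1 (s p q) (push s x p q) = (\<Sum>L\<in>parts p q. b1 (tdeg (args s x L)) (F (args s x L)))"
      using \<open>p \<le> q\<close> by (simp add: push_sum additive.sum[OF b1_add] deg)
    moreover have "curv s (push s x) p q = (\<Sum>L\<in>parts p q. quad F (args s x L))"
      unfolding quad_def args_def sum_splits2_map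
      unfolding args_def[symmetric] case_prod_conv sum_split_parts curv_def
    proof (intro sum.cong refl)
      fix j assume j: "j \<in> {p..<q}"
      then have "b2 (s p j) (s (Suc j) q) (push s x p j) (push s x (Suc j) q) =
          (\<Sum>U\<in>parts p j. b2 (s p j) (s (Suc j) q) (F (args s x U)) (\<Sum>V\<in>parts (Suc j) q. F (args s x V)))"
        by (simp add: push_sum additive.sum[OF b2_left])
      also have "\<dots> = (\<Sum>U\<in>parts p j. \<Sum>V\<in>parts (Suc j) q.
          b2 (tdeg (args s x U)) (tdeg (args s x V)) (F (args s x U)) (F (args s x V)))"
        using j by (auto simp: additive.sum[OF b2_right] deg intro!: sum.cong)
      finally show "b2 (s p j) (s (Suc j) q) (push s x p j) (push s x (Suc j) q) =
          (\<Sum>U\<in>parts p j. \<Sum>V\<in>parts (Suc j) q.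
          b2 (tdeg (args s x U)) (tdeg (args s x V)) (F (args s x U)) (F (args s x V)))" .
    qed
    ultimately show ?thesis by (simp add: sum.distrib)
  qed
  also have "\<dots> = (\<Sum>L\<in>parts p q. insertion F m (args s x L))"
    using \<open>p \<le> q\<close> by (intro sum.cong refl morphism[symmetric]) (auto dest: parts_ne_Nil)
  also have "\<dots> = (\<Sum>(a, b, U, W)\<in>?Q. ?G a b U W)"
    unfolding insertion_def args_def sum_splits3_map
    unfolding args_def[symmetric] case_prod_conv sum_splits3_parts
  proof (intro sum.cong refl, clarsimp)
    fix a b :: nat and U W assume "a \<le> b"
    then show "(\<Sum>V\<in>parts a b. alt (tdeg (args s x U))
        (F (args s x U @ (tdeg (args s x V) + 1, m (args s x V)) # args s x W))) = ?G a b U W"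
      by (simp add: deg additive.sum[OF F_add, symmetric] alt_sum[symmetric] massey_m)
  qed
  also have "\<dots> = (\<Sum>(a, b, U, W)\<in>{(p, q, [], [])}. ?G a b U W)"
  proof (rule sum.mono_neutral_right)
    have "chain p U a \<and> a \<le> b \<and> chain (Suc b) W (Suc q) \<Longrightarrow> a \<le> q \<and> b \<le> q" for U W a b
      using chain_le[of "Suc b" W "Suc q"] by auto
    then have "?Q \<subseteq> Sigma {..q} (\<lambda>a. Sigma {..q} (\<lambda>b. {U. chain p U a} \<times> {W. chain (Suc b) W (Suc q)}))"
      by auto
    then show "finite ?Q" by (rule finite_subset) auto
    show "\<forall>t\<in>?Q - {(p, q, [], [])}. (case t of (a, b, U, W) \<Rightarrow> ?G a b U W) = 0"
    proof
      fix t assume "t \<in> ?Q - {(p, q, [], [])}"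
      then obtain a b U W where t: "t = (a, b, U, W)" "chain p U a" "a \<le> b"
          "chain (Suc b) W (Suc q)" "(a, b, U, W) \<noteq> (p, q, [], [])" by auto
      have le: "p \<le> a" "b \<le> q" using chain_le[OF t(2)] chain_le[OF t(4)] by auto
      have "(a, b) \<noteq> (p, q)" using t chain_refl by auto
      then have "massey m s x a b = 0"
        using zero[OF le(1) _ le(2)] t(3) massey_same[of m s x] by (cases "a = b") auto
      then show "(case t of (a, b, U, W) \<Rightarrow> ?G a b U W) = 0"
        by (simp add: t(1) F_zero)
    qed
  qed (use \<open>p \<le> q\<close> in auto)
  finally show ?thesis by simp
qed

end

text \<open>The sets \<open>C s\<close> and \<open>CH s\<close> are the homogeneous components of shifted degree \<open>s\<close>.\<close>

locale a_inf_quasi_iso_into_dga = a_inf_into_dga b1 b2 m F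
  for b1 :: "int \<Rightarrow> 'a::ab_group_add \<Rightarrow> 'a" and b2 :: "int \<Rightarrow> int \<Rightarrow> 'a \<Rightarrow> 'a \<Rightarrow> 'a"
    and m :: "(int \<times> 'h::ab_group_add) list \<Rightarrow> 'h" and F :: "(int \<times> 'h) list \<Rightarrow> 'a" +
  fixes C :: "int \<Rightarrow> 'a set" and CH :: "int \<Rightarrow> 'h set"
  assumes C_zero: "0 \<in> C s" and C_add: "T \<in> C s \<Longrightarrow> Y \<in> C s \<Longrightarrow> T + Y \<in> C s"
    and C_minus: "T \<in> C s \<Longrightarrow> - T \<in> C s"
    and CH_zero: "0 \<in> CH s" and CH_add: "V \<in> CH s \<Longrightarrow> W \<in> CH s \<Longrightarrow> V + W \<in> CH s"
    and b1_C: "b1 s T \<in> C (s + 1)" and b2_C: "b2 s t T Y \<in> C (s + t + 1)"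
    and F_C: "xs \<noteq> [] \<Longrightarrow> F xs \<in> C (tdeg xs)" and m_CH: "xs \<noteq> [] \<Longrightarrow> m xs \<in> CH (tdeg xs + 1)"
    and F1_inj: "V \<in> CH s \<Longrightarrow> T \<in> C (s - 1) \<Longrightarrow> F [(s, V)] = b1 (s - 1) T \<Longrightarrow> V = 0"
    and F1_surj: "T \<in> C s \<Longrightarrow> b1 s T = 0 \<Longrightarrow> \<exists>V\<in>CH s. \<exists>Y\<in>C (s - 1). T = F [(s, V)] + b1 (s - 1) Y"
begin

lemma C_sum: "(\<And>x. x \<in> S \<Longrightarrow> f x \<in> C s) \<Longrightarrow> sum f S \<in> C s"
  by (induction S rule: infinite_finite_induct) (auto simp: C_zero C_add)

lemma CH_sum: "(\<And>x. x \<in> S \<Longrightarrow> f x \<in> CH s) \<Longrightarrow> sum f S \<in> CH s"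
  by (induction S rule: infinite_finite_induct) (auto simp: CH_zero CH_add)

lemma C_diff: "T \<in> C s \<Longrightarrow> Y \<in> C s \<Longrightarrow> T - Y \<in> C s"
  using C_add[OF _ C_minus] by fastforce

lemma C_alt: "T \<in> C s \<Longrightarrow> alt n T \<in> C s"
  by (simp add: alt_def C_minus)

context
  fixes s :: "nat \<Rightarrow> nat \<Rightarrow> int"
  assumes s: "\<And>p j q. p \<le> j \<Longrightarrow> j < q \<Longrightarrow> s p q = s p j + s (Suc j) q"
begin

lemma massey_m_CH:
  assumes "p \<le> q"
  shows "massey m s x p q \<in> CH (s p q + 1)"
  unfolding massey_def
proof (rule CH_sum)
  fix L assume L: "L \<in> parts p q - {[(p, q)]}"
  then have "tdeg (args s x L) = s p q"
    using assms by (intro tdeg_args[of s, OF s]) (auto simp: parts_def)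
  then show "m (args s x L) \<in> CH (s p q + 1)"
    using m_CH[of "args s x L"] parts_ne_Nil[OF assms] L by auto
qed

lemma massey_F_C:
  assumes "p \<le> q"
  shows "massey F s x p q \<in> C (s p q)"
  unfolding massey_def
proof (rule C_sum)
  fix L assume L: "L \<in> parts p q - {[(p, q)]}"
  then have "tdeg (args s x L) = s p q"
    using assms by (intro tdeg_args[of s, OF s]) (auto simp: parts_def)
  then show "F (args s x L) \<in> C (s p q)"
    using F_C[of "args s x L"] parts_ne_Nil[OF assms] L by auto
qed

lemma push_C: "p \<le> q \<Longrightarrow> push s x p q \<in> C (s p q)"
  unfolding push_def using F_C[of "[(s p q, x p q)]"] by (auto intro: C_add massey_F_C)

lemma gauge_C: "gauge s g y y' p q \<in> C (s p q)"
  unfolding gauge_def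
proof (rule C_sum)
  fix j assume "j \<in> {p..<q}"
  then have e: "s p q = s p j + s (Suc j) q" using s by auto
  show "alt (s p j) (b2 (s p j) (s (Suc j) q - 1) (y p j) (g (Suc j) q)) +
         b2 (s p j - 1) (s (Suc j) q) (g p j) (y' (Suc j) q) \<in> C (s p q)"
    using b2_C[of "s p j" "s (Suc j) q - 1" "y p j" "g (Suc j) q"]
      b2_C[of "s p j - 1" "s (Suc j) q" "g p j" "y' (Suc j) q"]
    by (auto simp: e intro!: C_add C_alt)
qed

text \<open>The image of \<open>x\<close> has diagonal F_1(x i i), while a Massey product prescribes
  other representatives of the same classes. A gauge transformation supported on the diagonal
  changes the diagonal by the coboundaries of \<open>g\<close>, and \<open>gauge_curv\<close>
  carries the equation along. At the corner the two curvatures then differ by a boundary.\<close>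

lemma push_defining_system:
  assumes zero: "\<And>p q. 1 \<le> p \<Longrightarrow> p < q \<Longrightarrow> q \<le> n \<Longrightarrow> (p, q) \<noteq> (1, n) \<Longrightarrow> massey m s x p q = 0"
    and g: "\<And>i. g i \<in> C (s i i - 1)"
    and n: "2 \<le> n"
  obtains y z where
    "\<And>i. y i i = F [(s i i, x i i)] + b1 (s i i - 1) (g i)"
    "\<And>p q. p \<le> q \<Longrightarrow> y p q \<in> C (s p q)"
    "\<And>p q. 1 \<le> p \<Longrightarrow> p \<le> q \<Longrightarrow> q \<le> n \<Longrightarrow> (p, q) \<noteq> (1, n) \<Longrightarrow> b1 (s p q) (y p q) = - curv s y p q"
    "z \<in> C (s 1 n)" "curv s y 1 n = F [(s 1 n + 1, massey m s x 1 n)] + b1 (s 1 n) z"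
proof -
  let ?Y = "push s x"
  define h where "h p q = (if p = q then g p else 0)" for p q
  have h_C: "h p q \<in> C (s p q - 1)" for p q using g C_zero by (simp add: h_def)
  \<comment> \<open>The gauge relation read as a recursion: the gauge term at (p, q) contains
    \<open>y'\<close> only on shorter final intervals.\<close>
  define step where "step y' p q = ?Y p q + b1 (s p q - 1) (h p q) + gauge s h ?Y y' p q" for y' p q
  have "\<exists>y. \<forall>p q. y p q = step y p q"
  proof -
    define y where "y = wfrec (measure (\<lambda>(p, q). q - p)) (\<lambda>f (p, q). step (\<lambda>a b. f (a, b)) p q)"
    have "y (p, q) = step (\<lambda>a b. y (a, b)) p q" for p q
    proof -
      have "y (p, q) = step (\<lambda>a b. cut y (measure (\<lambda>(p, q). q - p)) (p, q) (a, b)) p q"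
        unfolding y_def by (subst wfrec) auto
      also have "\<dots> = step (\<lambda>a b. y (a, b)) p q"
        unfolding step_def gauge_def by (auto simp: cut_def intro!: sum.cong)
      finally show ?thesis .
    qed
    then show ?thesis by (intro exI[of _ "\<lambda>a b. y (a, b)"]) blast
  qed
  then obtain y where y: "\<And>p q. y p q = ?Y p q + b1 (s p q - 1) (h p q) + gauge s h ?Y y p q"
    unfolding step_def by blast
  have mcY: "b1 (s p q) (?Y p q) = - curv s ?Y p q"
    if "1 \<le> p" "p \<le> q" "q \<le> n" "(p, q) \<noteq> (1, n)" for p q
  proof -
    have "massey m s x p q = 0"
      using that zero[of p q] massey_same[of m s x p] by (cases "p = q") auto
    moreover have "massey m s x i j = 0" if "p \<le> i" "i < j" "j \<le> q" for i j
      using that \<open>1 \<le> p\<close> \<open>q \<le> n\<close> \<open>(p, q) \<noteq> (1, n)\<close> by (intro zero) auto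
    ultimately show ?thesis
      using push_equation[of s p q x, OF s] that F1_zero by (simp add: add_eq_0_iff2)
  qed
  have "b1 (s p q) (gauge s h ?Y y p q) + curv s y p q = curv s ?Y p q"
    if "1 \<le> p" "p \<le> q" "q \<le> n" for p q
    using that
  proof (induction "q - p" arbitrary: p q rule: less_induct)
    case less
    show ?case
    proof (rule gauge_curv[where s = s, OF s])
      fix j assume j: "p \<le> j" "j < q"
      show "b1 (s p j) (?Y p j) = - curv s ?Y p j" using j less.prems by (intro mcY) auto
      \<comment> \<open>The equation for \<open>y\<close> on the shorter interval follows from the
        induction hypothesis and the equation for the image, because \<open>b1\<close> kills the
        summand \<open>b1 h\<close> of \<open>y\<close>.\<close>
      show "b1 (s (Suc j) q) (y (Suc j) q) = - curv s y (Suc j) q"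
      proof -
        have 1: "b1 (s (Suc j) q) (gauge s h ?Y y (Suc j) q) + curv s y (Suc j) q = curv s ?Y (Suc j) q"
          using j less.prems by (intro less.hyps) auto
        have 2: "b1 (s (Suc j) q) (?Y (Suc j) q) = - curv s ?Y (Suc j) q"
          using j less.prems by (intro mcY) auto
        have "b1 (s (Suc j) q) (y (Suc j) q) =
            b1 (s (Suc j) q) (?Y (Suc j) q) + b1 (s (Suc j) q) (gauge s h ?Y y (Suc j) q)"
          using b1_b1[of "s (Suc j) q - 1"] by (subst y) (simp add: additive.add[OF b1_add])
        then show ?thesis unfolding 2 1[symmetric] by simp
      qed
    qed (assumption | rule y)+
  qed
  note curv = this
  show ?thesis
  \<comment> \<open>The correction term comes from adding, at the corner, the identity d(push) +
    curv(push) = F_1(S) and the identity d(gauge) + curv(y) = curv(push).\<close>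
  proof (rule that[of y "- (?Y 1 n + gauge s h ?Y y 1 n)"])
    show "y i i = F [(s i i, x i i)] + b1 (s i i - 1) (g i)" for i
      by (subst y) (simp add: h_def push_same)
    show "y p q \<in> C (s p q)" if "p \<le> q" for p q
      using b1_C[of "s p q - 1" "h p q"] that by (subst y) (auto intro!: C_add push_C gauge_C)
    show "b1 (s p q) (y p q) = - curv s y p q"
      if "1 \<le> p" "p \<le> q" "q \<le> n" "(p, q) \<noteq> (1, n)" for p q
    proof -
      have "b1 (s p q) (y p q) = b1 (s p q) (?Y p q) + b1 (s p q) (gauge s h ?Y y p q)"
        using b1_b1[of "s p q - 1"] by (subst y) (simp add: additive.add[OF b1_add])
      then show ?thesis unfolding mcY[OF that] curv[OF that(1-3), symmetric] by simp
    qed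
    show "- (?Y 1 n + gauge s h ?Y y 1 n) \<in> C (s 1 n)"
      using n by (intro C_minus C_add push_C gauge_C) auto
    have "b1 (s 1 n) (?Y 1 n) + curv s ?Y 1 n = F [(s 1 n + 1, massey m s x 1 n)]"
      using n by (intro push_equation[where s = s, OF s] zero) auto
    then show "curv s y 1 n = F [(s 1 n + 1, massey m s x 1 n)] + b1 (s 1 n) (- (?Y 1 n + gauge s h ?Y y 1 n))"
    proof -
      assume "b1 (s 1 n) (?Y 1 n) + curv s ?Y 1 n = F [(s 1 n + 1, massey m s x 1 n)]"
      then have "F [(s 1 n + 1, massey m s x 1 n)] = b1 (s 1 n) (?Y 1 n) + curv s ?Y 1 n" ..
      moreover have "curv s ?Y 1 n = b1 (s 1 n) (gauge s h ?Y y 1 n) + curv s y 1 n"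
        using curv[of 1 n] n by simp
      ultimately show ?thesis
        by (simp add: additive.add[OF b1_add] additive.minus[OF b1_add] additive.diff[OF b1_add])
    qed
  qed
qed

text \<open>Obstruction theory on the length of intervals. At a new interval the candidate for F_1
  of the next entry has boundary minus F_1 of the Massey sum. Injectivity on cohomology makes the
  Massey sum vanish, whereupon the candidate is a cocycle, and surjectivity writes it as F_1 of a
  new entry plus a coboundary, which the gauge transformation absorbs. The given \<open>y\<close> is
  the source of the gauge transformation and the image of \<open>x\<close> its target.\<close>

lemma lift_defining_system:
  assumes y: "\<And>p q. 1 \<le> p \<Longrightarrow> p \<le> q \<Longrightarrow> q \<le> n \<Longrightarrow> (p, q) \<noteq> (1, n) \<Longrightarrow> y p q \<in> C (s p q)"
    and mc: "\<And>p q. 1 \<le> p \<Longrightarrow> p \<le> q \<Longrightarrow> q \<le> n \<Longrightarrow> (p, q) \<noteq> (1, n) \<Longrightarrow> b1 (s p q) (y p q) = - curv s y p q"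
    and v: "\<And>i. v i \<in> CH (s i i)" and g: "\<And>i. g i \<in> C (s i i - 1)"
    and diag: "\<And>i. 1 \<le> i \<Longrightarrow> i \<le> n \<Longrightarrow> F [(s i i, v i)] = y i i + b1 (s i i - 1) (g i)"
    and n: "2 \<le> n"
  obtains x z where "\<And>i. x i i = v i" "\<And>p q. x p q \<in> CH (s p q)"
    "\<And>p q. 1 \<le> p \<Longrightarrow> p < q \<Longrightarrow> q \<le> n \<Longrightarrow> (p, q) \<noteq> (1, n) \<Longrightarrow> massey m s x p q = 0"
    "z \<in> C (s 1 n)" "curv s y 1 n = F [(s 1 n + 1, massey m s x 1 n)] + b1 (s 1 n) z"
proof -
  \<comment> \<open>Stage \<open>w\<close> settles the intervals with q - p < w; elsewhere off the
    diagonal, \<open>x\<close> and \<open>h\<close> are only required to have the right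
    degree.\<close>
  define good where "good w x h \<longleftrightarrow> (\<forall>i. x i i = v i) \<and> (\<forall>p q. x p q \<in> CH (s p q)) \<and>
      (\<forall>p q. h p q \<in> C (s p q - 1)) \<and>
      (\<forall>p q. 1 \<le> p \<and> p \<le> q \<and> q \<le> n \<and> q - p < w \<longrightarrow> massey m s x p q = 0 \<and>
         push s x p q = y p q + b1 (s p q - 1) (h p q) + gauge s h y (push s x) p q)" for w x h
  have proper: "b - a < q - p" if "p \<le> a" "a \<le> b" "b \<le> q" "(a, b) \<noteq> (p, q)" for a b p q :: nat
    using that by (cases "a = p") auto
  have push_cong: "push s x i j = push s x' i j"
    if "p \<le> i" "i \<le> j" "j \<le> q" "\<And>i j. p \<le> i \<Longrightarrow> i \<le> j \<Longrightarrow> j \<le> q \<Longrightarrow> x i j = x' i j" for p q i j x x'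
    unfolding push_def using that by (simp add: massey_cong[of i j x x' F s])
  \<comment> \<open>Valid up to q - p = w, one step beyond the settled intervals, because curvature
    and gauge term at (p, q) use proper subintervals only.\<close>
  have obstruct: "b1 (s p q) (gauge s h y (push s x) p q) + curv s (push s x) p q = curv s y p q"
    if G: "good w x h" and pq: "1 \<le> p" "p \<le> q" "q \<le> n" "q - p \<le> w" for w x h p q
  proof (rule gauge_curv[where s = s, OF s])
    fix j assume j: "p \<le> j" "j < q"
    show "b1 (s p j) (y p j) = - curv s y p j" using pq j by (intro mc) auto
    have zero: "massey m s x a b = 0" if "p \<le> a" "a \<le> b" "b \<le> q" "(a, b) \<noteq> (p, q)" for a b
      using G pq that proper[of p a b q] by (simp add: good_def)
    have "b1 (s (Suc j) q) (push s x (Suc j) q) + curv s (push s x) (Suc j) q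
        = F [(s (Suc j) q + 1, massey m s x (Suc j) q)]"
      using j by (intro push_equation[where s = s, OF s] zero) auto
    also have "massey m s x (Suc j) q = 0" using j by (intro zero) auto
    finally show "b1 (s (Suc j) q) (push s x (Suc j) q) = - curv s (push s x) (Suc j) q"
      by (simp add: F1_zero add_eq_0_iff2)
    show "push s x p j = y p j + b1 (s p j - 1) (h p j) + gauge s h y (push s x) p j"
      "push s x (Suc j) q = y (Suc j) q + b1 (s (Suc j) q - 1) (h (Suc j) q)
          + gauge s h y (push s x) (Suc j) q"
      using G pq j proper[of p p j q] proper[of p "Suc j" q q] by (simp_all add: good_def)
  qed
  have obstruct2: "b1 (s p q) (push s x p q) + curv s (push s x) p q = F [(s p q + 1, massey m s x p q)]"
    if G: "good w x h" and pq: "1 \<le> p" "p \<le> q" "q \<le> n" "q - p \<le> w" for w x h p q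
    using G pq proper[of p _ _ q] by (intro push_equation[where s = s, OF s]) (auto simp: good_def)
  have "\<exists>x h. good w x h" if "1 \<le> w" "w \<le> n - 1" for w
    using that
  proof (induction w rule: dec_induct)
    case base
    define x h where "x p q = (if p = q then v p else 0)" and "h p q = (if p = q then g p else 0)" for p q
    have "good 1 x h"
      using v g diag by (auto simp: good_def x_def h_def CH_zero C_zero massey_same push_same)
    then show ?case by blast
  next
    case (step w)
    then obtain x h where G: "good w x h" by auto
    have "\<exists>V Z. V \<in> CH (s p q) \<and> Z \<in> C (s p q - 1) \<and> massey m s x p q = 0 \<and>
         F [(s p q, V)] + massey F s x p q = y p q + b1 (s p q - 1) Z + gauge s h y (push s x) p q"
      if pq: "1 \<le> p" "p \<le> q" "q \<le> n" "q - p = w" for p q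
    proof -
      \<comment> \<open>The value that F_1 of the missing entry must take, up to a coboundary, if
        the image of \<open>x\<close> is to be the gauge transform of \<open>y\<close> at (p,
        q).\<close>
      let ?c = "y p q + gauge s h y (push s x) p q - massey F s x p q"
      have ne: "(p, q) \<noteq> (1, n)" using step.hyps step.prems pq by auto
      have c: "?c \<in> C (s p q)"
        using pq ne by (intro C_add C_diff y gauge_C massey_F_C)
      have b1c: "b1 (s p q) ?c = - F [(s p q + 1, massey m s x p q)]"
      proof -
        have "b1 (s p q) (push s x p q) = b1 (s p q) (massey F s x p q)"
          by (simp add: push_def additive.add[OF b1_add] b1_F1)
        then have "b1 (s p q) (massey F s x p q) = F [(s p q + 1, massey m s x p q)] - curv s (push s x) p q"
          using obstruct2[OF G, of p q] pq by (simp add: eq_diff_eq)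
        moreover have "b1 (s p q) (gauge s h y (push s x) p q) = curv s y p q - curv s (push s x) p q"
          using obstruct[OF G, of p q] pq by (simp add: eq_diff_eq)
        moreover have "b1 (s p q) (y p q) = - curv s y p q" using mc[of p q] pq ne by simp
        ultimately show ?thesis by (simp add: additive.add[OF b1_add] additive.diff[OF b1_add])
      qed
      \<comment> \<open>F_1 of the Massey sum is the boundary of \<open>- ?c\<close>, hence its
        class is zero.\<close>
      have mz: "massey m s x p q = 0"
      proof (rule F1_inj[of _ "s p q + 1" "- ?c"])
        show "massey m s x p q \<in> CH (s p q + 1)" using pq by (intro massey_m_CH)
        show "- ?c \<in> C (s p q + 1 - 1)" using C_minus[OF c] by simp
        show "F [(s p q + 1, massey m s x p q)] = b1 (s p q + 1 - 1) (- ?c)"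
          by (simp only: add_diff_cancel_right' additive.minus[OF b1_add] b1c minus_minus)
      qed
      then have "b1 (s p q) ?c = 0" using b1c F1_zero by simp
      then obtain V Z where "V \<in> CH (s p q)" "Z \<in> C (s p q - 1)" "?c = F [(s p q, V)] + b1 (s p q - 1) Z"
        using F1_surj[OF c] by blast
      \<comment> \<open>\<open>Z\<close> changes sign because its coboundary moves to the side of
        \<open>y p q\<close>.\<close>
      then show ?thesis
        using mz by (intro exI[of _ V] exI[of _ "- Z"])
          (auto simp: C_minus additive.minus[OF b1_add] algebra_simps)
    qed
    then obtain V Z where VZ: "\<And>p q. 1 \<le> p \<Longrightarrow> p \<le> q \<Longrightarrow> q \<le> n \<Longrightarrow> q - p = w \<Longrightarrow>
        V p q \<in> CH (s p q) \<and> Z p q \<in> C (s p q - 1) \<and> massey m s x p q = 0 \<and>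
         F [(s p q, V p q)] + massey F s x p q = y p q + b1 (s p q - 1) (Z p q) + gauge s h y (push s x) p q"
      by metis
    \<comment> \<open>All intervals of this length are filled at once; their entries do not affect
      one another, since the conditions at each of them otherwise refer to smaller
      intervals.\<close>
    define new where "new p q \<longleftrightarrow> 1 \<le> p \<and> p \<le> q \<and> q \<le> n \<and> q - p = w" for p q
    define x' h' where "x' p q = (if new p q then V p q else x p q)"
      and "h' p q = (if new p q then Z p q else h p q)" for p q
    have old: "x' i j = x i j" "h' i j = h i j" if "j - i < w" for i j
      using that by (auto simp: x'_def h'_def new_def)
    have good': "massey m s x' p q = 0 \<and>
         push s x' p q = y p q + b1 (s p q - 1) (h' p q) + gauge s h' y (push s x') p q"
      if pq: "1 \<le> p" "p \<le> q" "q \<le> n" "q - p \<le> w" for p q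
    proof -
      have sub: "x' i j = x i j" "h' i j = h i j" "push s x' i j = push s x i j"
        if "p \<le> i" "i \<le> j" "j \<le> q" "(i, j) \<noteq> (p, q)" for i j
      proof -
        have "j - i < w" using proper[OF that] pq by simp
        then show "x' i j = x i j" "h' i j = h i j" using old by auto
        show "push s x' i j = push s x i j"
          by (rule push_cong[of i i j j]) (use that \<open>j - i < w\<close> in \<open>auto intro!: old\<close>)
      qed
      have e: "massey m s x' p q = massey m s x p q" "massey F s x' p q = massey F s x p q"
        "gauge s h' y (push s x') p q = gauge s h y (push s x) p q"
        by (intro massey_cong gauge_cong sub refl; assumption)+
      show ?thesis
      proof (cases "new p q")
        case True
        then show ?thesis using VZ[OF pq(1-3)] by (simp add: e push_def x'_def h'_def new_def)
      next
        case False
        then have "q - p < w" using pq by (auto simp: new_def)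
        then show ?thesis using G pq False e
          by (simp add: good_def push_def x'_def h'_def)
      qed
    qed
    moreover have "x' i i = v i" for i using old[of i i] G step.hyps by (simp add: good_def)
    moreover have "x' p q \<in> CH (s p q)" "h' p q \<in> C (s p q - 1)" for p q
      using G VZ[of p q] by (auto simp: x'_def h'_def new_def good_def)
    ultimately have "good (Suc w) x' h'" unfolding good_def by (simp add: less_Suc_eq_le)
    then show ?case by blast
  qed
  \<comment> \<open>At stage n - 1 every interval inside {1..n} except the full one is settled, and
    the full one is the next, to which \<open>obstruct\<close> still applies.\<close>
  then obtain x h where G: "good (n - 1) x h" using n by fastforce
  show ?thesis
  proof (rule that[of x "gauge s h y (push s x) 1 n - push s x 1 n"])
    show "x i i = v i" "x p q \<in> CH (s p q)" for i p q using G by (auto simp: good_def)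
    show "massey m s x p q = 0" if "1 \<le> p" "p < q" "q \<le> n" "(p, q) \<noteq> (1, n)" for p q
      using G that proper[of 1 p q n] by (simp add: good_def)
    show "gauge s h y (push s x) 1 n - push s x 1 n \<in> C (s 1 n)"
      using n by (intro C_diff gauge_C push_C) auto
    show "curv s y 1 n = F [(s 1 n + 1, massey m s x 1 n)] + b1 (s 1 n) (gauge s h y (push s x) 1 n - push s x 1 n)"
    proof -
      have "F [(s 1 n + 1, massey m s x 1 n)] = b1 (s 1 n) (push s x 1 n) + curv s (push s x) 1 n"
        using obstruct2[OF G, of 1 n] n by simp
      moreover have "curv s y 1 n = b1 (s 1 n) (gauge s h y (push s x) 1 n) + curv s (push s x) 1 n"
        using obstruct[OF G, of 1 n] n by simp
      ultimately show ?thesis by (simp add: additive.diff[OF b1_add])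
    qed
  qed
qed

end

end

section \<open>Homogeneous elements in one abelian group\<close>

text \<open>
  The components of a graded module are records with carriers and do not form a type of class
  \<open>ab_group_add\<close>. The product of all abelian groups with elements in \<open>'a\<close> does, and it contains
  each component as a direct factor. The factors are indexed by the module records themselves, so
  equal components of a graded module share a factor; degrees are tracked separately.
\<close>

typedef ('r, 'a) tot =
  "{\<phi> :: ('r, 'a) module \<Rightarrow> 'a. \<forall>M. if abelian_group M then \<phi> M \<in> carrier M else \<phi> M = undefined}"
  by (rule exI[of _ "\<lambda>M. if abelian_group M then \<zero>\<^bsub>M\<^esub> else undefined"])
     (auto intro: abelian_group.axioms(1) abelian_monoid.zero_closed)

lemma Rep_tot_carrier: "abelian_group M \<Longrightarrow> Rep_tot T M \<in> carrier M"
  using Rep_tot[of T] by (simp split: if_splits)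

lemma Rep_tot_undefined: "\<not> abelian_group M \<Longrightarrow> Rep_tot T M = undefined"
  using Rep_tot[of T] by (simp split: if_splits)

lemma tot_eqI: "(\<And>M. abelian_group M \<Longrightarrow> Rep_tot T M = Rep_tot Y M) \<Longrightarrow> T = Y"
  by (intro Rep_tot_inject[THEN iffD1] ext) (metis Rep_tot_undefined)

definition tot_of :: "(('r, 'a) module \<Rightarrow> 'a) \<Rightarrow> ('r, 'a) tot" where
  "tot_of \<phi> = Abs_tot (\<lambda>M. if abelian_group M then \<phi> M else undefined)"

lemma Rep_tot_of:
  "(\<And>N. abelian_group N \<Longrightarrow> \<phi> N \<in> carrier N) \<Longrightarrow> abelian_group M \<Longrightarrow> Rep_tot (tot_of \<phi>) M = \<phi> M"
  unfolding tot_of_def by (subst Abs_tot_inverse) auto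

instantiation tot :: (type, type) ab_group_add
begin

definition "0 = tot_of (\<lambda>M. \<zero>\<^bsub>M\<^esub>)"
definition "T + Y = tot_of (\<lambda>M. Rep_tot T M \<oplus>\<^bsub>M\<^esub> Rep_tot Y M)"
definition "- T = tot_of (\<lambda>M. \<ominus>\<^bsub>M\<^esub> Rep_tot T M)"
definition "(T :: ('a, 'b) tot) - Y = T + - Y"

lemma Rep_tot_ops:
  assumes "abelian_group M"
  shows "Rep_tot 0 M = \<zero>\<^bsub>M\<^esub>" "Rep_tot (T + Y) M = Rep_tot T M \<oplus>\<^bsub>M\<^esub> Rep_tot Y M"
    "Rep_tot (- T) M = \<ominus>\<^bsub>M\<^esub> Rep_tot T M"
proof -
  have m: "abelian_group N \<Longrightarrow> abelian_monoid N" for N :: "('a, 'b) module"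
    by (rule abelian_group.axioms(1))
  show "Rep_tot 0 M = \<zero>\<^bsub>M\<^esub>"
    unfolding zero_tot_def by (rule Rep_tot_of[OF _ assms]) (rule abelian_monoid.zero_closed[OF m])
  show "Rep_tot (T + Y) M = Rep_tot T M \<oplus>\<^bsub>M\<^esub> Rep_tot Y M"
    unfolding plus_tot_def
    by (rule Rep_tot_of[OF _ assms]) (intro abelian_monoid.a_closed m Rep_tot_carrier)
  show "Rep_tot (- T) M = \<ominus>\<^bsub>M\<^esub> Rep_tot T M"
    unfolding uminus_tot_def
    by (rule Rep_tot_of[OF _ assms]) (intro abelian_group.a_inv_closed Rep_tot_carrier)
qed

instance
proof
  fix T Y Z :: "('a, 'b) tot"
  show "T + Y + Z = T + (Y + Z)"
    by (rule tot_eqI) (simp add: Rep_tot_ops Rep_tot_carrier abelian_monoid.a_assoc abelian_group.axioms(1))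
  show "T + Y = Y + T"
    by (rule tot_eqI) (simp add: Rep_tot_ops Rep_tot_carrier abelian_monoid.a_comm abelian_group.axioms(1))
  show "0 + T = T"
    by (rule tot_eqI) (simp add: Rep_tot_ops Rep_tot_carrier abelian_monoid.l_zero abelian_group.axioms(1))
  show "- T + T = 0"
    by (rule tot_eqI) (simp add: Rep_tot_ops Rep_tot_carrier abelian_group.l_neg)
qed (simp add: minus_tot_def)

end

section \<open>Components as direct factors\<close>

definition proj :: "('r, 'a) module \<Rightarrow> ('r, 'a) tot \<Rightarrow> 'a" where
  "proj M T = Rep_tot T M"

definition emb :: "('r, 'a) module \<Rightarrow> 'a \<Rightarrow> ('r, 'a) tot" where
  "emb M a = tot_of (\<lambda>N. if N = M then a else \<zero>\<^bsub>N\<^esub>)"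

text \<open>Factors that are not modules over \<open>R\<close> are left alone, and so is everything
  if \<open>c\<close> is not a scalar. The map is thus additive for every \<open>c\<close>, and the
  unit scalar acts as the identity.\<close>

definition scal :: "('r, 's) ring_scheme \<Rightarrow> 'r \<Rightarrow> ('r, 'a) tot \<Rightarrow> ('r, 'a) tot" where
  "scal R c T = tot_of (\<lambda>M. if module R M \<and> c \<in> carrier R then c \<odot>\<^bsub>M\<^esub> Rep_tot T M else Rep_tot T M)"

lemma Rep_emb:
  "abelian_group M \<Longrightarrow> a \<in> carrier M \<Longrightarrow> abelian_group N \<Longrightarrow>
     Rep_tot (emb M a) N = (if N = M then a else \<zero>\<^bsub>N\<^esub>)"
  unfolding emb_def by (subst Rep_tot_of) (auto intro: abelian_group.axioms(1) abelian_monoid.zero_closed)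

lemma Rep_scal:
  "abelian_group M \<Longrightarrow> Rep_tot (scal R c T) M =
     (if module R M \<and> c \<in> carrier R then c \<odot>\<^bsub>M\<^esub> Rep_tot T M else Rep_tot T M)"
  unfolding scal_def by (subst Rep_tot_of) (auto simp: Rep_tot_carrier module.smult_closed)

lemma additive_scal: "additive (scal R c)"
  by (rule additive.intro, rule tot_eqI)
     (auto simp: Rep_scal Rep_tot_ops Rep_tot_carrier module.smult_r_distr)

context
  fixes M :: "('r, 'a) module"
  assumes M: "abelian_group M"
begin

interpretation abelian_group M by (rule M)

lemma proj_closed [simp]: "proj M T \<in> carrier M"
  by (simp add: proj_def Rep_tot_carrier M)

lemma proj_ops: "proj M 0 = \<zero>\<^bsub>M\<^esub>" "proj M (T + Y) = proj M T \<oplus>\<^bsub>M\<^esub> proj M Y" "proj M (- T) = \<ominus>\<^bsub>M\<^esub> proj M T"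
  by (simp_all add: proj_def Rep_tot_ops M)

lemma proj_emb [simp]: "a \<in> carrier M \<Longrightarrow> proj M (emb M a) = a"
  by (simp add: proj_def Rep_emb M)

lemma emb_zero [simp]: "emb M \<zero>\<^bsub>M\<^esub> = 0"
  by (rule tot_eqI) (simp add: Rep_emb Rep_tot_ops M)

lemma emb_add: "a \<in> carrier M \<Longrightarrow> b \<in> carrier M \<Longrightarrow> emb M (a \<oplus>\<^bsub>M\<^esub> b) = emb M a + emb M b"
  by (rule tot_eqI)
     (simp add: Rep_emb Rep_tot_ops M abelian_monoid.l_zero abelian_monoid.zero_closed abelian_group.axioms(1))

lemma emb_minus: "a \<in> carrier M \<Longrightarrow> emb M (\<ominus>\<^bsub>M\<^esub> a) = - emb M a"
  by (rule tot_eqI) (auto simp: Rep_emb Rep_tot_ops M intro!: abelian_group.minus_equality[symmetric]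
      abelian_monoid.l_zero abelian_monoid.zero_closed abelian_group.axioms(1))

lemma emb_inj: "a \<in> carrier M \<Longrightarrow> b \<in> carrier M \<Longrightarrow> emb M a = emb M b \<longleftrightarrow> a = b"
  using proj_emb by metis

lemma emb_eq_0: "a \<in> carrier M \<Longrightarrow> emb M a = 0 \<longleftrightarrow> a = \<zero>\<^bsub>M\<^esub>"
  using emb_inj[of a "\<zero>\<^bsub>M\<^esub>"] by simp

lemma emb_signed: "a \<in> carrier M \<Longrightarrow> emb M (signed M n a) = alt n (emb M a)"
  by (simp add: signed_def alt_def emb_minus)

lemma signed_closed [simp]: "a \<in> carrier M \<Longrightarrow> signed M n a \<in> carrier M"
  by (simp add: signed_def)

lemma emb_finsum: "f \<in> S \<rightarrow> carrier M \<Longrightarrow> emb M (\<Oplus>\<^bsub>M\<^esub>x\<in>S. f x) = (\<Sum>x\<in>S. emb M (f x))"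
proof (induction S rule: infinite_finite_induct)
  case (insert x S)
  then show ?case by (subst finsum_insert) (auto simp: emb_add Pi_def intro!: finsum_closed)
qed (simp_all add: finsum_infinite)

lemma emb_scal: "module R M \<Longrightarrow> c \<in> carrier R \<Longrightarrow> a \<in> carrier M \<Longrightarrow> emb M (c \<odot>\<^bsub>M\<^esub> a) = scal R c (emb M a)"
  by (rule tot_eqI) (auto simp: Rep_emb Rep_scal M module.smult_closed module.smult_r_null)

lemma proj_scal: "module R M \<Longrightarrow> c \<in> carrier R \<Longrightarrow> proj M (scal R c T) = c \<odot>\<^bsub>M\<^esub> proj M T"
  by (simp add: proj_def Rep_scal M)

end

section \<open>From graded operations to operations on one group\<close>

definition up :: "('r, 'a) graded \<Rightarrow> (int \<times> 'a) list \<Rightarrow> (int \<times> ('r, 'a) tot) list" where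
  "up A xs = map (\<lambda>(k, a). (k - 1, emb (A k) a)) xs"

text \<open>Projecting each entry to the component named by its degree turns an arbitrary list into
  a homogeneous one; on homogeneous lists this inverts \<open>up\<close>.\<close>

definition down :: "('r, 'a) graded \<Rightarrow> (int \<times> ('r, 'a) tot) list \<Rightarrow> (int \<times> 'a) list" where
  "down A xs = map (\<lambda>(s, T). (s + 1, proj (A (s + 1)) T)) xs"

text \<open>Extends an operation from homogeneous lists to all lists by projecting first, and
  includes the sign of the shift. In this form it can satisfy axioms without carrier conditions,
  such as those of \<open>shifted_dga\<close>.\<close>

definition lift :: "('r, 'a) graded \<Rightarrow> ('r, 'b) graded \<Rightarrow> int \<Rightarrow> ((int \<times> 'a) list \<Rightarrow> 'b) \<Rightarrow>
    (int \<times> ('r, 'a) tot) list \<Rightarrow> ('r, 'b) tot" where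
  "lift A B e \<phi> xs =
     emb (B (fst (shifted B e \<phi> (down A xs)))) (snd (shifted B e \<phi> (down A xs)))"

definition homg :: "('r, 'a) graded \<Rightarrow> int \<Rightarrow> ('r, 'a) tot set" where
  "homg A s = emb (A (s + 1)) ` carrier (A (s + 1))"

lemma up_simps [simp]: "up A [] = []" "up A ((k, a) # xs) = (k - 1, emb (A k) a) # up A xs"
  "up A (xs @ ys) = up A xs @ up A ys" "length (up A xs) = length xs" "up A xs = [] \<longleftrightarrow> xs = []"
  by (auto simp: up_def)

lemma down_simps [simp]: "down A [] = []"
  "down A ((s, T) # us) = (s + 1, proj (A (s + 1)) T) # down A us"
  "down A (us @ vs) = down A us @ down A vs" "length (down A us) = length us" "down A us = [] \<longleftrightarrow> us = []"
  by (auto simp: down_def)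

lemma homog_simps [simp]: "homog A []" "homog A (u # xs) \<longleftrightarrow> snd u \<in> carrier (A (fst u)) \<and> homog A xs"
  "homog A (xs @ ys) \<longleftrightarrow> homog A xs \<and> homog A ys"
  by (auto simp: homog_def)

lemma out_deg_up: "out_deg e xs = e + tdeg (up A xs)"
  by (induction xs) (auto simp: out_deg_def)

lemma out_deg_down: "out_deg e (down A xs) = e + tdeg xs"
  by (induction xs) (auto simp: out_deg_def)

lemma sum_list_sdeg: "(\<Sum>u\<leftarrow>xs. sdeg u) = tdeg (up A xs)"
  by (induction xs) (auto simp: sdeg_def)

locale graded_mod =
  fixes R :: "('r, 's) ring_scheme" and A :: "('r, 'a) graded"
  assumes graded_module: "graded_module R A"
begin

lemma module [simp]: "module R (A k)"
  using graded_module by (simp add: graded_module_def)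

lemma abelian_group [simp]: "abelian_group (A k)"
  using module module_def by blast

lemma homog_down [simp]: "homog A (down A xs)"
  by (induction xs) auto

lemma down_up: "homog A xs \<Longrightarrow> down A (up A xs) = xs"
  by (induction xs) auto

lemma homg_zero: "0 \<in> homg A s"
  unfolding homg_def by (metis abelian_group abelian_group.axioms(1) abelian_monoid.zero_closed emb_zero imageI)

lemma homg_add: "T \<in> homg A s \<Longrightarrow> Y \<in> homg A s \<Longrightarrow> T + Y \<in> homg A s"
  by (auto simp: homg_def emb_add[symmetric] intro!: imageI abelian_monoid.a_closed abelian_group.axioms(1))

lemma homg_minus: "T \<in> homg A s \<Longrightarrow> - T \<in> homg A s"
  by (auto simp: homg_def emb_minus[symmetric] intro!: imageI abelian_group.a_inv_closed)

lemma emb_homg: "a \<in> carrier (A k) \<Longrightarrow> emb (A k) a \<in> homg A (k - 1)"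
  by (simp add: homg_def)

lemma homg_emb_proj: "T \<in> homg A s \<Longrightarrow> emb (A (s + 1)) (proj (A (s + 1)) T) = T"
  by (auto simp: homg_def)

end

definition sign_exp :: "(int \<times> 'a) list \<Rightarrow> int" where
  "sign_exp xs = (\<Sum>i<length xs. int (length xs - Suc i) * sdeg (xs ! i))"

text \<open>The sign of the shift depends on degrees alone, hence stays the same when the element in
  one slot varies; this lets linearity pass through the shift.\<close>

lemma sign_exp_cong:
  assumes "map fst xs = map fst ys"
  shows "sign_exp xs = sign_exp ys"
proof -
  have l: "length xs = length ys" using assms map_eq_imp_length_eq by blast
  then have "sdeg (xs ! i) = sdeg (ys ! i)" if "i < length ys" for i
    using assms that by (metis nth_map sdeg_def)
  then show ?thesis using l unfolding sign_exp_def by (intro sum.cong) auto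
qed

lemma shifted_sign_exp: "shifted B e \<phi> xs = (out_deg e xs, signed (B (out_deg e xs)) (sign_exp xs) (\<phi> xs))"
  by (simp add: shifted_def sign_exp_def)

lemma not_Cons_append: "us @ v # vs \<noteq> []"
  by simp

locale graded_map = dom: graded_mod R A + cod: graded_mod R B
  for R :: "('r, 's) ring_scheme" and A :: "('r, 'a) graded" and B :: "('r, 'b) graded" +
  fixes e :: int and \<phi> :: "(int \<times> 'a) list \<Rightarrow> 'b"
  assumes multilinear: "graded_multilinear R A B e \<phi>"
begin

abbreviation "L \<equiv> lift A B e \<phi>"

lemma closed: "xs \<noteq> [] \<Longrightarrow> homog A xs \<Longrightarrow> \<phi> xs \<in> carrier (B (out_deg e xs))"
  using multilinear by (simp add: graded_multilinear_def)

lemma shifted_closed: "xs \<noteq> [] \<Longrightarrow> homog A xs \<Longrightarrow> snd (shifted B e \<phi> xs) \<in> carrier (B (out_deg e xs))"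
  by (simp add: shifted_def closed)

lemma lift_up:
  assumes "homog A xs"
  shows "L (up A xs) = emb (B (out_deg e xs)) (snd (shifted B e \<phi> xs))"
  by (simp add: lift_def dom.down_up[OF assms] shifted_def)

text \<open>In shifted degrees the operation has degree e - 1, which is 1 for an A_inf structure and
  0 for a morphism.\<close>

lemma up_shifted:
  "homog A xs \<Longrightarrow> up B [shifted B e \<phi> xs] = [(tdeg (up A xs) + e - 1, L (up A xs))]"
  by (simp add: lift_up shifted_def out_deg_up[of e xs A] add.commute)

lemma lift_signed:
  "xs \<noteq> [] \<Longrightarrow> L xs = alt (sign_exp (down A xs)) (emb (B (e + tdeg xs)) (\<phi> (down A xs)))"
  using closed[of "down A xs"] by (simp add: lift_def shifted_sign_exp emb_signed out_deg_down)

lemma lift_cong: "down A xs = down A ys \<Longrightarrow> L xs = L ys"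
  by (simp add: lift_def)

lemma lift_homg: "xs \<noteq> [] \<Longrightarrow> L xs \<in> homg B (tdeg xs + e - 1)"
  using shifted_closed[of "down A xs"]
  by (simp add: lift_def homg_def out_deg_down shifted_def add.commute)

lemma additive_lift: "additive (\<lambda>T. L (us @ (s, T) # vs))"
proof
  fix T Y :: "('r, 'a) tot"
  let ?xs = "\<lambda>T. us @ (s, T) # vs"
  have "\<phi> (down A (?xs (T + Y))) = \<phi> (down A (?xs T)) \<oplus>\<^bsub>B (e + tdeg (?xs T))\<^esub> \<phi> (down A (?xs Y))"
    using multilinear out_deg_down[of e A "?xs T"]
    by (simp add: graded_multilinear_def proj_ops)
  moreover have "\<phi> (down A (?xs Z)) \<in> carrier (B (e + tdeg (?xs T)))" for Z
    using closed[of "down A (?xs Z)"] out_deg_down[of e A "?xs Z"] by simp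
  moreover obtain n where "\<And>Z. sign_exp (down A (?xs Z)) = n"
  proof (rule that)
    show "sign_exp (down A (?xs Z)) = sign_exp (down A (?xs 0))" for Z
      by (rule sign_exp_cong) simp
  qed
  ultimately show "L (?xs (T + Y)) = L (?xs T) + L (?xs Y)"
    unfolding lift_signed[OF not_Cons_append] by (simp add: emb_add alt_add)
qed

lemma scal_lift:
  assumes "c \<in> carrier R"
  shows "L (us @ (s, scal R c T) # vs) = scal R c (L (us @ (s, T) # vs))"
proof -
  let ?xs = "\<lambda>T. us @ (s, T) # vs"
  have "\<phi> (down A (?xs (scal R c T))) = c \<odot>\<^bsub>B (e + tdeg (?xs T))\<^esub> \<phi> (down A (?xs T))"
    using multilinear out_deg_down[of e A "?xs T"] assms
    by (simp add: graded_multilinear_def proj_scal)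
  moreover have "\<phi> (down A (?xs Z)) \<in> carrier (B (e + tdeg (?xs T)))" for Z
    using closed[of "down A (?xs Z)"] out_deg_down[of e A "?xs Z"] by simp
  moreover obtain n where "\<And>Z. sign_exp (down A (?xs Z)) = n"
  proof (rule that)
    show "sign_exp (down A (?xs Z)) = sign_exp (down A (?xs 0))" for Z
      by (rule sign_exp_cong) simp
  qed
  ultimately show ?thesis
    using assms unfolding lift_signed[OF not_Cons_append] by (simp add: emb_scal[where R = R] additive.alt[OF additive_scal])
qed

end

context graded_map
begin

text \<open>Inserting a value of \<open>\<mu>\<close> changes the number of arguments and the sum of
  degrees in such a way that every term has degree \<open>out_deg (e + 1) xs\<close>. The sum can
  therefore be embedded term by term, and its Koszul sign becomes \<open>alt\<close> of the total
  shifted degree of \<open>us\<close>.\<close>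

lemma emb_insertion_sum:
  assumes \<mu>: "graded_map R A A 2 \<mu>" and xs: "homog A xs"
  shows "emb (B (out_deg (e + 1) xs)) (insertion_sum B e \<phi> A \<mu> xs) =
    insertion L (lift A A 2 \<mu>) (up A xs)"
    and "insertion_sum B e \<phi> A \<mu> xs \<in> carrier (B (out_deg (e + 1) xs))"
proof -
  interpret \<mu>: graded_map R A A 2 \<mu> by (rule \<mu>)
  interpret M: abelian_group "B (out_deg (e + 1) xs)" by simp
  let ?s = "\<lambda>us vs ws. us @ shifted A 2 \<mu> vs # ws"
  have *: "homog A us" "homog A vs" "homog A ws" "homog A (?s us vs ws)"
      "out_deg e (?s us vs ws) = out_deg (e + 1) xs"
    if "(us, vs, ws) \<in> splits3 xs" for us vs ws
  proof -
    have x: "xs = us @ vs @ ws" "vs \<noteq> []" using that by (auto simp: splits3_def)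
    then show h: "homog A us" "homog A vs" "homog A ws" using xs by auto
    show "homog A (?s us vs ws)"
      using h \<mu>.shifted_closed[of vs] x by (simp add: shifted_def)
    show "out_deg e (?s us vs ws) = out_deg (e + 1) xs"
      by (simp add: x out_deg_def shifted_def)
  qed
  have cl: "snd (shifted B e \<phi> (?s us vs ws)) \<in> carrier (B (out_deg (e + 1) xs))"
    if "(us, vs, ws) \<in> splits3 xs" for us vs ws
    using shifted_closed[of "?s us vs ws"] *[OF that] by simp
  show "insertion_sum B e \<phi> A \<mu> xs \<in> carrier (B (out_deg (e + 1) xs))"
    unfolding insertion_sum_def splits3_def[symmetric] 
  proof (intro M.finsum_closed Pi_I)
    fix t assume t: "t \<in> splits3 xs"
    obtain us vs ws where "t = (us, vs, ws)" by (cases t) auto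
    then show "(case t of (us, vs, ws) \<Rightarrow> signed (B (out_deg (e + 1) xs)) (\<Sum>u\<leftarrow>us. sdeg u)
        (snd (shifted B e \<phi> (?s us vs ws)))) \<in> carrier (B (out_deg (e + 1) xs))"
      using cl[of us vs ws] t by simp
  qed
  have "emb (B (out_deg (e + 1) xs)) (insertion_sum B e \<phi> A \<mu> xs) =
    (\<Sum>(us, vs, ws)\<in>splits3 xs. emb (B (out_deg (e + 1) xs))
       (signed (B (out_deg (e + 1) xs)) (\<Sum>u\<leftarrow>us. sdeg u) (snd (shifted B e \<phi> (?s us vs ws)))))"
    unfolding insertion_sum_def splits3_def[symmetric]
    by (subst emb_finsum) (auto simp: cl intro!: sum.cong)
  also have "\<dots> = (\<Sum>(us, vs, ws)\<in>splits3 xs. alt (tdeg (up A us))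
     (L (up A us @ (tdeg (up A vs) + 1, lift A A 2 \<mu> (up A vs)) # up A ws)))"
  proof (intro sum.cong refl, clarify)
    fix us vs ws assume t: "(us, vs, ws) \<in> splits3 xs"
    have "L (up A us @ (tdeg (up A vs) + 1, lift A A 2 \<mu> (up A vs)) # up A ws) = L (up A (?s us vs ws))"
      using \<mu>.up_shifted[of vs] *[OF t] by (simp add: up_def add.commute)
    also have "\<dots> = emb (B (out_deg (e + 1) xs)) (snd (shifted B e \<phi> (?s us vs ws)))"
      using lift_up[OF *(4)[OF t]] *(5)[OF t] by simp
    finally show "emb (B (out_deg (e + 1) xs))
         (signed (B (out_deg (e + 1) xs)) (\<Sum>u\<leftarrow>us. sdeg u) (snd (shifted B e \<phi> (?s us vs ws)))) =
       alt (tdeg (up A us)) (L (up A us @ (tdeg (up A vs) + 1, lift A A 2 \<mu> (up A vs)) # up A ws))"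
      using cl[OF t] by (simp add: emb_signed sum_list_sdeg[of us A])
  qed
  also have "\<dots> = insertion L (lift A A 2 \<mu>) (up A xs)"
    unfolding insertion_def up_def sum_splits3_map by simp
  finally show "emb (B (out_deg (e + 1) xs)) (insertion_sum B e \<phi> A \<mu> xs) =
    insertion L (lift A A 2 \<mu>) (up A xs)" .
qed

text \<open>Lifted operations see a list only through its projections, so equations known for
  homogeneous lists extend to all lists.\<close>

lemma insertion_down:
  assumes \<mu>: "graded_map R A A 2 \<mu>"
  shows "insertion L (lift A A 2 \<mu>) xs = insertion L (lift A A 2 \<mu>) (up A (down A xs))"
proof -
  interpret \<mu>: graded_map R A A 2 \<mu> by (rule \<mu>)
  have d: "down A (up A (down A us)) = down A us" for us by (simp add: dom.down_up)
  have t: "tdeg (up A (down A us)) = tdeg us" for us :: "(int \<times> ('r, 'a) tot) list"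
    by (induction us) auto
  have m: "up A (down A us) = map (\<lambda>(s, T). (s, emb (A (s + 1)) (proj (A (s + 1)) T))) us" for us
    by (auto simp: up_def down_def)
  show ?thesis
    unfolding m insertion_def sum_splits3_map
    unfolding m[symmetric] case_prod_conv t
    by (intro sum.cong refl) (auto intro!: arg_cong[of _ _ "alt _"] lift_cong simp: d \<mu>.lift_cong[OF d])
qed

end

section \<open>A dga in shifted form\<close>

locale dg_algebra = graded_mod R A
  for R :: "('r, 's) ring_scheme" and A :: "('r, 'a) graded" +
  fixes \<delta> :: "(int \<times> 'a) list \<Rightarrow> 'a"
  assumes dga: "dga R A \<delta>"
begin

lemma a_inf: "a_inf_algebra R A \<delta>"
  using dga by (simp add: dga_def)

sublocale \<delta>: graded_map R A A 2 \<delta>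
  by unfold_locales (use a_inf in \<open>simp add: a_inf_algebra_def\<close>)

abbreviation "b1 \<equiv> \<lambda>s T. \<delta>.L [(s, T)]"
abbreviation "b2 \<equiv> \<lambda>s t T Y. \<delta>.L [(s, T), (t, Y)]"

lemma lift_long: "3 \<le> length xs \<Longrightarrow> \<delta>.L xs = 0"
proof -
  assume l: "3 \<le> length xs"
  then have "\<delta> (down A xs) = \<zero>\<^bsub>A (2 + tdeg xs)\<^esub>"
    using dga by (simp add: dga_def out_deg_down)
  moreover have "xs \<noteq> []" using l by auto
  ultimately show ?thesis by (simp add: \<delta>.lift_signed)
qed

lemma insertion_zero: "xs \<noteq> [] \<Longrightarrow> insertion \<delta>.L \<delta>.L xs = 0"
  using a_inf \<delta>.emb_insertion_sum[OF \<delta>.graded_map_axioms, of "down A xs"]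
    \<delta>.insertion_down[OF \<delta>.graded_map_axioms, of xs]
  by (simp add: a_inf_algebra_def)

lemma splits3_small:
  "splits3 [a] = {([], [a], [])}"
  "splits3 [a, b] = {([], [a], [b]), ([], [a, b], []), ([a], [b], [])}"
  "splits3 [a, b, c] = {([], [a], [b, c]), ([], [a, b], [c]), ([], [a, b, c], []), ([a], [b], [c]),
     ([a], [b, c], []), ([a, b], [c], [])}"
  by (auto simp: splits3_def append_eq_Cons_conv)

sublocale shifted_dga b1 b2
proof
  show "b1 s (T + Y) = b1 s T + b1 s Y" for s T Y
    using additive.add[OF \<delta>.additive_lift[of "[]" s "[]"]] by simp
  show "b2 s t (T + U) Y = b2 s t T Y + b2 s t U Y" for s t T U Y
    using additive.add[OF \<delta>.additive_lift[of "[]" s "[(t, Y)]"]] by simp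
  show "b2 s t T (Y + Z) = b2 s t T Y + b2 s t T Z" for s t T Y Z
    using additive.add[OF \<delta>.additive_lift[of "[(s, T)]" t "[]"]] by simp
  show "b1 (s + 1) (b1 s T) = 0" for s T
    using insertion_zero[of "[(s, T)]"] by (simp add: insertion_def splits3_small)
  show "b1 (s + t + 1) (b2 s t T Y) + b2 (s + 1) t (b1 s T) Y + alt s (b2 s (t + 1) T (b1 t Y)) = 0" for s t T Y
    using insertion_zero[of "[(s, T), (t, Y)]"]
    by (simp add: insertion_def splits3_small add_ac)
  \<comment> \<open>Of the six insertions into three arguments, the four that involve the ternary
    operation vanish; the two iterated products remain.\<close>
  show "b2 (s + t + 1) r (b2 s t T Y) Z + alt s (b2 s (t + r + 1) T (b2 t r Y Z)) = 0" for s t r T Y Z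
    using insertion_zero[of "[(s, T), (t, Y), (r, Z)]"]
      additive.zero[OF \<delta>.additive_lift[of "[]" "1 + (r + (s + t))" "[]"]]
    by (simp add: insertion_def splits3_small add_ac lift_long)
qed

end

lemma finite_blocks: "finite {yss. concat yss = xs \<and> [] \<notin> set yss}"
proof (rule finite_subset)
  let ?S = "{ys. set ys \<subseteq> set xs \<and> length ys \<le> length xs}"
  have *: "length yss \<le> length (concat yss)" if "[] \<notin> set yss" for yss :: "'x list list"
    using that
  proof (induction yss)
    case (Cons ys yss)
    then have "1 \<le> length ys" by (cases ys) auto
    then show ?case using Cons by simp
  qed simp
  have "length ys \<le> length (concat yss)" if "ys \<in> set yss" for ys :: "'x list" and yss
    using that by (induction yss) auto
  then show "{yss. concat yss = xs \<and> [] \<notin> set yss} \<subseteq> {yss. set yss \<subseteq> ?S \<and> length yss \<le> length xs}"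
    using * by auto
  show "finite {yss. set yss \<subseteq> ?S \<and> length yss \<le> length xs}"
    by (simp add: finite_lists_length_le)
qed

text \<open>The cuts that matter for a target without operations of arity three or more: one block
  or two.\<close>

lemma short_blocks:
  assumes "xs \<noteq> []"
  shows "{yss. concat yss = xs \<and> [] \<notin> set yss \<and> length yss \<le> 2} =
    insert [xs] ((\<lambda>(ys, zs). [ys, zs]) ` splits2 xs)" (is "?A = ?B")
proof
  show "?A \<subseteq> ?B"
  proof
    fix yss assume y: "yss \<in> ?A"
    then consider "yss = []" | ys where "yss = [ys]" | ys zs where "yss = [ys, zs]"
      by (cases yss; cases "tl yss"; cases "tl (tl yss)") auto
    then show "yss \<in> ?B"
      using y assms by cases (auto simp: splits2_def image_iff)
  qed
qed (use assms in \<open>auto simp: splits2_def\<close>)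

lemma (in dg_algebra) emb_morphism_rhs:
  assumes f: "graded_map R H A 1 f" and xs: "homog H xs" "xs \<noteq> []"
  shows "emb (A (out_deg 2 xs)) (\<Oplus>\<^bsub>A (out_deg 2 xs)\<^esub> yss \<in> {yss. concat yss = xs \<and> [] \<notin> set yss}.
           snd (shifted A 2 \<delta> (map (shifted A 1 f) yss))) =
     b1 (tdeg (up H xs)) (lift H A 1 f (up H xs)) + quad (lift H A 1 f) (up H xs)"
    and "(\<Oplus>\<^bsub>A (out_deg 2 xs)\<^esub> yss \<in> {yss. concat yss = xs \<and> [] \<notin> set yss}.
           snd (shifted A 2 \<delta> (map (shifted A 1 f) yss))) \<in> carrier (A (out_deg 2 xs))"
proof -
  interpret M: abelian_group "A (out_deg 2 xs)" by simp
  interpret f: graded_map R H A 1 f by (rule f)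
  let ?Y = "{yss. concat yss = xs \<and> [] \<notin> set yss}"
  let ?g = "\<lambda>yss. map (shifted A 1 f) yss"
  have deg: "out_deg 2 (?g yss) = 2 + tdeg (up H (concat yss))" for yss
    by (induction yss) (auto simp: out_deg_def shifted_def out_deg_up[of 1 _ H, unfolded out_deg_def])
  have hom: "homog A (?g yss)" if "homog H (concat yss)" "[] \<notin> set yss" for yss
    using that f.shifted_closed by (induction yss) (auto simp: shifted_def)
  have up: "up A (?g yss) = map (\<lambda>ys. (tdeg (up H ys), f.L (up H ys))) yss"
    if "homog H (concat yss)" for yss
    using that
  proof (induction yss)
    case (Cons ys yss)
    then show ?case using f.up_shifted[of ys] by (simp add: up_def)
  qed simp
  have e: "emb (A (out_deg 2 xs)) (snd (shifted A 2 \<delta> (?g yss))) =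
      \<delta>.L (map (\<lambda>ys. (tdeg (up H ys), f.L (up H ys))) yss)" if "yss \<in> ?Y" for yss
    using \<delta>.lift_up[OF hom[of yss]] up[of yss] deg[of yss] that xs by (simp add: out_deg_up[of 2 xs H])
  have cl: "snd (shifted A 2 \<delta> (?g yss)) \<in> carrier (A (out_deg 2 xs))" if "yss \<in> ?Y" for yss
  proof -
    have "yss \<noteq> []" using that xs by auto
    then show ?thesis
      using \<delta>.shifted_closed[OF _ hom[of yss]] deg[of yss] that xs by (auto simp: out_deg_up[of 2 xs H])
  qed
  show "(\<Oplus>\<^bsub>A (out_deg 2 xs)\<^esub> yss \<in> ?Y. snd (shifted A 2 \<delta> (?g yss))) \<in> carrier (A (out_deg 2 xs))"
    by (intro M.finsum_closed Pi_I cl)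
  have "emb (A (out_deg 2 xs)) (\<Oplus>\<^bsub>A (out_deg 2 xs)\<^esub> yss \<in> ?Y. snd (shifted A 2 \<delta> (?g yss))) =
     (\<Sum>yss\<in>?Y. \<delta>.L (map (\<lambda>ys. (tdeg (up H ys), f.L (up H ys))) yss))"
    by (subst emb_finsum) (use cl e in \<open>auto intro!: sum.cong\<close>)
  also have "\<dots> = (\<Sum>yss\<in>insert [xs] ((\<lambda>(ys, zs). [ys, zs]) ` splits2 xs).
      \<delta>.L (map (\<lambda>ys. (tdeg (up H ys), f.L (up H ys))) yss))"
    unfolding short_blocks[OF xs(2), symmetric]
  proof (rule sum.mono_neutral_right)
    have "\<delta>.L (map g yss) = 0" if "\<not> length yss \<le> 2" for g and yss :: "(int \<times> 'b) list list"
      using that by (intro lift_long) simp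
    then show "\<forall>yss\<in>?Y - {yss. concat yss = xs \<and> [] \<notin> set yss \<and> length yss \<le> 2}.
        \<delta>.L (map (\<lambda>ys. (tdeg (up H ys), f.L (up H ys))) yss) = 0" by blast
  qed (auto simp: finite_blocks)
  also have "\<dots> = b1 (tdeg (up H xs)) (f.L (up H xs)) +
     (\<Sum>yss\<in>(\<lambda>(ys, zs). [ys, zs]) ` splits2 xs. \<delta>.L (map (\<lambda>ys. (tdeg (up H ys), f.L (up H ys))) yss))"
    by (subst sum.insert) auto
  also have "(\<Sum>yss\<in>(\<lambda>(ys, zs). [ys, zs]) ` splits2 xs. \<delta>.L (map (\<lambda>ys. (tdeg (up H ys), f.L (up H ys))) yss))
      = quad f.L (up H xs)"
    unfolding quad_def up_def sum_splits2_map
    by (subst sum.reindex) (auto simp: inj_on_def intro!: sum.cong)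
  finally show "emb (A (out_deg 2 xs)) (\<Oplus>\<^bsub>A (out_deg 2 xs)\<^esub> yss \<in> ?Y. snd (shifted A 2 \<delta> (?g yss))) =
     b1 (tdeg (up H xs)) (f.L (up H xs)) + quad f.L (up H xs)" .
qed

section \<open>Massey sums of a graded module as sums over interval partitions\<close>

definition shifted_deg :: "(nat \<Rightarrow> int) \<Rightarrow> nat \<Rightarrow> nat \<Rightarrow> int" where
  "shifted_deg d p q = (\<Sum>k=p..q. d k - 1)"

lemma massey_deg_shifted_deg: "massey_deg d p q = shifted_deg d p q + 1"
  by (simp add: massey_deg_def shifted_deg_def)

lemma shifted_deg_add: "p \<le> j \<Longrightarrow> j < q \<Longrightarrow> shifted_deg d p q = shifted_deg d p j + shifted_deg d (Suc j) q"
proof -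
  assume "p \<le> j" "j < q"
  then have "{p..q} = {p..j} \<union> {Suc j..q}" by auto
  then show ?thesis unfolding shifted_deg_def by (simp add: sum.union_disjoint)
qed

lemma shifted_deg_same [simp]: "shifted_deg d p p = d p - 1"
  by (simp add: shifted_deg_def)

definition blocks :: "nat \<Rightarrow> nat list \<Rightarrow> nat \<Rightarrow> (nat \<times> nat) list" where
  "blocks p js q = zip (p # map Suc js) (js @ [q])"

lemma blocks_Cons [simp]: "blocks p (j # js) q = (p, j) # blocks (Suc j) js q"
  by (simp add: blocks_def)

lemma blocks_Nil [simp]: "blocks p [] q = [(p, q)]"
  by (simp add: blocks_def)

text \<open>The right ends of all blocks but the last give back the cut points, so the encoding is
  injective.\<close>

lemma blocks_ends: "butlast (map snd (blocks p js q)) = js"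
proof -
  have "map snd (blocks p js q) = js @ [q]" by (induction js arbitrary: p) auto
  then show ?thesis by simp
qed

lemma chain_blocks:
  "sorted_wrt (<) js \<Longrightarrow> set js \<subseteq> {p..<q} \<Longrightarrow> p \<le> q \<Longrightarrow> chain p (blocks p js q) (Suc q)"
proof (induction js arbitrary: p)
  case (Cons j js)
  then have "chain (Suc j) (blocks (Suc j) js q) (Suc q)" by (intro Cons.IH) force+
  then show ?case using Cons.prems by auto
qed simp

lemma chain_eq_blocks:
  "chain p L (Suc q) \<Longrightarrow> L \<noteq> [] \<Longrightarrow>
     \<exists>js. sorted_wrt (<) js \<and> set js \<subseteq> {p..<q} \<and> L = blocks p js q"
proof (induction p L "Suc q" rule: chain.induct)
  case (2 p i j L)
  then have i: "i = p" "p \<le> j" "chain (Suc j) L (Suc q)" by auto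
  show ?case
  proof (cases "L = []")
    case True
    then show ?thesis using i by (intro exI[of _ "[]"]) auto
  next
    case False
    then have "Suc j < Suc q" using chain_less i(3) by blast
    obtain js where js: "sorted_wrt (<) js" "set js \<subseteq> {Suc j..<q}" "L = blocks (Suc j) js q"
      using 2(1) 2(2) False by auto
    then show ?thesis using i \<open>Suc j < Suc q\<close> by (intro exI[of _ "j # js"]) force
  qed
qed simp

text \<open>The condition r \<ge> 2, that is, at least one cut point, corresponds to leaving out the
  partition into a single block.\<close>

lemma blocks_bij:
  assumes "p \<le> q"
  shows "bij_betw (\<lambda>js. blocks p js q)
    {js. js \<noteq> [] \<and> sorted_wrt (<) js \<and> set js \<subseteq> {p..<q}} (parts p q - {[(p, q)]})"
proof (rule bij_betwI')
  fix js js'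
  show "blocks p js q = blocks p js' q \<longleftrightarrow> js = js'" using blocks_ends by metis
next
  fix js assume "js \<in> {js. js \<noteq> [] \<and> sorted_wrt (<) js \<and> set js \<subseteq> {p..<q}}"
  then have "chain p (blocks p js q) (Suc q)" "blocks p js q \<noteq> [(p, q)]"
    using chain_blocks[of js p q] assms blocks_ends[of p js q] by auto
  then show "blocks p js q \<in> parts p q - {[(p, q)]}" by (simp add: parts_def)
next
  fix L assume L: "L \<in> parts p q - {[(p, q)]}"
  then obtain js where "sorted_wrt (<) js" "set js \<subseteq> {p..<q}" "L = blocks p js q"
    using chain_eq_blocks[of p L q] parts_ne_Nil[OF assms, of L] by (auto simp: parts_def)
  moreover from this have "js \<noteq> []" using L by auto
  ultimately show "\<exists>js\<in>{js. js \<noteq> [] \<and> sorted_wrt (<) js \<and> set js \<subseteq> {p..<q}}. L = blocks p js q"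
    by auto
qed

context graded_mod
begin

text \<open>The hypothesis on \<open>x\<close> leaves out (p, q) itself, since the nontrivial
  partitions never use that entry; at the corner of a defining system none is given.\<close>

lemma emb_massey_sum:
  assumes \<mu>: "graded_map R A A 2 \<mu>" and "p \<le> q"
    and x: "\<And>i j. p \<le> i \<Longrightarrow> i \<le> j \<Longrightarrow> j \<le> q \<Longrightarrow> (i, j) \<noteq> (p, q) \<Longrightarrow> x i j \<in> carrier (A (massey_deg d i j))"
  shows "emb (A (massey_deg d p q + 1)) (massey_sum A \<mu> d x p q) =
      massey (lift A A 2 \<mu>) (shifted_deg d) (\<lambda>i j. emb (A (massey_deg d i j)) (x i j)) p q"
    and "massey_sum A \<mu> d x p q \<in> carrier (A (massey_deg d p q + 1))"
proof -
  interpret \<mu>: graded_map R A A 2 \<mu> by (rule \<mu>)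
  interpret M: abelian_group "A (massey_deg d p q + 1)" by simp
  let ?J = "{js. js \<noteq> [] \<and> sorted_wrt (<) js \<and> set js \<subseteq> {p..<q}}"
  let ?y = "\<lambda>js. map (\<lambda>(i, j). (massey_deg d i j, x i j)) (blocks p js q)"
  let ?e = "\<lambda>i j. emb (A (massey_deg d i j)) (x i j)"
  have y: "?y js \<noteq> []" "homog A (?y js)" "out_deg 2 (?y js) = massey_deg d p q + 1"
    "up A (?y js) = args (shifted_deg d) ?e (blocks p js q)" if "js \<in> ?J" for js
  proof -
    have b: "blocks p js q \<in> parts p q - {[(p, q)]}"
      using bij_betwE[OF blocks_bij[OF \<open>p \<le> q\<close>]] that by blast
    show "?y js \<noteq> []" using parts_ne_Nil[OF \<open>p \<le> q\<close>] b by auto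
    show "homog A (?y js)"
      using parts_proper[of "blocks p js q" p q] b x by (auto simp: homog_def)
    show u: "up A (?y js) = args (shifted_deg d) ?e (blocks p js q)"
      by (auto simp: up_def args_def massey_deg_shifted_deg)
    have "tdeg (args (shifted_deg d) ?e (blocks p js q)) = shifted_deg d p q"
      using b \<open>p \<le> q\<close> by (intro tdeg_args[of "shifted_deg d", OF shifted_deg_add]) (auto simp: parts_def)
    then show "out_deg 2 (?y js) = massey_deg d p q + 1"
      unfolding out_deg_up[of 2 "?y js" A] u by (simp add: massey_deg_shifted_deg)
  qed
  have cl: "snd (shifted A 2 \<mu> (?y js)) \<in> carrier (A (massey_deg d p q + 1))" if "js \<in> ?J" for js
    using \<mu>.shifted_closed[OF y(1,2)] y(3) that by simp
  have ms: "massey_sum A \<mu> d x p q = (\<Oplus>\<^bsub>A (massey_deg d p q + 1)\<^esub> js \<in> ?J. snd (shifted A 2 \<mu> (?y js)))"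
    by (simp add: massey_sum_def blocks_def)
  show "massey_sum A \<mu> d x p q \<in> carrier (A (massey_deg d p q + 1))"
    unfolding ms using cl by (intro M.finsum_closed) auto
  have "emb (A (massey_deg d p q + 1)) (massey_sum A \<mu> d x p q) =
      (\<Sum>js\<in>?J. emb (A (massey_deg d p q + 1)) (snd (shifted A 2 \<mu> (?y js))))"
    unfolding ms using cl by (intro emb_finsum) auto
  also have "\<dots> = (\<Sum>js\<in>?J. \<mu>.L (args (shifted_deg d) ?e (blocks p js q)))"
  proof (intro sum.cong refl)
    fix js assume "js \<in> ?J"
    then show "emb (A (massey_deg d p q + 1)) (snd (shifted A 2 \<mu> (?y js))) = \<mu>.L (args (shifted_deg d) ?e (blocks p js q))"
      using \<mu>.lift_up[OF y(2)[of js]] y(3)[of js] y(4)[of js] by simp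
  qed
  also have "\<dots> = massey \<mu>.L (shifted_deg d) ?e p q"
    unfolding massey_def using blocks_bij[OF \<open>p \<le> q\<close>] by (rule sum.reindex_bij_betw)
  finally show "emb (A (massey_deg d p q + 1)) (massey_sum A \<mu> d x p q) = massey \<mu>.L (shifted_deg d) ?e p q" .
qed

lemma massey_sum_cong:
  assumes "graded_map R A A 2 \<mu>" "p \<le> q"
    and "\<And>i j. p \<le> i \<Longrightarrow> i \<le> j \<Longrightarrow> j \<le> q \<Longrightarrow> (i, j) \<noteq> (p, q) \<Longrightarrow> x i j \<in> carrier (A (massey_deg d i j))"
    and xy: "\<And>i j. p \<le> i \<Longrightarrow> i \<le> j \<Longrightarrow> j \<le> q \<Longrightarrow> (i, j) \<noteq> (p, q) \<Longrightarrow> x i j = y i j"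
  shows "massey_sum A \<mu> d x p q = massey_sum A \<mu> d y p q"
proof -
  have y: "y i j \<in> carrier (A (massey_deg d i j))" if "p \<le> i" "i \<le> j" "j \<le> q" "(i, j) \<noteq> (p, q)" for i j
    using assms(3)[OF that] xy[OF that] by simp
  have "massey (lift A A 2 \<mu>) (shifted_deg d) (\<lambda>i j. emb (A (massey_deg d i j)) (x i j)) p q =
        massey (lift A A 2 \<mu>) (shifted_deg d) (\<lambda>i j. emb (A (massey_deg d i j)) (y i j)) p q"
    by (rule massey_cong) (simp add: xy)
  then show ?thesis
    using emb_massey_sum[OF assms(1,2), of x d] emb_massey_sum[OF assms(1,2), of y d] assms(3) y
      emb_inj[OF abelian_group, of "massey_sum A \<mu> d x p q" "massey_deg d p q + 1" "massey_sum A \<mu> d y p q"]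
    by simp
qed

lemma massey_sum_same: "massey_sum A \<mu> d x p p = \<zero>\<^bsub>A (massey_deg d p p + 1)\<^esub>"
proof -
  interpret M: abelian_group "A (massey_deg d p p + 1)" by simp
  have "{js. js \<noteq> [] \<and> sorted_wrt (<) js \<and> set js \<subseteq> {p..<p}} = {}" by auto
  then show ?thesis by (simp only: massey_sum_def M.finsum_empty)
qed

end

lemma module_hom_zero:
  assumes "module R M" "module R N" "g \<in> module_hom R M N"
  shows "g \<zero>\<^bsub>M\<^esub> = \<zero>\<^bsub>N\<^esub>"
  using mod_hom.f0_is_0[of R M N g] assms by (simp add: mod_hom_def mod_hom_axioms_def)

lemma module_hom_minus:
  assumes "module R M" "module R N" "g \<in> module_hom R M N" "v \<in> carrier M"
  shows "g (\<ominus>\<^bsub>M\<^esub> v) = \<ominus>\<^bsub>N\<^esub> g v"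
  using mod_hom.f_neg[of R M N g v] assms by (simp add: mod_hom_def mod_hom_axioms_def)

lemma module_hom_in: "g \<in> module_hom R M N \<Longrightarrow> v \<in> carrier M \<Longrightarrow> g v \<in> carrier N"
  by (auto simp: module_hom_def)

section \<open>Contraction of a dga over a field onto its cohomology\<close>

definition lin_closed :: "('r, 's) ring_scheme \<Rightarrow> ('r, 'a, 'm) module_scheme \<Rightarrow> 'a set \<Rightarrow> bool" where
  "lin_closed R M N \<longleftrightarrow> N \<subseteq> carrier M \<and> \<zero>\<^bsub>M\<^esub> \<in> N \<and>
     (\<forall>x\<in>N. \<forall>y\<in>N. x \<oplus>\<^bsub>M\<^esub> y \<in> N) \<and> (\<forall>c\<in>carrier R. \<forall>x\<in>N. c \<odot>\<^bsub>M\<^esub> x \<in> N)"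

lemma (in module) lin_closed_minus:
  assumes "lin_closed R M N" "x \<in> N"
  shows "\<ominus>\<^bsub>M\<^esub> x \<in> N"
proof -
  have "(\<ominus> \<one>) \<odot>\<^bsub>M\<^esub> x \<in> N" "x \<in> carrier M" using assms by (auto simp: lin_closed_def)
  then show ?thesis by (simp add: smult_l_minus)
qed

text \<open>Zorn's lemma gives a maximal subspace \<open>C\<close> that meets \<open>N\<close>
  trivially. If some \<open>v\<close> were outside N + C, the span of \<open>C\<close> and
  \<open>v\<close> would still meet \<open>N\<close> trivially: an element of \<open>N\<close> in it
  with nonzero coefficient of \<open>v\<close> could be divided by that coefficient and solved for
  \<open>v\<close>.\<close>

lemma (in module) complement_exists:
  assumes "field R" and N: "lin_closed R M N"
  obtains C where "lin_closed R M C" "C \<inter> N \<subseteq> {\<zero>\<^bsub>M\<^esub>}"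
    "\<And>v. v \<in> carrier M \<Longrightarrow> \<exists>n\<in>N. \<exists>c\<in>C. v = n \<oplus>\<^bsub>M\<^esub> c"
proof -
  interpret F: field R by (rule assms(1))
  let ?S = "{C. lin_closed R M C \<and> C \<inter> N \<subseteq> {\<zero>\<^bsub>M\<^esub>}}"
  have "\<exists>C\<in>?S. \<forall>D\<in>?S. C \<subseteq> D \<longrightarrow> D = C"
  proof (rule subset_Zorn_nonempty)
    have "{\<zero>\<^bsub>M\<^esub>} \<in> ?S" by (auto simp: lin_closed_def)
    then show "?S \<noteq> {}" by blast
    fix \<C> assume \<C>: "\<C> \<noteq> {}" "subset.chain ?S \<C>"
    have l: "lin_closed R M D" "D \<inter> N \<subseteq> {\<zero>\<^bsub>M\<^esub>}" if "D \<in> \<C>" for D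
      using \<C> that by (auto simp: subset.chain_def)
    \<comment> \<open>Two members of the chain are comparable, so both summands lie in the larger
      one.\<close>
    have add: "x \<oplus>\<^bsub>M\<^esub> y \<in> \<Union>\<C>" if xy: "x \<in> D" "y \<in> E" "D \<in> \<C>" "E \<in> \<C>" for x y D E
    proof -
      have "D \<subseteq> E \<or> E \<subseteq> D" using \<C>(2) xy by (auto simp: subset_chain_def)
      then obtain F where "x \<in> F" "y \<in> F" "F \<in> \<C>" using xy by blast
      then show ?thesis using l(1)[of F] unfolding lin_closed_def by blast
    qed
    have "lin_closed R M (\<Union>\<C>)"
      unfolding lin_closed_def
    proof (intro conjI ballI)
      show "\<Union>\<C> \<subseteq> carrier M"
      proof
        fix x assume "x \<in> \<Union>\<C>"
        then obtain D where "x \<in> D" "D \<in> \<C>" by blast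
        then show "x \<in> carrier M" using l(1)[of D] by (auto simp: lin_closed_def)
      qed
      obtain D where "D \<in> \<C>" using \<C>(1) by blast
      then show "\<zero>\<^bsub>M\<^esub> \<in> \<Union>\<C>" using l(1)[of D] by (auto simp: lin_closed_def)
      show "x \<oplus>\<^bsub>M\<^esub> y \<in> \<Union>\<C>" if "x \<in> \<Union>\<C>" "y \<in> \<Union>\<C>" for x y
        using that add by (elim UnionE)
      show "c \<odot>\<^bsub>M\<^esub> x \<in> \<Union>\<C>" if c: "c \<in> carrier R" and x: "x \<in> \<Union>\<C>" for c x
      proof -
        obtain D where D: "x \<in> D" "D \<in> \<C>" using x by blast
        then have "c \<odot>\<^bsub>M\<^esub> x \<in> D" using l(1)[of D] c by (auto simp: lin_closed_def)
        then show ?thesis using D by blast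
      qed
    qed
    then show "\<Union>\<C> \<in> ?S" using l(2) by auto
  qed
  then obtain C where C: "lin_closed R M C" "C \<inter> N \<subseteq> {\<zero>\<^bsub>M\<^esub>}"
    and max: "\<And>D. lin_closed R M D \<Longrightarrow> D \<inter> N \<subseteq> {\<zero>\<^bsub>M\<^esub>} \<Longrightarrow> C \<subseteq> D \<Longrightarrow> D = C"
    by auto
  have sub: "C \<subseteq> carrier M" "N \<subseteq> carrier M" "\<zero>\<^bsub>M\<^esub> \<in> C" "\<zero>\<^bsub>M\<^esub> \<in> N"
    using C N by (auto simp: lin_closed_def)
  have "\<exists>n\<in>N. \<exists>c\<in>C. v = n \<oplus>\<^bsub>M\<^esub> c" if v: "v \<in> carrier M" for v
  proof (rule ccontr)
    assume not: "\<not> ?thesis"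
    define D where "D = {c \<oplus>\<^bsub>M\<^esub> a \<odot>\<^bsub>M\<^esub> v | c a. c \<in> C \<and> a \<in> carrier R}"
    have "lin_closed R M D"
      unfolding lin_closed_def
    proof (intro conjI ballI)
      show "D \<subseteq> carrier M" using sub v by (auto simp: D_def)
      have "\<zero>\<^bsub>M\<^esub> = \<zero>\<^bsub>M\<^esub> \<oplus>\<^bsub>M\<^esub> \<zero> \<odot>\<^bsub>M\<^esub> v" using v by simp
      then show "\<zero>\<^bsub>M\<^esub> \<in> D" unfolding D_def using sub by blast
    next
      fix x y assume "x \<in> D" "y \<in> D"
      then obtain c a c' a' where xy: "x = c \<oplus>\<^bsub>M\<^esub> a \<odot>\<^bsub>M\<^esub> v" "y = c' \<oplus>\<^bsub>M\<^esub> a' \<odot>\<^bsub>M\<^esub> v" and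
        mem: "c \<in> C" "a \<in> carrier R" "c' \<in> C" "a' \<in> carrier R" by (auto simp: D_def)
      then have "x \<oplus>\<^bsub>M\<^esub> y = (c \<oplus>\<^bsub>M\<^esub> c') \<oplus>\<^bsub>M\<^esub> (a \<oplus> a') \<odot>\<^bsub>M\<^esub> v"
        using sub v by (simp add: smult_l_distr M.a_ac subset_iff)
      moreover have "c \<oplus>\<^bsub>M\<^esub> c' \<in> C" using C(1) mem by (simp add: lin_closed_def)
      ultimately show "x \<oplus>\<^bsub>M\<^esub> y \<in> D" unfolding D_def using mem by blast
    next
      fix b x assume "b \<in> carrier R" "x \<in> D"
      then obtain c a where x: "x = c \<oplus>\<^bsub>M\<^esub> a \<odot>\<^bsub>M\<^esub> v" and mem: "c \<in> C" "a \<in> carrier R"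
        by (auto simp: D_def)
      have "b \<odot>\<^bsub>M\<^esub> x = b \<odot>\<^bsub>M\<^esub> c \<oplus>\<^bsub>M\<^esub> (b \<otimes> a) \<odot>\<^bsub>M\<^esub> v"
        using sub v mem \<open>b \<in> carrier R\<close> by (simp add: x smult_r_distr smult_assoc1 subset_iff)
      moreover have "b \<odot>\<^bsub>M\<^esub> c \<in> C" using C(1) mem \<open>b \<in> carrier R\<close> by (simp add: lin_closed_def)
      ultimately show "b \<odot>\<^bsub>M\<^esub> x \<in> D" unfolding D_def using mem \<open>b \<in> carrier R\<close> by blast
    qed
    moreover have "D \<inter> N \<subseteq> {\<zero>\<^bsub>M\<^esub>}"
    proof
      fix n assume "n \<in> D \<inter> N"
      then obtain c a where n: "n = c \<oplus>\<^bsub>M\<^esub> a \<odot>\<^bsub>M\<^esub> v" "c \<in> C" "a \<in> carrier R" "n \<in> N"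
        by (auto simp: D_def)
      have car: "c \<in> carrier M" "n \<in> carrier M" using n sub by auto
      show "n \<in> {\<zero>\<^bsub>M\<^esub>}"
      proof (cases "a = \<zero>")
        case True
        then have "n = c" using n car v by simp
        then show ?thesis using C(2) n by auto
      next
        case False
        then have "a \<in> Units R" using n(3) by (simp add: F.field_Units)
        then have a: "inv a \<in> carrier R" "inv a \<otimes> a = \<one>" by simp_all
        have "inv a \<odot>\<^bsub>M\<^esub> n = inv a \<odot>\<^bsub>M\<^esub> c \<oplus>\<^bsub>M\<^esub> v"
          using n a car v by (simp add: smult_r_distr smult_assoc1[symmetric])
        then have "v = inv a \<odot>\<^bsub>M\<^esub> n \<oplus>\<^bsub>M\<^esub> (\<ominus>\<^bsub>M\<^esub> (inv a \<odot>\<^bsub>M\<^esub> c))"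
          using a car v by (simp add: M.a_ac M.r_neg)
        moreover have "inv a \<odot>\<^bsub>M\<^esub> n \<in> N" using N n a by (simp add: lin_closed_def)
        moreover have "\<ominus>\<^bsub>M\<^esub> (inv a \<odot>\<^bsub>M\<^esub> c) \<in> C"
          using C(1) n a by (intro lin_closed_minus) (auto simp: lin_closed_def)
        ultimately show ?thesis using not by blast
      qed
    qed
    moreover have "C \<subseteq> D"
    proof
      fix c assume "c \<in> C"
      then have "c = c \<oplus>\<^bsub>M\<^esub> \<zero> \<odot>\<^bsub>M\<^esub> v" using v sub by (simp add: subset_iff)
      then show "c \<in> D" unfolding D_def using \<open>c \<in> C\<close> by blast
    qed
    ultimately have "D = C" by (rule max)
    moreover have "v = \<zero>\<^bsub>M\<^esub> \<oplus>\<^bsub>M\<^esub> \<one> \<odot>\<^bsub>M\<^esub> v" using v by simp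
    ultimately have "v \<in> C" unfolding D_def using sub by blast
    moreover have "v = \<zero>\<^bsub>M\<^esub> \<oplus>\<^bsub>M\<^esub> v" using v by simp
    ultimately show False using not sub by blast
  qed
  with C show ?thesis using that by blast
qed

text \<open>The projection along a complement; it is well defined because two decompositions of a
  vector differ by an element of both subspaces.\<close>

lemma projection_exists:
  fixes M :: "('r, 'a) module"
  assumes "module R M" "field R" and N: "lin_closed R M N"
  obtains q where "q \<in> module_hom R M M" "\<And>v. v \<in> carrier M \<Longrightarrow> q v \<in> N" "\<And>v. v \<in> N \<Longrightarrow> q v = v"
proof -
  interpret module R M by (rule assms(1))
  obtain C where C: "lin_closed R M C" "C \<inter> N \<subseteq> {\<zero>\<^bsub>M\<^esub>}"
    and dec: "\<And>v. v \<in> carrier M \<Longrightarrow> \<exists>n\<in>N. \<exists>c\<in>C. v = n \<oplus>\<^bsub>M\<^esub> c"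
    using complement_exists[OF assms(2,3)] by metis
  have sub: "C \<subseteq> carrier M" "N \<subseteq> carrier M" "\<zero>\<^bsub>M\<^esub> \<in> C" "\<zero>\<^bsub>M\<^esub> \<in> N"
    and cl: "\<And>x y. x \<in> C \<Longrightarrow> y \<in> C \<Longrightarrow> x \<oplus>\<^bsub>M\<^esub> y \<in> C" "\<And>x y. x \<in> N \<Longrightarrow> y \<in> N \<Longrightarrow> x \<oplus>\<^bsub>M\<^esub> y \<in> N"
      "\<And>a x. a \<in> carrier R \<Longrightarrow> x \<in> C \<Longrightarrow> a \<odot>\<^bsub>M\<^esub> x \<in> C" "\<And>a x. a \<in> carrier R \<Longrightarrow> x \<in> N \<Longrightarrow> a \<odot>\<^bsub>M\<^esub> x \<in> N"
    using C N by (auto simp: lin_closed_def)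
  have uniq: "n = n'" if "n \<oplus>\<^bsub>M\<^esub> c = n' \<oplus>\<^bsub>M\<^esub> c'" "n \<in> N" "n' \<in> N" "c \<in> C" "c' \<in> C" for n n' c c'
  proof -
    have car: "n \<in> carrier M" "n' \<in> carrier M" "c \<in> carrier M" "c' \<in> carrier M" using that sub by auto
    have "emb M n + emb M c = emb M n' + emb M c'"
      using that(1) car emb_add[OF M.abelian_group_axioms] by metis
    then have "emb M (n \<oplus>\<^bsub>M\<^esub> (\<ominus>\<^bsub>M\<^esub> n')) = emb M (c' \<oplus>\<^bsub>M\<^esub> (\<ominus>\<^bsub>M\<^esub> c))"
      using car by (simp add: emb_add emb_minus M.abelian_group_axioms algebra_simps)
    then have e: "n \<oplus>\<^bsub>M\<^esub> (\<ominus>\<^bsub>M\<^esub> n') = c' \<oplus>\<^bsub>M\<^esub> (\<ominus>\<^bsub>M\<^esub> c)"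
      using car by (simp add: emb_inj M.abelian_group_axioms)
    have "n \<oplus>\<^bsub>M\<^esub> (\<ominus>\<^bsub>M\<^esub> n') \<in> N" "c' \<oplus>\<^bsub>M\<^esub> (\<ominus>\<^bsub>M\<^esub> c) \<in> C"
      using that lin_closed_minus[OF N] lin_closed_minus[OF C(1)] cl by auto
    then have "n \<ominus>\<^bsub>M\<^esub> n' = \<zero>\<^bsub>M\<^esub>" using e C(2) by (auto simp: a_minus_def)
    then show ?thesis using car by simp
  qed
  define q where "q v = (SOME n. n \<in> N \<and> (\<exists>c\<in>C. v = n \<oplus>\<^bsub>M\<^esub> c))" for v
  have q: "q v \<in> N \<and> (\<exists>c\<in>C. v = q v \<oplus>\<^bsub>M\<^esub> c)" if "v \<in> carrier M" for v
    unfolding q_def by (rule someI_ex) (use dec[OF that] in blast)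
  have q_eq: "q (n \<oplus>\<^bsub>M\<^esub> c) = n" if nc: "n \<in> N" "c \<in> C" for n c
  proof -
    have "n \<oplus>\<^bsub>M\<^esub> c \<in> carrier M" using that sub by auto
    then obtain c' where "q (n \<oplus>\<^bsub>M\<^esub> c) \<in> N" "c' \<in> C" "n \<oplus>\<^bsub>M\<^esub> c = q (n \<oplus>\<^bsub>M\<^esub> c) \<oplus>\<^bsub>M\<^esub> c'"
      using q by blast
    then show ?thesis using uniq nc by metis
  qed
  show ?thesis
  proof
    show "q v \<in> N" if "v \<in> carrier M" for v using q that by blast
    show "q v = v" if "v \<in> N" for v using q_eq[OF that sub(3)] that sub by (simp add: subset_iff)
    have "q (v \<oplus>\<^bsub>M\<^esub> w) = q v \<oplus>\<^bsub>M\<^esub> q w" if vw: "v \<in> carrier M" "w \<in> carrier M" for v w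
    proof -
      obtain c c' where c: "c \<in> C" "v = q v \<oplus>\<^bsub>M\<^esub> c" "c' \<in> C" "w = q w \<oplus>\<^bsub>M\<^esub> c'" using q vw by blast
      have car: "c \<in> carrier M" "c' \<in> carrier M" "q v \<in> carrier M" "q w \<in> carrier M"
        using c q vw sub by auto
      have "v \<oplus>\<^bsub>M\<^esub> w = (q v \<oplus>\<^bsub>M\<^esub> q w) \<oplus>\<^bsub>M\<^esub> (c \<oplus>\<^bsub>M\<^esub> c')"
        by (subst c(2), subst c(4)) (simp add: car M.a_ac)
      then show ?thesis using q_eq q vw cl c by metis
    qed
    moreover have "q (a \<odot>\<^bsub>M\<^esub> v) = a \<odot>\<^bsub>M\<^esub> q v" if av: "a \<in> carrier R" "v \<in> carrier M" for a v
    proof -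
      obtain c where c: "c \<in> C" "v = q v \<oplus>\<^bsub>M\<^esub> c" using q av by blast
      have car: "c \<in> carrier M" "q v \<in> carrier M" using c q av sub by auto
      have "a \<odot>\<^bsub>M\<^esub> v = a \<odot>\<^bsub>M\<^esub> q v \<oplus>\<^bsub>M\<^esub> a \<odot>\<^bsub>M\<^esub> c"
        by (subst c(2)) (simp add: car av smult_r_distr)
      then show ?thesis using q_eq q av cl c by metis
    qed
    ultimately show "q \<in> module_hom R M M" using q sub by (auto simp: module_hom_def)
  qed
qed

context graded_map
begin

lemma multilinear_add:
  "homog A (xs @ (k, a) # ys) \<Longrightarrow> b \<in> carrier (A k) \<Longrightarrow> \<phi> (xs @ (k, a \<oplus>\<^bsub>A k\<^esub> b) # ys) =
     \<phi> (xs @ (k, a) # ys) \<oplus>\<^bsub>B (out_deg e (xs @ (k, a) # ys))\<^esub> \<phi> (xs @ (k, b) # ys)"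
  using multilinear unfolding graded_multilinear_def by blast

lemma multilinear_smult:
  "homog A (xs @ (k, a) # ys) \<Longrightarrow> c \<in> carrier R \<Longrightarrow> \<phi> (xs @ (k, c \<odot>\<^bsub>A k\<^esub> a) # ys) =
     c \<odot>\<^bsub>B (out_deg e (xs @ (k, a) # ys))\<^esub> \<phi> (xs @ (k, a) # ys)"
  using multilinear unfolding graded_multilinear_def by blast

lemma unary_linear:
  assumes "j = k + e - 1"
  shows "(\<lambda>a. \<phi> [(k, a)]) \<in> module_hom R (A k) (B j)"
proof -
  have o: "out_deg e [(k, a)] = j" for a :: 'a using assms by (simp add: out_deg_def)
  have "\<phi> [(k, a)] \<in> carrier (B j)" if "a \<in> carrier (A k)" for a
    using closed[of "[(k, a)]"] that o by simp
  moreover have "\<phi> [(k, a \<oplus>\<^bsub>A k\<^esub> b)] = \<phi> [(k, a)] \<oplus>\<^bsub>B j\<^esub> \<phi> [(k, b)]"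
    if "a \<in> carrier (A k)" "b \<in> carrier (A k)" for a b
    using multilinear_add[of "[]" k a "[]" b] that by (simp add: o)
  moreover have "\<phi> [(k, c \<odot>\<^bsub>A k\<^esub> a)] = c \<odot>\<^bsub>B j\<^esub> \<phi> [(k, a)]"
    if "c \<in> carrier R" "a \<in> carrier (A k)" for a c
    using multilinear_smult[of "[]" k a "[]" c] that by (simp add: o)
  ultimately show ?thesis by (auto simp: module_hom_def)
qed

text \<open>In the exponent of the shift sign the last argument has coefficient 0, so an operation
  of arity one is shifted without sign.\<close>

lemma lift_single:
  assumes "a \<in> carrier (A k)" "j = k + e - 1"
  shows "L [(k - 1, emb (A k) a)] = emb (B j) (\<phi> [(k, a)])"
  using lift_up[of "[(k, a)]"] assms(1)
  by (simp add: shifted_def signed_def out_deg_def assms(2) algebra_simps)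

end

lemma UN_eq_const: "a \<in> S \<Longrightarrow> (\<And>x. x \<in> S \<Longrightarrow> f x = K) \<Longrightarrow> (\<Union>x\<in>S. f x) = K"
  by blast

section \<open>Cohomology of a dga\<close>

context dg_algebra
begin

abbreviation "ZZ \<equiv> cocycles A \<delta>"
abbreviation "BB \<equiv> coboundaries A \<delta>"
abbreviation "cls \<equiv> coh_class A \<delta>"
abbreviation "HH \<equiv> cohomology A \<delta>"

lemma d_linear: "(\<lambda>a. \<delta> [(k, a)]) \<in> module_hom R (A k) (A (k + 1))"
  by (rule \<delta>.unary_linear) simp

lemmas d_in = module_hom_in[OF d_linear]
lemmas d_zero = module_hom_zero[OF module module d_linear]
lemmas d_minus = module_hom_minus[OF module module d_linear]
lemmas d_add = module_hom_add[OF d_linear]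
lemmas d_smult = module_hom_smult[OF d_linear]

lemma b1_emb: "a \<in> carrier (A k) \<Longrightarrow> b1 (k - 1) (emb (A k) a) = emb (A (k + 1)) (\<delta> [(k, a)])"
  by (rule \<delta>.lift_single) auto

lemma b1_emb': "a \<in> carrier (A (s + 1)) \<Longrightarrow> b1 s (emb (A (s + 1)) a) = emb (A (s + 2)) (\<delta> [(s + 1, a)])"
  using b1_emb[of a "s + 1"] by (simp add: add.assoc)

lemma dd:
  assumes "a \<in> carrier (A k)" "i = k + 1" "j = k + 2"
  shows "\<delta> [(i, \<delta> [(k, a)])] = \<zero>\<^bsub>A j\<^esub>"
proof -
  have "emb (A (k + 2)) (\<delta> [(k + 1, \<delta> [(k, a)])]) = b1 k (b1 (k - 1) (emb (A k) a))"
    using b1_emb'[of "\<delta> [(k, a)]" k] b1_emb[OF assms(1)] d_in[OF assms(1)] by simp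
  also have "\<dots> = 0" using b1_b1[of "k - 1"] by simp
  finally show ?thesis using emb_eq_0[OF abelian_group, of _ "k + 2"] d_in[OF d_in[OF assms(1)]]
    by (simp add: add.assoc assms(2,3))
qed

lemma ZZ_iff: "a \<in> ZZ k \<longleftrightarrow> a \<in> carrier (A k) \<and> \<delta> [(k, a)] = \<zero>\<^bsub>A (k + 1)\<^esub>"
  by (simp add: cocycles_def)

lemma BB_iff: "b \<in> BB k \<longleftrightarrow> (\<exists>a\<in>carrier (A (k - 1)). b = \<delta> [(k - 1, a)])"
  by (auto simp: coboundaries_def)

lemma BB_carrier: "b \<in> BB k \<Longrightarrow> b \<in> carrier (A k)"
  using d_in[of _ "k - 1"] by (auto simp: BB_iff)

lemma BB_ZZ: "b \<in> BB k \<Longrightarrow> b \<in> ZZ k"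
  using dd[of _ "k - 1" k "k + 1"] BB_carrier[of b k] by (auto simp: BB_iff ZZ_iff)

lemma d_BB: "a \<in> carrier (A k) \<Longrightarrow> \<delta> [(k, a)] \<in> BB (k + 1)"
  by (auto simp: BB_iff)

lemma lin_closed_ZZ: "lin_closed R (A k) (ZZ k)"
proof -
  interpret module R "A k" by simp
  interpret N: module R "A (k + 1)" by simp
  show ?thesis
    unfolding lin_closed_def using d_add d_smult d_zero by (auto simp: ZZ_iff)
qed

lemma lin_closed_BB: "lin_closed R (A k) (BB k)"
proof -
  interpret module R "A k" by simp
  interpret N: module R "A (k - 1)" by simp
  note l = d_add[of _ "k - 1"] d_smult[of _ _ "k - 1"] d_zero[of "k - 1"]
  have "\<zero>\<^bsub>A k\<^esub> \<in> BB k" unfolding BB_iff using l(3) by (intro bexI[of _ "\<zero>\<^bsub>A (k - 1)\<^esub>"]) auto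
  moreover have "x \<oplus>\<^bsub>A k\<^esub> y \<in> BB k" if "x \<in> BB k" "y \<in> BB k" for x y
  proof -
    obtain a where a: "a \<in> carrier (A (k - 1))" "x = \<delta> [(k - 1, a)]" using \<open>x \<in> BB k\<close> by (auto simp: BB_iff)
    obtain b where b: "b \<in> carrier (A (k - 1))" "y = \<delta> [(k - 1, b)]" using \<open>y \<in> BB k\<close> by (auto simp: BB_iff)
    have "x \<oplus>\<^bsub>A k\<^esub> y = \<delta> [(k - 1, a \<oplus>\<^bsub>A (k - 1)\<^esub> b)]" using l(1)[OF a(1) b(1)] a b by simp
    then show ?thesis unfolding BB_iff using a(1) b(1) N.M.a_closed by blast
  qed
  moreover have "c \<odot>\<^bsub>A k\<^esub> x \<in> BB k" if "c \<in> carrier R" "x \<in> BB k" for c x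
  proof -
    obtain a where a: "a \<in> carrier (A (k - 1))" "x = \<delta> [(k - 1, a)]" using \<open>x \<in> BB k\<close> by (auto simp: BB_iff)
    have "c \<odot>\<^bsub>A k\<^esub> x = \<delta> [(k - 1, c \<odot>\<^bsub>A (k - 1)\<^esub> a)]" using l(2)[OF \<open>c \<in> carrier R\<close> a(1)] a by simp
    then show ?thesis unfolding BB_iff using a(1) \<open>c \<in> carrier R\<close> N.smult_closed by blast
  qed
  ultimately show ?thesis unfolding lin_closed_def using BB_carrier by auto
qed

lemma abelian_subgroup_BB: "abelian_subgroup (BB k) (A k)"
proof (rule abelian_subgroupI3)
  interpret module R "A k" by simp
  show "additive_subgroup (BB k) (A k)"
  proof (rule additive_subgroup.intro, rule subgroup.intro)
    show "BB k \<subseteq> carrier (add_monoid (A k))" using BB_carrier by auto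
    show "x \<otimes>\<^bsub>add_monoid (A k)\<^esub> y \<in> BB k" if "x \<in> BB k" "y \<in> BB k" for x y
      using lin_closed_BB that by (auto simp: lin_closed_def)
    show "\<one>\<^bsub>add_monoid (A k)\<^esub> \<in> BB k" using lin_closed_BB by (auto simp: lin_closed_def)
    show "inv\<^bsub>add_monoid (A k)\<^esub> x \<in> BB k" if "x \<in> BB k" for x
      using lin_closed_minus[OF lin_closed_BB that] by (simp add: a_inv_def)
  qed
qed simp

lemma cls_mem:
  assumes "a \<in> carrier (A k)"
  shows "x \<in> cls k a \<longleftrightarrow> x \<in> carrier (A k) \<and> x \<ominus>\<^bsub>A k\<^esub> a \<in> BB k"
proof -
  interpret abelian_subgroup "BB k" "A k" by (rule abelian_subgroup_BB)
  show ?thesis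
    unfolding coh_class_def a_minus_def
    using a_rcos_module_imp[OF assms, of x] a_rcos_module_rev[OF assms, of x] a_elemrcos_carrier[OF assms, of x]
    by blast
qed

lemma cls_self: "a \<in> carrier (A k) \<Longrightarrow> a \<in> cls k a"
  unfolding coh_class_def using abelian_subgroup.a_rcos_self[OF abelian_subgroup_BB] by blast

lemma cls_eq:
  assumes "a \<in> carrier (A k)" "b \<in> carrier (A k)"
  shows "cls k a = cls k b \<longleftrightarrow> a \<ominus>\<^bsub>A k\<^esub> b \<in> BB k"
proof -
  interpret abelian_subgroup "BB k" "A k" by (rule abelian_subgroup_BB)
  show ?thesis
  proof
    assume "cls k a = cls k b"
    then show "a \<ominus>\<^bsub>A k\<^esub> b \<in> BB k" using cls_self[OF assms(1)] cls_mem[OF assms(2), of a] by simp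
  next
    assume "a \<ominus>\<^bsub>A k\<^esub> b \<in> BB k"
    then have "a \<in> BB k +>\<^bsub>A k\<^esub> b" using cls_mem[OF assms(2), of a] assms by (simp add: coh_class_def)
    then show "cls k a = cls k b"
      unfolding coh_class_def by (rule a_repr_independence[symmetric, OF _ assms(2) additive_subgroup.a_subgroup[OF additive_subgroup_axioms]])
  qed
qed

text \<open>The index k - 2 is the shifted degree of a cochain of degree k - 1. Together with its
  converse \<open>cls_eqD\<close> this exchanges equalities of classes for equations in one abelian
  group.\<close>

lemma cls_eqI:
  assumes "a \<in> carrier (A k)" "b \<in> carrier (A k)" "c \<in> carrier (A (k - 1))"
    "emb (A k) a = emb (A k) b + b1 (k - 2) (emb (A (k - 1)) c)"
  shows "cls k a = cls k b"
proof -
  interpret module R "A k" by simp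
  have "emb (A k) (a \<ominus>\<^bsub>A k\<^esub> b) = emb (A k) (\<delta> [(k - 1, c)])"
    using assms b1_emb[OF assms(3)] by (simp add: a_minus_def emb_add emb_minus)
  then have "a \<ominus>\<^bsub>A k\<^esub> b = \<delta> [(k - 1, c)]"
    using assms d_in[OF assms(3)] by (simp add: emb_inj)
  then show ?thesis using assms by (auto simp: cls_eq BB_iff)
qed

lemma cls_eqD:
  assumes "a \<in> carrier (A k)" "b \<in> carrier (A k)" "cls k a = cls k b"
  obtains c where "c \<in> carrier (A (k - 1))" "emb (A k) a = emb (A k) b + b1 (k - 2) (emb (A (k - 1)) c)"
proof -
  interpret module R "A k" by simp
  obtain c where c: "c \<in> carrier (A (k - 1))" "a \<ominus>\<^bsub>A k\<^esub> b = \<delta> [(k - 1, c)]"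
    using assms by (auto simp: cls_eq BB_iff)
  then have "emb (A k) (a \<ominus>\<^bsub>A k\<^esub> b) = b1 (k - 2) (emb (A (k - 1)) c)"
    using b1_emb[OF c(1)] by simp
  then have "emb (A k) a = emb (A k) b + b1 (k - 2) (emb (A (k - 1)) c)"
    using assms by (simp add: a_minus_def emb_add emb_minus diff_eq_eq add.commute)
  with c(1) that show ?thesis by blast
qed

lemma cls_add:
  assumes "a \<in> carrier (A k)" "b \<in> carrier (A k)"
  shows "cls k a \<oplus>\<^bsub>HH k\<^esub> cls k b = cls k (a \<oplus>\<^bsub>A k\<^esub> b)"
  unfolding cohomology_def coh_class_def
  using abelian_subgroup.a_rcos_sum[OF abelian_subgroup_BB assms] by simp

lemma cls_smult:
  assumes "c \<in> carrier R" "a \<in> carrier (A k)"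
  shows "c \<odot>\<^bsub>HH k\<^esub> cls k a = cls k (c \<odot>\<^bsub>A k\<^esub> a)"
proof -
  interpret module R "A k" by simp
  have "c \<odot>\<^bsub>HH k\<^esub> cls k a = (\<Union>x\<in>cls k a. cls k (c \<odot>\<^bsub>A k\<^esub> x))"
    by (simp add: cohomology_def)
  also have "\<dots> = cls k (c \<odot>\<^bsub>A k\<^esub> a)"
  proof (rule UN_eq_const[OF cls_self[OF assms(2)]])
    fix x assume "x \<in> cls k a"
    then have x: "x \<in> carrier (A k)" "x \<ominus>\<^bsub>A k\<^esub> a \<in> BB k" using assms by (auto simp: cls_mem)
    have "c \<odot>\<^bsub>A k\<^esub> (x \<ominus>\<^bsub>A k\<^esub> a) = c \<odot>\<^bsub>A k\<^esub> x \<ominus>\<^bsub>A k\<^esub> c \<odot>\<^bsub>A k\<^esub> a"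
      using assms x by (simp add: a_minus_def smult_r_distr smult_r_minus)
    moreover have "c \<odot>\<^bsub>A k\<^esub> (x \<ominus>\<^bsub>A k\<^esub> a) \<in> BB k"
      using lin_closed_BB assms x by (auto simp: lin_closed_def)
    ultimately show "cls k (c \<odot>\<^bsub>A k\<^esub> x) = cls k (c \<odot>\<^bsub>A k\<^esub> a)" using assms x by (simp add: cls_eq)
  qed
  finally show ?thesis .
qed

lemma HH_carrier: "carrier (HH k) = cls k ` ZZ k"
  by (simp add: cohomology_def)

lemma cls_zero: "\<zero>\<^bsub>HH k\<^esub> = cls k \<zero>\<^bsub>A k\<^esub>"
proof -
  interpret abelian_subgroup "BB k" "A k" by (rule abelian_subgroup_BB)
  show ?thesis using a_rcos_const[OF additive_subgroup.zero_closed[OF additive_subgroup_axioms]]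
    by (simp add: cohomology_def coh_class_def)
qed

lemma ZZ_closed:
  "a \<in> ZZ k \<Longrightarrow> a \<in> carrier (A k)" "\<zero>\<^bsub>A k\<^esub> \<in> ZZ k" "a \<in> ZZ k \<Longrightarrow> b \<in> ZZ k \<Longrightarrow> a \<oplus>\<^bsub>A k\<^esub> b \<in> ZZ k"
  "c \<in> carrier R \<Longrightarrow> a \<in> ZZ k \<Longrightarrow> c \<odot>\<^bsub>A k\<^esub> a \<in> ZZ k" "a \<in> ZZ k \<Longrightarrow> \<ominus>\<^bsub>A k\<^esub> a \<in> ZZ k"
  using lin_closed_ZZ[of k] module.lin_closed_minus[OF module lin_closed_ZZ] by (auto simp: lin_closed_def)

lemma HH_cases:
  assumes "C \<in> carrier (HH k)"
  obtains a where "a \<in> ZZ k" "a \<in> carrier (A k)" "C = cls k a"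
  using assms by (auto simp: HH_carrier ZZ_closed(1))

lemma module_HH: "module R (HH k)"
proof -
  interpret module R "A k" by simp
  show ?thesis
  proof (rule moduleI)
  show "cring R" by (rule R.is_cring)
  show "abelian_group (HH k)"
  proof (rule abelian_groupI)
    fix x y z assume x: "x \<in> carrier (HH k)" and y: "y \<in> carrier (HH k)" and z: "z \<in> carrier (HH k)"
    obtain a where a: "a \<in> ZZ k" "a \<in> carrier (A k)" "x = cls k a" using x by (rule HH_cases)
    obtain b where b: "b \<in> ZZ k" "b \<in> carrier (A k)" "y = cls k b" using y by (rule HH_cases)
    obtain c where c: "c \<in> ZZ k" "c \<in> carrier (A k)" "z = cls k c" using z by (rule HH_cases)
    show "x \<oplus>\<^bsub>HH k\<^esub> y \<in> carrier (HH k)" using a b by (auto simp: cls_add HH_carrier ZZ_closed)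
    show "x \<oplus>\<^bsub>HH k\<^esub> y \<oplus>\<^bsub>HH k\<^esub> z = x \<oplus>\<^bsub>HH k\<^esub> (y \<oplus>\<^bsub>HH k\<^esub> z)" using a b c by (simp add: cls_add M.a_assoc)
    show "x \<oplus>\<^bsub>HH k\<^esub> y = y \<oplus>\<^bsub>HH k\<^esub> x" using a b by (simp add: cls_add M.a_comm)
  next
    show "\<zero>\<^bsub>HH k\<^esub> \<in> carrier (HH k)" by (auto simp: cls_zero HH_carrier ZZ_closed)
  next
    fix x assume x: "x \<in> carrier (HH k)"
    obtain a where a: "a \<in> ZZ k" "a \<in> carrier (A k)" "x = cls k a" using x by (rule HH_cases)
    show "\<zero>\<^bsub>HH k\<^esub> \<oplus>\<^bsub>HH k\<^esub> x = x" using a by (simp add: cls_add cls_zero)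
    have "cls k (\<ominus>\<^bsub>A k\<^esub> a) \<oplus>\<^bsub>HH k\<^esub> x = \<zero>\<^bsub>HH k\<^esub>" using a by (simp add: cls_add cls_zero M.l_neg)
    then show "\<exists>y\<in>carrier (HH k). y \<oplus>\<^bsub>HH k\<^esub> x = \<zero>\<^bsub>HH k\<^esub>"
      using a by (auto simp: HH_carrier ZZ_closed)
  qed
  show "\<one>\<^bsub>R\<^esub> \<odot>\<^bsub>HH k\<^esub> x = x" if x: "x \<in> carrier (HH k)" for x
  proof -
    obtain a where a: "a \<in> ZZ k" "a \<in> carrier (A k)" "x = cls k a" using x by (rule HH_cases)
    then show ?thesis by (simp add: cls_smult)
  qed
  show "c \<odot>\<^bsub>HH k\<^esub> x \<in> carrier (HH k)" if c: "c \<in> carrier R" and x: "x \<in> carrier (HH k)" for c x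
  proof -
    obtain a where a: "a \<in> ZZ k" "a \<in> carrier (A k)" "x = cls k a" using x by (rule HH_cases)
    then show ?thesis using c by (simp add: cls_smult HH_carrier ZZ_closed)
  qed
  show "(c \<oplus>\<^bsub>R\<^esub> b) \<odot>\<^bsub>HH k\<^esub> x = c \<odot>\<^bsub>HH k\<^esub> x \<oplus>\<^bsub>HH k\<^esub> b \<odot>\<^bsub>HH k\<^esub> x"
    if c: "c \<in> carrier R" "b \<in> carrier R" and x: "x \<in> carrier (HH k)" for c b x
  proof -
    obtain a where a: "a \<in> ZZ k" "a \<in> carrier (A k)" "x = cls k a" using x by (rule HH_cases)
    then show ?thesis using c by (simp add: cls_smult cls_add smult_l_distr)
  qed
  show "(c \<otimes>\<^bsub>R\<^esub> b) \<odot>\<^bsub>HH k\<^esub> x = c \<odot>\<^bsub>HH k\<^esub> (b \<odot>\<^bsub>HH k\<^esub> x)"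
    if c: "c \<in> carrier R" "b \<in> carrier R" and x: "x \<in> carrier (HH k)" for c b x
  proof -
    obtain a where a: "a \<in> ZZ k" "a \<in> carrier (A k)" "x = cls k a" using x by (rule HH_cases)
    then show ?thesis using c by (simp add: cls_smult smult_assoc1)
  qed
  show "c \<odot>\<^bsub>HH k\<^esub> (x \<oplus>\<^bsub>HH k\<^esub> y) = c \<odot>\<^bsub>HH k\<^esub> x \<oplus>\<^bsub>HH k\<^esub> c \<odot>\<^bsub>HH k\<^esub> y"
    if c: "c \<in> carrier R" and x: "x \<in> carrier (HH k)" and y: "y \<in> carrier (HH k)" for c x y
  proof -
    obtain a where a: "a \<in> ZZ k" "a \<in> carrier (A k)" "x = cls k a" using x by (rule HH_cases)
    moreover obtain b where b: "b \<in> ZZ k" "b \<in> carrier (A k)" "y = cls k b" using y by (rule HH_cases)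
    ultimately show ?thesis using c by (simp add: cls_smult cls_add smult_r_distr)
  qed
  qed
qed

lemma HH_negative:
  assumes "k < 0"
  shows "carrier (HH k) = {\<zero>\<^bsub>HH k\<^esub>}"
proof -
  have z: "carrier (A k) = {\<zero>\<^bsub>A k\<^esub>}"
    using graded_module assms unfolding graded_module_def by blast
  have "C \<in> carrier (HH k) \<longleftrightarrow> C \<in> {\<zero>\<^bsub>HH k\<^esub>}" for C
  proof
    assume "C \<in> carrier (HH k)"
    then obtain a where a: "a \<in> ZZ k" "a \<in> carrier (A k)" "C = cls k a" by (rule HH_cases)
    have "a = \<zero>\<^bsub>A k\<^esub>" using a(2) unfolding z by (rule singletonD)
    then show "C \<in> {\<zero>\<^bsub>HH k\<^esub>}" unfolding a(3) cls_zero by (simp only: singleton_iff)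
  next
    assume "C \<in> {\<zero>\<^bsub>HH k\<^esub>}"
    then show "C \<in> carrier (HH k)"
      unfolding HH_carrier cls_zero using ZZ_closed(2)[of k] by (simp only: singleton_iff imageI)
  qed
  then show ?thesis by auto
qed

lemma graded_mod_HH: "graded_mod R HH"
  by (rule graded_mod.intro) (simp add: graded_module_def module_HH HH_negative)

end

lemma module_hom_diff:
  assumes "module R M" "module R N" "f \<in> module_hom R M N" "g \<in> module_hom R M N"
  shows "(\<lambda>v. f v \<ominus>\<^bsub>N\<^esub> g v) \<in> module_hom R M N"
proof -
  interpret M: module R M by (rule assms(1))
  interpret N: module R N by (rule assms(2))
  note fg = assms(3,4)[THEN module_hom_in] assms(3,4)[THEN module_hom_add] assms(3,4)[THEN module_hom_smult]
  have "f (v \<oplus>\<^bsub>M\<^esub> w) \<ominus>\<^bsub>N\<^esub> g (v \<oplus>\<^bsub>M\<^esub> w) = (f v \<ominus>\<^bsub>N\<^esub> g v) \<oplus>\<^bsub>N\<^esub> (f w \<ominus>\<^bsub>N\<^esub> g w)"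
    if "v \<in> carrier M" "w \<in> carrier M" for v w
    using that by (simp add: fg a_minus_def N.minus_add N.M.a_ac)
  moreover have "f (c \<odot>\<^bsub>M\<^esub> v) \<ominus>\<^bsub>N\<^esub> g (c \<odot>\<^bsub>M\<^esub> v) = c \<odot>\<^bsub>N\<^esub> (f v \<ominus>\<^bsub>N\<^esub> g v)"
    if "c \<in> carrier R" "v \<in> carrier M" for c v
    using that by (simp add: fg a_minus_def N.smult_r_distr N.smult_r_minus)
  ultimately show ?thesis by (auto simp: module_hom_def fg)
qed

lemma module_hom_id: "module R M \<Longrightarrow> (\<lambda>v. v) \<in> module_hom R M M"
  by (auto simp: module_hom_def)

text \<open>A map between two components, extended to the whole group by reading off one component;
  all others are ignored.\<close>

definition lin :: "('r, 'a) module \<Rightarrow> ('r, 'b) module \<Rightarrow> ('a \<Rightarrow> 'b) \<Rightarrow> ('r, 'a) tot \<Rightarrow> ('r, 'b) tot" where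
  "lin M N g T = emb N (g (proj M T))"

lemma scal_one: "scal R \<one>\<^bsub>R\<^esub> T = T"
  by (rule tot_eqI) (auto simp: Rep_scal Rep_tot_carrier module.smult_one)

context
  fixes R :: "('r, 's) ring_scheme" and M :: "('r, 'a) module" and N :: "('r, 'b) module" and g
  assumes M: "module R M" and N: "module R N" and g: "g \<in> module_hom R M N"
begin

interpretation M: module R M by (rule M)
interpretation N: module R N by (rule N)

lemma lin_linear:
  assumes "c \<in> carrier R"
  shows "lin M N g (scal R c T + Y) = scal R c (lin M N g T) + lin M N g Y"
proof -
  have p: "proj M T \<in> carrier M" "proj M Y \<in> carrier M" by (simp_all add: M.M.abelian_group_axioms)
  have "proj M (scal R c T + Y) = c \<odot>\<^bsub>M\<^esub> proj M T \<oplus>\<^bsub>M\<^esub> proj M Y"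
    using assms by (simp add: proj_ops proj_scal M M.M.abelian_group_axioms)
  then have "lin M N g (scal R c T + Y) = emb N (c \<odot>\<^bsub>N\<^esub> g (proj M T) \<oplus>\<^bsub>N\<^esub> g (proj M Y))"
    using p assms by (simp add: lin_def module_hom_add[OF g] module_hom_smult[OF g])
  also have "\<dots> = scal R c (emb N (g (proj M T))) + emb N (g (proj M Y))"
    using p assms module_hom_in[OF g]
    by (simp add: emb_add emb_scal[where R = R] N N.M.abelian_group_axioms)
  finally show ?thesis by (simp add: lin_def)
qed

lemma lin_additive: "additive (lin M N g)"
  using lin_linear[OF M.one_closed] by (intro additive.intro) (simp add: scal_one)

lemma lin_emb: "a \<in> carrier M \<Longrightarrow> lin M N g (emb M a) = emb N (g a)"
  by (simp add: lin_def M.M.abelian_group_axioms)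

lemma lin_emb_proj: "lin M N g (emb M (proj M T)) = lin M N g T"
  by (simp add: lin_def M.M.abelian_group_axioms)

end

section \<open>Section, projection and homotopy over a field\<close>

locale dg_algebra_field = dg_algebra R A \<delta>
  for R :: "('r, 's) ring_scheme" and A :: "('r, 'a) graded" and \<delta> :: "(int \<times> 'a) list \<Rightarrow> 'a" +
  assumes field: "field R"
begin

text \<open>Choosing a projection onto the cocycles is choosing a complement. Together with
  \<open>boundary_proj\<close> it splits a component into boundaries, representatives of classes and
  a complement of the cocycles.\<close>

definition cocycle_proj :: "int \<Rightarrow> 'a \<Rightarrow> 'a" where
  "cocycle_proj k = (SOME q. q \<in> module_hom R (A k) (A k) \<and> (\<forall>v\<in>carrier (A k). q v \<in> ZZ k) \<and> (\<forall>v\<in>ZZ k. q v = v))"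

definition boundary_proj :: "int \<Rightarrow> 'a \<Rightarrow> 'a" where
  "boundary_proj k = (SOME q. q \<in> module_hom R (A k) (A k) \<and> (\<forall>v\<in>carrier (A k). q v \<in> BB k) \<and> (\<forall>v\<in>BB k. q v = v))"

lemma cocycle_proj: "cocycle_proj k \<in> module_hom R (A k) (A k)" "v \<in> carrier (A k) \<Longrightarrow> cocycle_proj k v \<in> ZZ k" "v \<in> ZZ k \<Longrightarrow> cocycle_proj k v = v"
proof -
  have "\<exists>q. q \<in> module_hom R (A k) (A k) \<and> (\<forall>v\<in>carrier (A k). q v \<in> ZZ k) \<and> (\<forall>v\<in>ZZ k. q v = v)"
    using projection_exists[OF module field lin_closed_ZZ] by metis
  from someI_ex[OF this] show "cocycle_proj k \<in> module_hom R (A k) (A k)"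
    "v \<in> carrier (A k) \<Longrightarrow> cocycle_proj k v \<in> ZZ k" "v \<in> ZZ k \<Longrightarrow> cocycle_proj k v = v"
    unfolding cocycle_proj_def[symmetric] by blast+
qed

lemma boundary_proj: "boundary_proj k \<in> module_hom R (A k) (A k)" "v \<in> carrier (A k) \<Longrightarrow> boundary_proj k v \<in> BB k" "v \<in> BB k \<Longrightarrow> boundary_proj k v = v"
proof -
  have "\<exists>q. q \<in> module_hom R (A k) (A k) \<and> (\<forall>v\<in>carrier (A k). q v \<in> BB k) \<and> (\<forall>v\<in>BB k. q v = v)"
    using projection_exists[OF module field lin_closed_BB] by metis
  from someI_ex[OF this] show "boundary_proj k \<in> module_hom R (A k) (A k)"
    "v \<in> carrier (A k) \<Longrightarrow> boundary_proj k v \<in> BB k" "v \<in> BB k \<Longrightarrow> boundary_proj k v = v"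
    unfolding boundary_proj_def[symmetric] by blast+
qed

lemma boundary_proj_diff: "(\<lambda>v. v \<ominus>\<^bsub>A k\<^esub> boundary_proj k v) \<in> module_hom R (A k) (A k)"
  by (intro module_hom_diff module_hom_id module boundary_proj)

lemma cocycle_proj_diff: "(\<lambda>v. v \<ominus>\<^bsub>A k\<^esub> cocycle_proj k v) \<in> module_hom R (A k) (A k)"
  by (intro module_hom_diff module_hom_id module cocycle_proj)

text \<open>If r is the projection onto boundaries, z - rz does not change when a boundary is added
  to z, since r fixes boundaries. It is thus a function of the class, and a linear section of the
  class map.\<close>

definition cocycle_rep :: "int \<Rightarrow> 'a set \<Rightarrow> 'a" where
  "cocycle_rep k C = (let z = SOME z. z \<in> ZZ k \<and> C = cls k z in z \<ominus>\<^bsub>A k\<^esub> boundary_proj k z)"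

lemma cocycle_rep_cls:
  assumes z: "z \<in> ZZ k"
  shows "cocycle_rep k (cls k z) = z \<ominus>\<^bsub>A k\<^esub> boundary_proj k z"
proof -
  interpret module R "A k" by simp
  define z' where "z' = (SOME z'. z' \<in> ZZ k \<and> cls k z = cls k z')"
  have z': "z' \<in> ZZ k" "cls k z = cls k z'"
    using someI[of "\<lambda>z'. z' \<in> ZZ k \<and> cls k z = cls k z'" z] z unfolding z'_def by auto
  have car: "z \<in> carrier (A k)" "z' \<in> carrier (A k)" using z z' ZZ_closed(1) by auto
  have c: "boundary_proj k z \<in> carrier (A k)" "boundary_proj k z' \<in> carrier (A k)" using boundary_proj(2) BB_carrier car by auto
  have "z \<ominus>\<^bsub>A k\<^esub> z' \<in> BB k" using z'(2) car by (simp add: cls_eq)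
  then have "boundary_proj k (z \<ominus>\<^bsub>A k\<^esub> z') = z \<ominus>\<^bsub>A k\<^esub> z'" by (rule boundary_proj)
  then have "emb (A k) (boundary_proj k z \<oplus>\<^bsub>A k\<^esub> (\<ominus>\<^bsub>A k\<^esub> boundary_proj k z')) = emb (A k) (z \<oplus>\<^bsub>A k\<^esub> (\<ominus>\<^bsub>A k\<^esub> z'))"
    using car by (simp add: a_minus_def module_hom_add[OF boundary_proj(1)] module_hom_minus[OF module module boundary_proj(1)])
  then have "emb (A k) (z' \<oplus>\<^bsub>A k\<^esub> (\<ominus>\<^bsub>A k\<^esub> boundary_proj k z')) = emb (A k) (z \<oplus>\<^bsub>A k\<^esub> (\<ominus>\<^bsub>A k\<^esub> boundary_proj k z))"
    using car c by (simp add: emb_add emb_minus algebra_simps)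
  then have "z' \<ominus>\<^bsub>A k\<^esub> boundary_proj k z' = z \<ominus>\<^bsub>A k\<^esub> boundary_proj k z"
    using car c by (simp add: a_minus_def emb_inj)
  then show ?thesis by (simp add: cocycle_rep_def z'_def Let_def)
qed

lemma cocycle_rep_ZZ:
  assumes "C \<in> carrier (HH k)"
  shows "cocycle_rep k C \<in> ZZ k" "cls k (cocycle_rep k C) = C"
proof -
  interpret module R "A k" by simp
  obtain z where z: "z \<in> ZZ k" "z \<in> carrier (A k)" "C = cls k z" using assms by (rule HH_cases)
  have r: "boundary_proj k z \<in> BB k" "boundary_proj k z \<in> carrier (A k)" using boundary_proj(2)[OF z(2)] BB_carrier by auto
  show i: "cocycle_rep k C \<in> ZZ k"
    unfolding z(3) cocycle_rep_cls[OF z(1)] a_minus_def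
    using ZZ_closed(3)[OF z(1) ZZ_closed(5)[OF BB_ZZ[OF r(1)]]] .
  have "emb (A k) (z \<ominus>\<^bsub>A k\<^esub> boundary_proj k z \<ominus>\<^bsub>A k\<^esub> z) = emb (A k) (\<ominus>\<^bsub>A k\<^esub> boundary_proj k z)"
    using z r by (simp add: a_minus_def emb_add emb_minus)
  then have "z \<ominus>\<^bsub>A k\<^esub> boundary_proj k z \<ominus>\<^bsub>A k\<^esub> z = \<ominus>\<^bsub>A k\<^esub> boundary_proj k z" using z r by (simp add: emb_inj)
  moreover have "\<ominus>\<^bsub>A k\<^esub> boundary_proj k z \<in> BB k" using lin_closed_minus[OF lin_closed_BB r(1)] .
  ultimately have "cls k (z \<ominus>\<^bsub>A k\<^esub> boundary_proj k z) = cls k z" using z r by (simp add: cls_eq)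
  then show "cls k (cocycle_rep k C) = C" unfolding z(3) cocycle_rep_cls[OF z(1)] .
qed

lemma cocycle_rep_linear: "cocycle_rep k \<in> module_hom R (HH k) (A k)"
proof -
  have "cocycle_rep k C \<in> carrier (A k)" if "C \<in> carrier (HH k)" for C
    by (rule ZZ_closed(1)[OF cocycle_rep_ZZ(1)[OF that]])
  moreover have "cocycle_rep k (C \<oplus>\<^bsub>HH k\<^esub> D) = cocycle_rep k C \<oplus>\<^bsub>A k\<^esub> cocycle_rep k D"
    if C: "C \<in> carrier (HH k)" and D: "D \<in> carrier (HH k)" for C D
  proof -
    obtain a where a: "a \<in> ZZ k" "a \<in> carrier (A k)" "C = cls k a" using C by (rule HH_cases)
    obtain b where b: "b \<in> ZZ k" "b \<in> carrier (A k)" "D = cls k b" using D by (rule HH_cases)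
    show ?thesis
      unfolding a(3) b(3) cls_add[OF a(2) b(2)] cocycle_rep_cls[OF a(1)] cocycle_rep_cls[OF b(1)]
        cocycle_rep_cls[OF ZZ_closed(3)[OF a(1) b(1)]]
      by (rule module_hom_add[OF boundary_proj_diff a(2) b(2)])
  qed
  moreover have "cocycle_rep k (c \<odot>\<^bsub>HH k\<^esub> C) = c \<odot>\<^bsub>A k\<^esub> cocycle_rep k C"
    if c: "c \<in> carrier R" and C: "C \<in> carrier (HH k)" for c C
  proof -
    obtain a where a: "a \<in> ZZ k" "a \<in> carrier (A k)" "C = cls k a" using C by (rule HH_cases)
    show ?thesis
      unfolding a(3) cls_smult[OF c a(2)] cocycle_rep_cls[OF a(1)] cocycle_rep_cls[OF ZZ_closed(4)[OF c a(1)]]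
      by (rule module_hom_smult[OF boundary_proj_diff c a(2)])
  qed
  ultimately show ?thesis by (auto simp: module_hom_def)
qed

text \<open>The class map makes sense on cocycles; projecting onto them first extends it linearly to
  all elements.\<close>

definition class_proj :: "int \<Rightarrow> 'a \<Rightarrow> 'a set" where
  "class_proj k v = cls k (cocycle_proj k v)"

lemma class_proj_linear: "class_proj k \<in> module_hom R (A k) (HH k)"
proof -
  have q: "cocycle_proj k v \<in> ZZ k" "cocycle_proj k v \<in> carrier (A k)" if "v \<in> carrier (A k)" for v
    using cocycle_proj(2)[OF that] ZZ_closed(1) by auto
  show ?thesis
    unfolding module_hom_def class_proj_def
    using q by (auto simp: HH_carrier cls_add cls_smult module_hom_add[OF cocycle_proj(1)] module_hom_smult[OF cocycle_proj(1)])
qed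

text \<open>A linear inverse of the differential on boundaries. With q the projection onto cocycles,
  a - qa is the same for all \<open>a\<close> with a given differential, because q fixes
  cocycles.\<close>

definition primitive :: "int \<Rightarrow> 'a \<Rightarrow> 'a" where
  "primitive k b = (let a = SOME a. a \<in> carrier (A k) \<and> b = \<delta> [(k, a)] in a \<ominus>\<^bsub>A k\<^esub> cocycle_proj k a)"

lemma primitive_d:
  assumes a: "a \<in> carrier (A k)"
  shows "primitive k (\<delta> [(k, a)]) = a \<ominus>\<^bsub>A k\<^esub> cocycle_proj k a"
proof -
  interpret module R "A k" by simp
  interpret N: module R "A (k + 1)" by simp
  define a' where "a' = (SOME a'. a' \<in> carrier (A k) \<and> \<delta> [(k, a)] = \<delta> [(k, a')])"
  have a': "a' \<in> carrier (A k)" "\<delta> [(k, a)] = \<delta> [(k, a')]"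
    using someI[of "\<lambda>a'. a' \<in> carrier (A k) \<and> \<delta> [(k, a)] = \<delta> [(k, a')]" a] a unfolding a'_def by auto
  have c: "cocycle_proj k a \<in> carrier (A k)" "cocycle_proj k a' \<in> carrier (A k)" using cocycle_proj(2) ZZ_closed(1) a a'(1) by auto
  have "a \<ominus>\<^bsub>A k\<^esub> a' \<in> ZZ k"
    using a a' d_in[OF a'(1)] by (simp add: ZZ_iff a_minus_def d_add d_minus N.M.r_neg)
  then have "cocycle_proj k (a \<ominus>\<^bsub>A k\<^esub> a') = a \<ominus>\<^bsub>A k\<^esub> a'" by (rule cocycle_proj)
  then have "emb (A k) (cocycle_proj k a \<oplus>\<^bsub>A k\<^esub> (\<ominus>\<^bsub>A k\<^esub> cocycle_proj k a')) = emb (A k) (a \<oplus>\<^bsub>A k\<^esub> (\<ominus>\<^bsub>A k\<^esub> a'))"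
    using a a' by (simp add: a_minus_def module_hom_add[OF cocycle_proj(1)] module_hom_minus[OF module module cocycle_proj(1)])
  then have "emb (A k) (a' \<oplus>\<^bsub>A k\<^esub> (\<ominus>\<^bsub>A k\<^esub> cocycle_proj k a')) = emb (A k) (a \<oplus>\<^bsub>A k\<^esub> (\<ominus>\<^bsub>A k\<^esub> cocycle_proj k a))"
    using a a' c by (simp add: emb_add emb_minus algebra_simps)
  then have "a' \<ominus>\<^bsub>A k\<^esub> cocycle_proj k a' = a \<ominus>\<^bsub>A k\<^esub> cocycle_proj k a"
    using a a' c by (simp add: a_minus_def emb_inj)
  then show ?thesis by (simp add: primitive_def a'_def Let_def)
qed

lemma BB_cases:
  assumes "b \<in> BB (k + 1)"
  obtains a where "a \<in> carrier (A k)" "b = \<delta> [(k, a)]"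
  using assms by (auto simp: BB_iff)

lemma primitive_d_inverse: "b \<in> BB (k + 1) \<Longrightarrow> primitive k b \<in> carrier (A k) \<and> \<delta> [(k, primitive k b)] = b"
proof -
  assume "b \<in> BB (k + 1)"
  then obtain a where a: "a \<in> carrier (A k)" "b = \<delta> [(k, a)]" by (rule BB_cases)
  interpret module R "A k" by simp
  interpret N: module R "A (k + 1)" by simp
  have "cocycle_proj k a \<in> carrier (A k)" "\<delta> [(k, cocycle_proj k a)] = \<zero>\<^bsub>A (k + 1)\<^esub>" using cocycle_proj(2)[OF a(1)] by (auto simp: ZZ_iff)
  then show ?thesis using a d_in[OF a(1)] by (simp add: primitive_d a_minus_def d_add d_minus)
qed

lemma primitive_add:
  assumes "b \<in> BB (k + 1)" "b' \<in> BB (k + 1)"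
  shows "primitive k (b \<oplus>\<^bsub>A (k + 1)\<^esub> b') = primitive k b \<oplus>\<^bsub>A k\<^esub> primitive k b'"
proof -
  interpret module R "A k" by simp
  obtain a where a: "a \<in> carrier (A k)" "b = \<delta> [(k, a)]" using assms(1) by (rule BB_cases)
  obtain a' where a': "a' \<in> carrier (A k)" "b' = \<delta> [(k, a')]" using assms(2) by (rule BB_cases)
  show ?thesis
    unfolding a(2) a'(2) d_add[OF a(1) a'(1), symmetric] primitive_d[OF a(1)] primitive_d[OF a'(1)]
      primitive_d[OF M.a_closed[OF a(1) a'(1)]]
    by (rule module_hom_add[OF cocycle_proj_diff a(1) a'(1)])
qed

lemma primitive_smult:
  assumes "c \<in> carrier R" "b \<in> BB (k + 1)"
  shows "primitive k (c \<odot>\<^bsub>A (k + 1)\<^esub> b) = c \<odot>\<^bsub>A k\<^esub> primitive k b"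
proof -
  interpret module R "A k" by simp
  obtain a where a: "a \<in> carrier (A k)" "b = \<delta> [(k, a)]" using assms(2) by (rule BB_cases)
  show ?thesis
    unfolding a(2) d_smult[OF assms(1) a(1), symmetric] primitive_d[OF a(1)]
      primitive_d[OF smult_closed[OF assms(1) a(1)]]
    by (rule module_hom_smult[OF cocycle_proj_diff assms(1) a(1)])
qed

definition homotopy_op :: "int \<Rightarrow> 'a \<Rightarrow> 'a" where
  "homotopy_op k v = \<ominus>\<^bsub>A k\<^esub> primitive k (boundary_proj (k + 1) (cocycle_proj (k + 1) v))"

lemma homotopy_op_linear: "homotopy_op k \<in> module_hom R (A (k + 1)) (A k)"
proof -
  interpret module R "A k" by simp
  interpret N: module R "A (k + 1)" by simp
  have q: "cocycle_proj (k + 1) v \<in> carrier (A (k + 1))" if "v \<in> carrier (A (k + 1))" for v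
    using cocycle_proj(2)[OF that] ZZ_closed(1) by auto
  have r: "boundary_proj (k + 1) (cocycle_proj (k + 1) v) \<in> BB (k + 1)" if "v \<in> carrier (A (k + 1))" for v
    using boundary_proj(2)[OF q[OF that]] .
  have t: "primitive k (boundary_proj (k + 1) (cocycle_proj (k + 1) v)) \<in> carrier (A k)" if "v \<in> carrier (A (k + 1))" for v
    using primitive_d_inverse[OF r[OF that]] by blast
  have "homotopy_op k (v \<oplus>\<^bsub>A (k + 1)\<^esub> w) = homotopy_op k v \<oplus>\<^bsub>A k\<^esub> homotopy_op k w"
    if "v \<in> carrier (A (k + 1))" "w \<in> carrier (A (k + 1))" for v w
    using that t by (simp add: homotopy_op_def module_hom_add[OF cocycle_proj(1)] module_hom_add[OF boundary_proj(1)] q primitive_add r minus_add)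
  moreover have "homotopy_op k (c \<odot>\<^bsub>A (k + 1)\<^esub> v) = c \<odot>\<^bsub>A k\<^esub> homotopy_op k v"
    if "c \<in> carrier R" "v \<in> carrier (A (k + 1))" for c v
    using that t by (simp add: homotopy_op_def module_hom_smult[OF cocycle_proj(1)] module_hom_smult[OF boundary_proj(1)] q primitive_smult r smult_r_minus)
  ultimately show ?thesis using t by (auto simp: module_hom_def homotopy_op_def)
qed

text \<open>Write q and r for the projections onto cocycles and boundaries. Then dhv = - rqv, and
  hdv = - (v - qv) because q and r fix the boundary dv; the representative of the class of qv is qv
  - rqv. The minus sign in \<open>homotopy_op\<close> is dictated by the convention dh + hd = ip -
  1.\<close>

lemma homotopy_op_eq:
  assumes v: "v \<in> carrier (A (k + 1))"
  shows "emb (A (k + 1)) (\<delta> [(k, homotopy_op k v)]) + emb (A (k + 1)) (homotopy_op (k + 1) (\<delta> [(k + 1, v)])) =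
    emb (A (k + 1)) (cocycle_rep (k + 1) (class_proj (k + 1) v)) - emb (A (k + 1)) v"
proof -
  interpret module R "A k" by simp
  interpret N: module R "A (k + 1)" by simp
  interpret P: module R "A (k + 1 + 1)" by simp
  let ?q = "cocycle_proj (k + 1) v" let ?r = "boundary_proj (k + 1) ?q"
  have q: "?q \<in> ZZ (k + 1)" "?q \<in> carrier (A (k + 1))" using cocycle_proj(2)[OF v] ZZ_closed(1) by auto
  have r: "?r \<in> BB (k + 1)" "?r \<in> carrier (A (k + 1))" using boundary_proj(2)[OF q(2)] BB_carrier by auto
  have t: "primitive k ?r \<in> carrier (A k)" "\<delta> [(k, primitive k ?r)] = ?r" using primitive_d_inverse[OF r(1)] by auto
  have 1: "\<delta> [(k, homotopy_op k v)] = \<ominus>\<^bsub>A (k + 1)\<^esub> ?r" using t by (simp add: homotopy_op_def d_minus)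
  have d: "\<delta> [(k + 1, v)] \<in> BB (k + 1 + 1)" "\<delta> [(k + 1, v)] \<in> carrier (A (k + 1 + 1))"
    using d_BB[OF v] d_in[OF v] by auto
  have "homotopy_op (k + 1) (\<delta> [(k + 1, v)]) = \<ominus>\<^bsub>A (k + 1)\<^esub> (v \<ominus>\<^bsub>A (k + 1)\<^esub> ?q)"
    unfolding homotopy_op_def cocycle_proj(3)[OF BB_ZZ[OF d(1)]] boundary_proj(3)[OF d(1)] primitive_d[OF v] ..
  moreover have "cocycle_rep (k + 1) (class_proj (k + 1) v) = ?q \<ominus>\<^bsub>A (k + 1)\<^esub> ?r"
    unfolding class_proj_def by (rule cocycle_rep_cls[OF q(1)])
  ultimately show ?thesis using 1 v q r by (simp add: a_minus_def emb_add emb_minus)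
qed

lemma class_proj_d: "v \<in> carrier (A k) \<Longrightarrow> class_proj (k + 1) (\<delta> [(k, v)]) = \<zero>\<^bsub>HH (k + 1)\<^esub>"
proof -
  assume v: "v \<in> carrier (A k)"
  interpret N: module R "A (k + 1)" by simp
  have "cls (k + 1) (\<delta> [(k, v)]) = cls (k + 1) \<zero>\<^bsub>A (k + 1)\<^esub>"
  proof -
    have "\<delta> [(k, v)] \<oplus>\<^bsub>A (k + 1)\<^esub> (\<ominus>\<^bsub>A (k + 1)\<^esub> \<zero>\<^bsub>A (k + 1)\<^esub>) \<in> BB (k + 1)"
      using lin_closed_BB[of "k + 1"] N.lin_closed_minus[OF lin_closed_BB] d_BB[OF v] by (simp add: lin_closed_def)
    then show ?thesis using d_in[OF v] by (simp add: cls_eq a_minus_def)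
  qed
  then show ?thesis unfolding class_proj_def cocycle_proj(3)[OF BB_ZZ[OF d_BB[OF v]]] cls_zero .
qed

end

section \<open>Minimal models\<close>

text \<open>An insertion never evaluates its operations on the empty list, where nothing is claimed
  about \<open>lift\<close> applied to \<open>descend\<close>.\<close>

lemma insertion_cong:
  assumes "\<And>ys. ys \<noteq> [] \<Longrightarrow> \<Phi> ys = \<Psi> ys" "\<And>ys. ys \<noteq> [] \<Longrightarrow> M ys = N ys"
  shows "insertion \<Phi> M xs = insertion \<Psi> N xs"
  unfolding insertion_def using assms by (intro sum.cong refl) (auto simp: splits3_def)

lemma (in shifted_dga) quad_cong:
  assumes "\<And>ys. ys \<noteq> [] \<Longrightarrow> F ys = G ys"
  shows "quad F xs = quad G xs"
  unfolding quad_def using assms by (intro sum.cong refl) (auto simp: splits2_def)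

text \<open>Arguments enter only through \<open>i\<close>, so whatever \<open>i\<close> ignores the
  transferred morphism ignores too. With \<open>c\<close> the projection to a component this gives
  the hypothesis \<open>factor\<close> of \<open>descend_graded_map\<close>.\<close>

lemma (in contraction) transfer_mor_cong:
  assumes c: "\<And>s T. i s (c s T) = i s T"
  shows "transfer_mor (map (\<lambda>(s, T). (s, c s T)) xs) = transfer_mor xs"
proof (induction xs rule: length_induct)
  case (1 xs)
  let ?m = "map (\<lambda>(s, T). (s, c s T))"
  have t: "tdeg (?m ys) = tdeg ys" for ys by (induction ys) auto
  have "unary (?m xs) = unary xs"
    using c by (auto simp: unary_def split: list.split)
  moreover have "quad transfer_mor (?m xs) = quad transfer_mor xs"
    unfolding quad_def sum_splits2_map case_prod_conv t
    using 1 by (intro sum.cong refl) (auto simp: splits2_def)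
  ultimately show ?case by (simp add: transfer_mor t)
qed

lemma (in contraction) transfer_mu_cong:
  assumes c: "\<And>s T. i s (c s T) = i s T"
  shows "transfer_mu (map (\<lambda>(s, T). (s, c s T)) xs) = transfer_mu xs"
proof -
  have t: "tdeg (map (\<lambda>(s, T). (s, c s T)) ys) = tdeg ys" for ys by (induction ys) auto
  have "quad transfer_mor (map (\<lambda>(s, T). (s, c s T)) xs) = quad transfer_mor xs"
    unfolding quad_def sum_splits2_map case_prod_conv t transfer_mor_cong[OF c] ..
  then show ?thesis by (simp add: transfer_mu_def t)
qed

text \<open>Meant as an inverse to \<open>lift\<close>; the shift sign is undone by applying it
  again.\<close>

definition descend :: "('r, 'a) graded \<Rightarrow> ('r, 'b) graded \<Rightarrow> int \<Rightarrow>
    ((int \<times> ('r, 'a) tot) list \<Rightarrow> ('r, 'b) tot) \<Rightarrow> (int \<times> 'a) list \<Rightarrow> 'b" where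
  "descend A B e \<Phi> xs =
     signed (B (out_deg e xs)) (sign_exp xs) (proj (B (out_deg e xs)) (\<Phi> (up A xs)))"

lemma signed_signed:
  "abelian_group M \<Longrightarrow> a \<in> carrier M \<Longrightarrow> signed M n (signed M n a) = a"
  by (simp add: signed_def abelian_group.minus_minus)

text \<open>Lifted operations are linear in each slot, have homogeneous values and see only the
  projections of their arguments. Conversely, these properties let an operation on the large group
  be recovered from its restriction to homogeneous lists.\<close>

lemma descend_graded_map:
  fixes R :: "('r, 's) ring_scheme" and \<Phi> :: "(int \<times> ('r, 'a) tot) list \<Rightarrow> ('r, 'b) tot"
  assumes A: "graded_mod R A" and B: "graded_mod R B"
    and linear: "\<And>us s c T Y ws. c \<in> carrier R \<Longrightarrow>
        \<Phi> (us @ (s, scal R c T + Y) # ws) = scal R c (\<Phi> (us @ (s, T) # ws)) + \<Phi> (us @ (s, Y) # ws)"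
    and homg: "\<And>xs. xs \<noteq> [] \<Longrightarrow> \<Phi> xs \<in> homg B (tdeg xs + e - 1)"
    and factor: "\<And>xs. \<Phi> (up A (down A xs)) = \<Phi> xs"
  shows "graded_map R A B e (descend A B e \<Phi>)"
    and "xs \<noteq> [] \<Longrightarrow> lift A B e (descend A B e \<Phi>) xs = \<Phi> xs"
proof -
  interpret A: graded_mod R A by (rule A)
  interpret B: graded_mod R B by (rule B)
  have R: "cring R" using A.module[of 0] by (simp add: module_def)
  then interpret R: cring R .
  have one: "\<one>\<^bsub>R\<^esub> \<in> carrier R" by simp
  let ?\<phi> = "descend A B e \<Phi>"
  have add: "\<Phi> (us @ (s, T + Y) # ws) = \<Phi> (us @ (s, T) # ws) + \<Phi> (us @ (s, Y) # ws)" for us s T Y ws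
    using linear[OF one, of us s T Y ws] by (simp add: scal_one)
  have zero: "\<Phi> (us @ (s, 0) # ws) = 0" for us s ws
    using add[of us s 0 0 ws] by simp
  have smult: "\<Phi> (us @ (s, scal R c T) # ws) = scal R c (\<Phi> (us @ (s, T) # ws))" if "c \<in> carrier R" for us s c T ws
    using linear[OF that, of us s T 0 ws] zero by simp
  have closed: "?\<phi> xs \<in> carrier (B (out_deg e xs))" for xs by (simp add: descend_def)
  have "graded_multilinear R A B e ?\<phi>"
    unfolding graded_multilinear_def
  proof (intro conjI allI impI closed)
    fix xs k a b ys assume h: "homog A (xs @ (k, a) # ys) \<and> b \<in> carrier (A k)"
    let ?x = "\<lambda>a. xs @ (k, a) # ys"
    interpret M: abelian_group "B (out_deg e (?x a))" by simp
    have o: "out_deg e (?x c) = out_deg e (?x a)" for c by (simp add: out_deg_def)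
    have s: "sign_exp (?x c) = sign_exp (?x a)" for c by (rule sign_exp_cong) simp
    have "\<Phi> (up A (?x (a \<oplus>\<^bsub>A k\<^esub> b))) = \<Phi> (up A (?x a)) + \<Phi> (up A (?x b))"
      using h by (simp add: emb_add add)
    then show "?\<phi> (?x (a \<oplus>\<^bsub>A k\<^esub> b)) = ?\<phi> (?x a) \<oplus>\<^bsub>B (out_deg e (?x a))\<^esub> ?\<phi> (?x b)"
      unfolding descend_def o[of b] o[of "a \<oplus>\<^bsub>A k\<^esub> b"] s[of b] s[of "a \<oplus>\<^bsub>A k\<^esub> b"]
      by (simp add: proj_ops signed_def M.minus_add)
  next
    fix xs k a c ys assume h: "homog A (xs @ (k, a) # ys) \<and> c \<in> carrier R"
    let ?x = "\<lambda>a. xs @ (k, a) # ys"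
    interpret M: module R "B (out_deg e (?x a))" by simp
    have o: "out_deg e (?x c) = out_deg e (?x a)" for c by (simp add: out_deg_def)
    have s: "sign_exp (?x c) = sign_exp (?x a)" for c by (rule sign_exp_cong) simp
    have "\<Phi> (up A (?x (c \<odot>\<^bsub>A k\<^esub> a))) = scal R c (\<Phi> (up A (?x a)))"
      using h by (simp add: emb_scal[where R = R] smult)
    then show "?\<phi> (?x (c \<odot>\<^bsub>A k\<^esub> a)) = c \<odot>\<^bsub>B (out_deg e (?x a))\<^esub> ?\<phi> (?x a)"
      unfolding descend_def o[of "c \<odot>\<^bsub>A k\<^esub> a"] s[of "c \<odot>\<^bsub>A k\<^esub> a"]
      using h by (simp add: proj_scal signed_def M.smult_r_minus)
  qed
  then show g: "graded_map R A B e ?\<phi>"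
    by (intro graded_map.intro A B graded_map_axioms.intro)
  interpret \<phi>: graded_map R A B e ?\<phi> by (rule g)
  assume xs: "xs \<noteq> []"
  let ?k = "e + tdeg xs"
  have o: "out_deg e (down A xs) = ?k" by (rule out_deg_down)
  have h: "emb (B ?k) (proj (B ?k) (\<Phi> xs)) = \<Phi> xs"
    using B.homg_emb_proj[OF homg[OF xs]] by (simp add: add.commute)
  have "lift A B e ?\<phi> xs = emb (B ?k) (signed (B ?k) (sign_exp (down A xs)) (?\<phi> (down A xs)))"
    unfolding lift_def shifted_sign_exp fst_conv snd_conv o ..
  also have "?\<phi> (down A xs) = signed (B ?k) (sign_exp (down A xs)) (proj (B ?k) (\<Phi> xs))"
    unfolding descend_def o factor ..
  also have "signed (B ?k) (sign_exp (down A xs)) \<dots> = proj (B ?k) (\<Phi> xs)"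
    by (rule signed_signed) simp_all
  finally show "lift A B e ?\<phi> xs = \<Phi> xs" using h by simp
qed

lemma (in graded_mod) up_down: "up A (down A xs) = map (\<lambda>(s, T). (s, emb (A (s + 1)) (proj (A (s + 1)) T))) xs"
  by (auto simp: up_def down_def)

section \<open>Minimal structures and quasi-isomorphisms from them\<close>

locale minimal_a_inf = graded_mod R H
  for R :: "('r, 's) ring_scheme" and H :: "('r, 'a) graded" +
  fixes \<mu> :: "(int \<times> 'a) list \<Rightarrow> 'a"
  assumes a_inf: "a_inf_algebra R H \<mu>" and zero_diff: "zero_differential H \<mu>"
begin

sublocale \<mu>: graded_map R H H 2 \<mu>
  by unfold_locales (use a_inf in \<open>simp add: a_inf_algebra_def\<close>)

lemma coboundaries_eq: "coboundaries H \<mu> k = {\<zero>\<^bsub>H k\<^esub>}"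
proof -
  interpret M: abelian_group "H (k - 1)" by simp
  have "\<mu> [(k - 1, a)] = \<zero>\<^bsub>H k\<^esub>" if "a \<in> carrier (H (k - 1))" for a
    using zero_diff that unfolding zero_differential_def by (metis diff_add_cancel)
  then have "coboundaries H \<mu> k = (\<lambda>a. \<zero>\<^bsub>H k\<^esub>) ` carrier (H (k - 1))"
    unfolding coboundaries_def by (intro image_cong) auto
  then show ?thesis using M.zero_closed by blast
qed

lemma cocycles_eq: "cocycles H \<mu> k = carrier (H k)"
  using zero_diff by (auto simp: cocycles_def zero_differential_def)

lemma class_eq: "y \<in> carrier (H k) \<Longrightarrow> coh_class H \<mu> k y = {y}"
proof -
  assume y: "y \<in> carrier (H k)"
  interpret M: abelian_group "H k" by simp
  show ?thesis using y by (simp add: coh_class_def coboundaries_eq a_r_coset_def')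
qed

text \<open>All coboundaries are zero, so each class is a singleton and the cohomology is
  \<open>H\<close> with its elements wrapped.\<close>

lemma carrier_cohomology: "carrier (cohomology H \<mu> k) = (\<lambda>y. {y}) ` carrier (H k)"
  unfolding cohomology_def using class_eq by (auto simp: cocycles_eq)

lemma coh_map_eq: "coh_map B \<nu> f k {y} = coh_class B \<nu> k (f [(k, y)])"
  by (simp add: coh_map_def)

end

lemma (in dg_algebra) quad_down:
  assumes "graded_map R H A 1 f"
  shows "quad (lift H A 1 f) xs = quad (lift H A 1 f) (up H (down H xs))"
proof -
  interpret f: graded_map R H A 1 f by (rule assms)
  have d: "down H (up H (down H us)) = down H us" for us by (simp add: f.dom.down_up)
  have t: "tdeg (up H (down H us)) = tdeg us" for us
    by (induction us) auto
  show ?thesis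
    unfolding quad_def f.dom.up_down sum_splits2_map
    unfolding f.dom.up_down[symmetric] case_prod_conv t f.lift_cong[OF d] ..
qed

locale minimal_model = A: dg_algebra R A \<delta> + H: minimal_a_inf R H \<mu> + f: graded_map R H A 1 f
  for R :: "('r, 's) ring_scheme" and A :: "('r, 'a) graded" and \<delta> and H :: "('r, 'h) graded" and \<mu> and f +
  assumes quasi_iso: "a_inf_quasi_iso R H \<mu> A \<delta> f"
begin

lemma coh_map_bij: "bij_betw (coh_map A \<delta> f k) ((\<lambda>y. {y}) ` carrier (H k)) (carrier (A.HH k))"
  using quasi_iso by (simp add: a_inf_quasi_iso_def H.carrier_cohomology[symmetric])

lemma f1_in: "y \<in> carrier (H k) \<Longrightarrow> f [(k, y)] \<in> carrier (A k)"
  using module_hom_in[OF f.unary_linear[of k k]] by simp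

lemma f1_zero: "f [(k, \<zero>\<^bsub>H k\<^esub>)] = \<zero>\<^bsub>A k\<^esub>"
  by (rule module_hom_zero[OF H.module A.module f.unary_linear]) simp

lemma f1_inj:
  assumes "y \<in> carrier (H k)" "f [(k, y)] \<in> A.BB k"
  shows "y = \<zero>\<^bsub>H k\<^esub>"
proof -
  interpret Hk: abelian_group "H k" by simp
  interpret Ak: module R "A k" by simp
  have "f [(k, y)] \<ominus>\<^bsub>A k\<^esub> \<zero>\<^bsub>A k\<^esub> \<in> A.BB k"
    using A.lin_closed_BB[of k] Ak.lin_closed_minus[OF A.lin_closed_BB] assms(2)
    by (simp add: lin_closed_def a_minus_def)
  then have "A.cls k (f [(k, y)]) = A.cls k (f [(k, \<zero>\<^bsub>H k\<^esub>)])"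
    using f1_in[OF assms(1)] by (simp add: A.cls_eq f1_zero)
  then have "coh_map A \<delta> f k {y} = coh_map A \<delta> f k {\<zero>\<^bsub>H k\<^esub>}" by (simp add: coh_map_def)
  then have "{y} = {\<zero>\<^bsub>H k\<^esub>}"
    using bij_betw_imp_inj_on[OF coh_map_bij[of k]] assms(1) by (auto dest: inj_onD)
  then show ?thesis by simp
qed

lemma f1_surj:
  assumes "z \<in> A.ZZ k"
  obtains y where "y \<in> carrier (H k)" "A.cls k z = A.cls k (f [(k, y)])"
proof -
  have "A.cls k z \<in> carrier (A.HH k)" using assms by (simp add: A.HH_carrier)
  then have "A.cls k z \<in> coh_map A \<delta> f k ` (\<lambda>y. {y}) ` carrier (H k)"
    using bij_betw_imp_surj_on[OF coh_map_bij[of k]] by simp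
  then show ?thesis using that by (auto simp: coh_map_def)
qed

text \<open>Injectivity and surjectivity of the map on cohomology, stated with representatives,
  become \<open>F1_inj\<close> and \<open>F1_surj\<close>; the morphism equation extends from
  homogeneous lists to all lists.\<close>

sublocale a_inf_quasi_iso_into_dga A.b1 A.b2 H.\<mu>.L f.L "homg A" "homg H"
proof unfold_locales
  show "f.L (us @ (s, T + Y) # ws) = f.L (us @ (s, T) # ws) + f.L (us @ (s, Y) # ws)" for us s T Y ws
    by (rule additive.add[OF f.additive_lift])
  show "H.\<mu>.L [u] = 0" for u
  proof -
    obtain s T where u: "u = (s, T)" by (cases u)
    have "\<mu> [(s + 1, proj (H (s + 1)) T)] = \<zero>\<^bsub>H (2 + s)\<^esub>"
      using H.zero_diff by (simp add: zero_differential_def add.commute)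
    then show ?thesis by (simp add: u H.\<mu>.lift_signed)
  qed
  show "insertion f.L H.\<mu>.L xs = A.b1 (tdeg xs) (f.L xs) + A.quad f.L xs" if "xs \<noteq> []" for xs
  proof -
    let ?y = "down H xs"
    have t: "tdeg (up H ?y) = tdeg xs" by (induction xs) auto
    have y: "?y \<noteq> []" "homog H ?y" using that by auto
    have "insertion_sum A 1 f H \<mu> ?y =
       (\<Oplus>\<^bsub>A (out_deg 2 ?y)\<^esub> yss \<in> {yss. concat yss = ?y \<and> [] \<notin> set yss}.
           snd (shifted A 2 \<delta> (map (shifted A 1 f) yss)))"
      using quasi_iso y by (simp add: a_inf_quasi_iso_def a_inf_morphism_def)
    then have "insertion f.L H.\<mu>.L (up H ?y) = A.b1 (tdeg (up H ?y)) (f.L (up H ?y)) + A.quad f.L (up H ?y)"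
      using f.emb_insertion_sum(1)[OF H.\<mu>.graded_map_axioms y(2)]
        A.emb_morphism_rhs(1)[OF f.graded_map_axioms y(2,1)] by simp
    moreover have "f.L (up H ?y) = f.L xs" by (rule f.lift_cong) (simp add: H.down_up)
    ultimately show ?thesis
      using f.insertion_down[OF H.\<mu>.graded_map_axioms, of xs] A.quad_down[OF f.graded_map_axioms, of xs] t
      by simp
  qed
  show "A.b1 s T \<in> homg A (s + 1)" for s T using A.\<delta>.lift_homg[of "[(s, T)]"] by (simp add: add.commute)
  show "A.b2 s t T Y \<in> homg A (s + t + 1)" for s t T Y using A.\<delta>.lift_homg[of "[(s, T), (t, Y)]"] by (simp add: ac_simps)
  show "f.L xs \<in> homg A (tdeg xs)" if "xs \<noteq> []" for xs using f.lift_homg[OF that] by simp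
  show "H.\<mu>.L xs \<in> homg H (tdeg xs + 1)" if "xs \<noteq> []" for xs using H.\<mu>.lift_homg[OF that] by (simp add: add.commute)
  show "V = 0" if V: "V \<in> homg H s" and T: "T \<in> homg A (s - 1)" and e: "f.L [(s, V)] = A.b1 (s - 1) T" for s V T
  proof -
    obtain v where v: "v \<in> carrier (H (s + 1))" "V = emb (H (s + 1)) v" using V by (auto simp: homg_def)
    obtain t where t: "t \<in> carrier (A s)" "T = emb (A s) t" using T by (auto simp: homg_def)
    have "f.L [(s, V)] = emb (A (s + 1)) (f [(s + 1, v)])" using f.lift_single[OF v(1), of "s + 1"] v(2) by simp
    then have "emb (A (s + 1)) (f [(s + 1, v)]) = emb (A (s + 1)) (\<delta> [(s, t)])"
      using e A.b1_emb[OF t(1)] t(2) by simp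
    then have "f [(s + 1, v)] = \<delta> [(s, t)]"
      using f1_in[OF v(1)] A.d_in[OF t(1)] by (simp add: emb_inj)
    then have "v = \<zero>\<^bsub>H (s + 1)\<^esub>" using f1_inj[OF v(1)] A.d_BB[OF t(1)] by simp
    then show ?thesis using v(2) by simp
  qed
  show "\<exists>V\<in>homg H s. \<exists>Y\<in>homg A (s - 1). T = f.L [(s, V)] + A.b1 (s - 1) Y"
    if T: "T \<in> homg A s" and e: "A.b1 s T = 0" for s T
  proof -
    obtain t where t: "t \<in> carrier (A (s + 1))" "T = emb (A (s + 1)) t" using T by (auto simp: homg_def)
    have "emb (A (s + 2)) (\<delta> [(s + 1, t)]) = 0" using A.b1_emb'[OF t(1)] e t(2) by simp
    moreover have "\<delta> [(s + 1, t)] \<in> carrier (A (s + 2))" using A.d_in[OF t(1)] by (simp add: add.assoc)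
    ultimately have "\<delta> [(s + 1, t)] = \<zero>\<^bsub>A (s + 2)\<^esub>" by (simp add: emb_eq_0)
    then have "t \<in> A.ZZ (s + 1)" using t(1) by (simp add: A.ZZ_iff add.assoc)
    then obtain y where y: "y \<in> carrier (H (s + 1))" "A.cls (s + 1) t = A.cls (s + 1) (f [(s + 1, y)])"
      by (rule f1_surj)
    obtain c where c: "c \<in> carrier (A (s + 1 - 1))"
        "emb (A (s + 1)) t = emb (A (s + 1)) (f [(s + 1, y)]) + A.b1 (s + 1 - 2) (emb (A (s + 1 - 1)) c)"
      using A.cls_eqD[OF t(1) f1_in[OF y(1)] y(2)] by blast
    have "f.L [(s, emb (H (s + 1)) y)] = emb (A (s + 1)) (f [(s + 1, y)])"
      using f.lift_single[OF y(1), of "s + 1"] by simp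
    then show ?thesis
      using c t(2) H.emb_homg[OF y(1)] A.emb_homg[of c s]
      by (intro bexI[of _ "emb (H (s + 1)) y"] bexI[of _ "emb (A s) c"]) auto
  qed
qed (rule A.homg_zero A.homg_add A.homg_minus H.homg_zero H.homg_add; assumption?)+

end

section \<open>The minimal model of a dga over a field\<close>

context dg_algebra_field
begin

lemma b1_proj: "b1 s T = emb (A (s + 1 + 1)) (\<delta> [(s + 1, proj (A (s + 1)) T)])"
proof -
  have "b1 s T = b1 s (emb (A (s + 1)) (proj (A (s + 1)) T))"
    by (rule \<delta>.lift_cong) simp
  then show ?thesis using b1_emb'[of "proj (A (s + 1)) T" s] by (simp add: add.assoc)
qed

abbreviation "iT \<equiv> \<lambda>s. lin (HH (s + 1)) (A (s + 1)) (cocycle_rep (s + 1))"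
abbreviation "pT \<equiv> \<lambda>s. lin (A (s + 1)) (HH (s + 1)) (class_proj (s + 1))"
abbreviation "hT \<equiv> \<lambda>s. lin (A (s + 1)) (A s) (homotopy_op s)"

text \<open>Shifted degree \<open>s\<close> is the component \<open>s + 1\<close>; accordingly
  \<open>hT s\<close> maps component \<open>s + 1\<close> to component \<open>s\<close>.\<close>

sublocale con: contraction b1 b2 iT pT hT
proof
  interpret HH: graded_mod R HH by (rule graded_mod_HH)
  show "iT s (T + Y) = iT s T + iT s Y" for s T Y
    by (rule additive.add[OF lin_additive[OF module_HH module cocycle_rep_linear]])
  show "pT s (T + Y) = pT s T + pT s Y" for s T Y
    by (rule additive.add[OF lin_additive[OF module module_HH class_proj_linear]])
  show "hT s (T + Y) = hT s T + hT s Y" for s T Y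
    by (rule additive.add[OF lin_additive[OF module module homotopy_op_linear]])
  show "b1 s (iT s V) = 0" for s V
  proof -
    have i: "cocycle_rep (s + 1) (proj (HH (s + 1)) V) \<in> ZZ (s + 1)" by (rule cocycle_rep_ZZ) simp
    then have "b1 s (iT s V) = emb (A (s + 1 + 1)) (\<delta> [(s + 1, cocycle_rep (s + 1) (proj (HH (s + 1)) V))])"
      unfolding lin_def using b1_emb'[OF ZZ_closed(1)[OF i]] by (simp add: add.assoc)
    also have "\<dots> = 0" using i by (simp add: ZZ_iff)
    finally show ?thesis .
  qed
  show "pT (s + 1) (b1 s T) = 0" for s T
  proof -
    have "pT (s + 1) (b1 s T) = emb (HH (s + 1 + 1)) (class_proj (s + 1 + 1) (\<delta> [(s + 1, proj (A (s + 1)) T)]))"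
      unfolding b1_proj by (rule lin_emb[OF module module_HH class_proj_linear d_in]) simp
    also have "\<dots> = 0" using class_proj_d[of "proj (A (s + 1)) T" "s + 1"] by simp
    finally show ?thesis .
  qed
  show "b1 (s + t) (hT (s + t + 1) (b2 s t T Y)) + hT (s + t + 2) (b1 (s + t + 1) (b2 s t T Y)) =
      iT (s + t + 1) (pT (s + t + 1) (b2 s t T Y)) - b2 s t T Y" for s t T Y
  proof -
    let ?k = "s + t + 1"
    \<comment> \<open>Homogeneity of the product is what makes the identity hold, since the maps
      involved read a single component.\<close>
    have "b2 s t T Y \<in> homg A ?k" using \<delta>.lift_homg[of "[(s, T), (t, Y)]"] by (simp add: ac_simps)
    then obtain v where v: "v \<in> carrier (A (?k + 1))" "b2 s t T Y = emb (A (?k + 1)) v" by (auto simp: homg_def)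
    have p: "class_proj (?k + 1) v \<in> carrier (HH (?k + 1))" by (rule module_hom_in[OF class_proj_linear v(1)])
    have h: "homotopy_op ?k v \<in> carrier (A ?k)" by (rule module_hom_in[OF homotopy_op_linear v(1)])
    have 1: "b1 (s + t) (hT ?k (emb (A (?k + 1)) v)) = emb (A (?k + 1)) (\<delta> [(?k, homotopy_op ?k v)])"
      unfolding lin_emb[OF module module homotopy_op_linear v(1)] using b1_emb[OF h] by simp
    have 2: "hT (?k + 1) (b1 ?k (emb (A (?k + 1)) v)) = emb (A (?k + 1)) (homotopy_op (?k + 1) (\<delta> [(?k + 1, v)]))"
      unfolding b1_proj using v(1) by (simp only: proj_emb abelian_group lin_emb[OF module module homotopy_op_linear d_in[OF v(1)]])
    have 3: "iT ?k (pT ?k (emb (A (?k + 1)) v)) = emb (A (?k + 1)) (cocycle_rep (?k + 1) (class_proj (?k + 1) v))"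
      by (simp only: lin_emb[OF module module_HH class_proj_linear v(1)] lin_emb[OF module_HH module cocycle_rep_linear p])
    have k: "s + t + 2 = ?k + 1" by simp
    show ?thesis unfolding v(2) k 1 2 3 by (rule homotopy_op_eq[OF v(1)])
  qed
qed

lemma transfer_scal_linear:
  assumes "c \<in> carrier R"
  shows "con.transfer_mor (us @ (s, scal R c T + Y) # ws) =
      scal R c (con.transfer_mor (us @ (s, T) # ws)) + con.transfer_mor (us @ (s, Y) # ws)"
    "con.transfer_mu (us @ (s, scal R c T + Y) # ws) =
      scal R c (con.transfer_mu (us @ (s, T) # ws)) + con.transfer_mu (us @ (s, Y) # ws)"
proof -
  have b2: "b2 s t (scal R c U + U') W = scal R c (b2 s t U W) + b2 s t U' W"
    "b2 s t W (scal R c U + U') = scal R c (b2 s t W U) + b2 s t W U'" for s t U U' W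
    using \<delta>.scal_lift[OF assms, of "[]" s U "[(t, W)]"] \<delta>.scal_lift[OF assms, of "[(s, W)]" t U "[]"]
    by (simp_all add: additive.add[OF b2_left] additive.add[OF b2_right])
  note l = lin_linear[OF module_HH module cocycle_rep_linear assms] lin_linear[OF module module_HH class_proj_linear assms]
    lin_linear[OF module module homotopy_op_linear assms] b2
  show "con.transfer_mor (us @ (s, scal R c T + Y) # ws) =
      scal R c (con.transfer_mor (us @ (s, T) # ws)) + con.transfer_mor (us @ (s, Y) # ws)"
    "con.transfer_mu (us @ (s, scal R c T + Y) # ws) =
      scal R c (con.transfer_mu (us @ (s, T) # ws)) + con.transfer_mu (us @ (s, Y) # ws)"
    by (rule con.transfer_linear[OF l additive_scal additive_scal])+
qed

lemma transfer_mor_homg: "xs \<noteq> [] \<Longrightarrow> con.transfer_mor xs \<in> homg A (tdeg xs + 1 - 1)"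
proof -
  assume "xs \<noteq> []"
  have h: "hT (tdeg xs + 1) T \<in> homg A (tdeg xs)" for T
    using module_hom_in[OF homotopy_op_linear, of "proj (A (tdeg xs + 1 + 1)) T" "tdeg xs + 1"]
    by (simp add: lin_def homg_def)
  have i: "iT s T \<in> homg A s" for s T
  proof -
    interpret HH: graded_mod R HH by (rule graded_mod_HH)
    show ?thesis
      using module_hom_in[OF cocycle_rep_linear, of "proj (HH (s + 1)) T" "s + 1"] by (simp add: lin_def homg_def)
  qed
  have "con.unary xs \<in> homg A (tdeg xs)"
    using i homg_zero by (auto simp: con.unary_def split: list.split)
  then have "con.transfer_mor xs \<in> homg A (tdeg xs)"
    by (subst con.transfer_mor) (rule homg_add[OF _ h])
  then show ?thesis by simp
qed

lemma transfer_mu_homg: "xs \<noteq> [] \<Longrightarrow> con.transfer_mu xs \<in> homg HH (tdeg xs + 2 - 1)"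
proof -
  have "pT (tdeg xs + 1) T \<in> homg HH (tdeg xs + 1)" for T
    using module_hom_in[OF class_proj_linear, of "proj (A (tdeg xs + 1 + 1)) T" "tdeg xs + 1 + 1"]
    by (simp add: lin_def homg_def)
  then show ?thesis unfolding con.transfer_mu_def by (simp add: add.commute)
qed

text \<open>The transferred operations descend to graded ones, and the transfer equations are read
  back through the injective embedding. Since f_1 is the section \<open>cocycle_rep\<close>, the
  induced map takes the singleton of a class to that class and is bijective.\<close>

theorem minimal_model_exists:
  "\<exists>\<mu> f. a_inf_algebra R HH \<mu> \<and> zero_differential HH \<mu> \<and> a_inf_quasi_iso R HH \<mu> A \<delta> f"
proof -
  interpret HH: graded_mod R HH by (rule graded_mod_HH)
  define \<mu> where "\<mu> = descend HH HH 2 con.transfer_mu"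
  define f where "f = descend HH A 1 con.transfer_mor"
  have ip: "iT s (emb (HH (s + 1)) (proj (HH (s + 1)) T)) = iT s T" for s T
    by (rule lin_emb_proj[OF module_HH module cocycle_rep_linear])
  have fac: "con.transfer_mor (up HH (down HH xs)) = con.transfer_mor xs"
    "con.transfer_mu (up HH (down HH xs)) = con.transfer_mu xs" for xs
    unfolding HH.up_down by (rule con.transfer_mor_cong[OF ip], rule con.transfer_mu_cong[OF ip])
  have \<mu>g: "graded_map R HH HH 2 \<mu>" and \<mu>L: "xs \<noteq> [] \<Longrightarrow> lift HH HH 2 \<mu> xs = con.transfer_mu xs" for xs
    unfolding \<mu>_def
    by (rule descend_graded_map[OF graded_mod_HH graded_mod_HH transfer_scal_linear(2) transfer_mu_homg fac(2)];
        assumption)+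
  have fg: "graded_map R HH A 1 f" and fL: "xs \<noteq> [] \<Longrightarrow> lift HH A 1 f xs = con.transfer_mor xs" for xs
    unfolding f_def
    by (rule descend_graded_map[OF graded_mod_HH graded_mod_axioms transfer_scal_linear(1) transfer_mor_homg fac(1)];
        assumption)+
  interpret \<mu>: graded_map R HH HH 2 \<mu> by (rule \<mu>g)
  interpret f: graded_map R HH A 1 f by (rule fg)
  have "insertion_sum HH 2 \<mu> HH \<mu> xs = \<zero>\<^bsub>HH (out_deg 3 xs)\<^esub>" if xs: "xs \<noteq> []" "homog HH xs" for xs
  proof -
    have "insertion \<mu>.L \<mu>.L (up HH xs) = insertion con.transfer_mu con.transfer_mu (up HH xs)"
      by (rule insertion_cong) (rule \<mu>L; assumption)+
    also have "\<dots> = 0" using xs by (intro con.transfer_mu_equation) simp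
    finally show ?thesis
      using \<mu>.emb_insertion_sum[OF \<mu>g xs(2)] emb_eq_0[OF HH.abelian_group] by simp
  qed
  then have a: "a_inf_algebra R HH \<mu>"
    using HH.graded_module \<mu>.multilinear by (simp add: a_inf_algebra_def)
  have z: "zero_differential HH \<mu>"
    unfolding zero_differential_def
  proof (intro allI ballI)
    fix k y assume y: "y \<in> carrier (HH k)"
    have "emb (HH (k + 1)) (\<mu> [(k, y)]) = \<mu>.L [(k - 1, emb (HH k) y)]"
      by (rule \<mu>.lift_single[OF y, symmetric]) simp
    also have "\<dots> = 0" by (simp add: \<mu>L con.transfer_mu_single)
    finally show "\<mu> [(k, y)] = \<zero>\<^bsub>HH (k + 1)\<^esub>"
      using emb_eq_0[OF HH.abelian_group] module_hom_in[OF \<mu>.unary_linear[of "k + 1" k] y] by simp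
  qed
  interpret min: minimal_a_inf R HH \<mu> by unfold_locales (use a z in auto)
  have "insertion_sum A 1 f HH \<mu> xs =
      (\<Oplus>\<^bsub>A (out_deg 2 xs)\<^esub> yss \<in> {yss. concat yss = xs \<and> [] \<notin> set yss}.
           snd (shifted A 2 \<delta> (map (shifted A 1 f) yss)))" (is "_ = ?rhs") if xs: "xs \<noteq> []" "homog HH xs" for xs
  proof -
    have "insertion f.L \<mu>.L (up HH xs) = insertion con.transfer_mor con.transfer_mu (up HH xs)"
      by (rule insertion_cong) (rule fL \<mu>L; assumption)+
    also have "\<dots> = b1 (tdeg (up HH xs)) (con.transfer_mor (up HH xs)) + quad con.transfer_mor (up HH xs)"
      using xs by (intro con.transfer_mor_equation[symmetric]) simp
    also have "\<dots> = b1 (tdeg (up HH xs)) (f.L (up HH xs)) + quad f.L (up HH xs)"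
      using xs quad_cong[of f.L con.transfer_mor, OF fL] by (simp add: fL)
    finally have "emb (A (out_deg 2 xs)) (insertion_sum A 1 f HH \<mu> xs) = emb (A (out_deg 2 xs)) ?rhs"
      using f.emb_insertion_sum(1)[OF \<mu>g xs(2)] emb_morphism_rhs(1)[OF fg xs(2,1)] by simp
    then show ?thesis
      using f.emb_insertion_sum(2)[OF \<mu>g xs(2)] emb_morphism_rhs(2)[OF fg xs(2,1)] by (simp add: emb_inj)
  qed
  then have mor: "a_inf_morphism R HH \<mu> A \<delta> f"
    using f.multilinear by (simp add: a_inf_morphism_def)
  have coh: "coh_map A \<delta> f k {C} = C" if C: "C \<in> carrier (HH k)" for k C
  proof -
    have "emb (A k) (f [(k, C)]) = f.L [(k - 1, emb (HH k) C)]"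
      by (rule f.lift_single[OF C, symmetric]) simp
    also have "\<dots> = iT (k - 1) (emb (HH k) C)" by (simp add: fL con.transfer_mor_single)
    also have "\<dots> = emb (A k) (cocycle_rep k C)" using lin_emb[OF module_HH module cocycle_rep_linear C] by simp
    finally have "f [(k, C)] = cocycle_rep k C"
      using module_hom_in[OF f.unary_linear[of k k] C] module_hom_in[OF cocycle_rep_linear C] by (simp add: emb_inj)
    then show ?thesis using cocycle_rep_ZZ(2)[OF C] by (simp add: coh_map_def)
  qed
  have "coh_map A \<delta> f k \<in> module_hom R (cohomology HH \<mu> k) (HH k)" for k
  proof -
    interpret M: module R "HH k" by simp
    have "{C} \<oplus>\<^bsub>cohomology HH \<mu> k\<^esub> {D} = {C \<oplus>\<^bsub>HH k\<^esub> D}" for C D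
      by (simp add: cohomology_def set_add_def' )
    moreover have "c \<odot>\<^bsub>cohomology HH \<mu> k\<^esub> {C} = {c \<odot>\<^bsub>HH k\<^esub> C}" if "c \<in> carrier R" "C \<in> carrier (HH k)" for c C
      using min.class_eq[OF M.smult_closed[OF that]] by (simp add: cohomology_def)
    ultimately show ?thesis
      unfolding module_hom_def min.carrier_cohomology by (auto simp: coh)
  qed
  moreover have "bij_betw (coh_map A \<delta> f k) (carrier (cohomology HH \<mu> k)) (carrier (HH k))" for k
    unfolding min.carrier_cohomology
    by (rule bij_betw_byWitness[where f' = "\<lambda>y. {y}"]) (auto simp: coh)
  ultimately have "a_inf_quasi_iso R HH \<mu> A \<delta> f" using mor by (simp add: a_inf_quasi_iso_def)
  with a z show ?thesis by blast
qed

end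

section \<open>Massey products through a minimal model\<close>

text \<open>Operations of arity three and more vanish, so only partitions into two blocks
  contribute, and each of these is given by one cut point.\<close>

lemma (in dg_algebra) massey_curv:
  assumes "p \<le> q"
  shows "massey \<delta>.L s y p q = curv s y p q"
proof -
  have "curv s y p q = (\<Sum>j\<in>{p..<q}. \<delta>.L (args s y [(p, j), (Suc j, q)]))"
    unfolding curv_def by simp
  also have "\<dots> = (\<Sum>L\<in>(\<lambda>j. [(p, j), (Suc j, q)]) ` {p..<q}. \<delta>.L (args s y L))"
    by (subst sum.reindex) (auto simp: inj_on_def)
  also have "\<dots> = massey \<delta>.L s y p q"
    unfolding massey_def
  proof (rule sum.mono_neutral_left)
    show "(\<lambda>j. [(p, j), (Suc j, q)]) ` {p..<q} \<subseteq> parts p q - {[(p, q)]}"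
      by (auto simp: parts_def)
    show "\<forall>L\<in>parts p q - {[(p, q)]} - (\<lambda>j. [(p, j), (Suc j, q)]) ` {p..<q}. \<delta>.L (args s y L) = 0"
    proof
      fix L assume L: "L \<in> parts p q - {[(p, q)]} - (\<lambda>j. [(p, j), (Suc j, q)]) ` {p..<q}"
      have "3 \<le> length L"
      proof (rule ccontr)
        assume "\<not> 3 \<le> length L"
        then consider "L = []" | u where "L = [u]" | u v where "L = [u, v]"
          by (cases L; cases "tl L"; cases "tl (tl L)") auto
        then show False
        proof cases
          case 1
          then show ?thesis using L assms by (auto simp: parts_def)
        next
          case 2
          then show ?thesis using L by (cases u) (auto simp: parts_def)
        next
          case 3
          then obtain i j k l where "L = [(i, j), (k, l)]" by (cases u; cases v) auto
          then have "L = [(p, j), (Suc j, q)]" "j \<in> {p..<q}" using L by (auto simp: parts_def)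
          then show ?thesis using L by blast
        qed
      qed
      then show "\<delta>.L (args s y L) = 0" by (intro lift_long) simp
    qed
  qed simp
  finally show ?thesis ..
qed

definition proper :: "nat \<Rightarrow> nat \<Rightarrow> nat \<Rightarrow> bool" where
  "proper n p q \<longleftrightarrow> 1 \<le> p \<and> p \<le> q \<and> q \<le> n \<and> (p, q) \<noteq> (1, n)"

context minimal_model
begin

text \<open>A defining system over the minimal model: with zero differential the condition dx = - S
  becomes S = 0. It is stated without a basis; for p = q the sum S is empty.\<close>

definition solution :: "nat \<Rightarrow> (nat \<Rightarrow> int) \<Rightarrow> (nat \<Rightarrow> 'h) \<Rightarrow> (nat \<Rightarrow> nat \<Rightarrow> 'h) \<Rightarrow> bool" where
  "solution n d x w \<longleftrightarrow> (\<forall>i\<in>{1..n}. w i i = x i) \<and>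
     (\<forall>p q. proper n p q \<longrightarrow> w p q \<in> carrier (H (massey_deg d p q)) \<and>
        massey_sum H \<mu> d w p q = \<zero>\<^bsub>H (massey_deg d p q + 1)\<^esub>)"

context
  fixes n :: nat and d :: "nat \<Rightarrow> int" and x :: "nat \<Rightarrow> 'h" and a :: "nat \<Rightarrow> 'a"
  assumes n: "3 \<le> n"
    and x: "\<And>i. i \<in> {1..n} \<Longrightarrow> x i \<in> carrier (H (d i))"
    and a: "\<And>i. i \<in> {1..n} \<Longrightarrow> a i \<in> A.ZZ (d i)"
    and ax: "\<And>i. i \<in> {1..n} \<Longrightarrow> A.cls (d i) (a i) = A.cls (d i) (f [(d i, x i)])"
begin

lemma f_emb: "y \<in> carrier (H k) \<Longrightarrow> f.L [(k - 1, emb (H k) y)] = emb (A k) (f [(k, y)])"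
  by (rule f.lift_single) auto

text \<open>The equation at the corner, whether obtained by pushing or by lifting a system, says
  that the curvature and F_1 of the Massey sum differ by a boundary; here it becomes an equality of
  classes.\<close>

lemma massey_class:
  assumes Y: "\<And>p q. proper n p q \<Longrightarrow> Y p q \<in> carrier (A (massey_deg d p q))"
    and y: "\<And>p q. proper n p q \<Longrightarrow> y p q = emb (A (massey_deg d p q)) (Y p q)"
    and w: "\<And>p q. proper n p q \<Longrightarrow> w p q \<in> carrier (H (massey_deg d p q))"
    and v: "\<And>p q. proper n p q \<Longrightarrow> v p q = emb (H (massey_deg d p q)) (w p q)"
    and z: "z \<in> homg A (shifted_deg d 1 n)"
    and eq: "A.curv (shifted_deg d) y 1 n = f.L [(shifted_deg d 1 n + 1, massey H.\<mu>.L (shifted_deg d) v 1 n)] + A.b1 (shifted_deg d 1 n) z"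
  shows "A.cls (massey_deg d 1 n + 1) (massey_sum A \<delta> d Y 1 n) =
     A.cls (massey_deg d 1 n + 1) (f [(massey_deg d 1 n + 1, massey_sum H \<mu> d w 1 n)])"
proof -
  let ?k = "massey_deg d 1 n + 1"
  have 1: "1 \<le> n" using n by simp
  have Y': "Y i j \<in> carrier (A (massey_deg d i j))" if "1 \<le> i" "i \<le> j" "j \<le> n" "(i, j) \<noteq> (1, n)" for i j
    using Y that by (simp add: proper_def)
  have w': "w i j \<in> carrier (H (massey_deg d i j))" if "1 \<le> i" "i \<le> j" "j \<le> n" "(i, j) \<noteq> (1, n)" for i j
    using w that by (simp add: proper_def)
  have ms: "massey_sum H \<mu> d w 1 n \<in> carrier (H ?k)"
    by (rule H.emb_massey_sum(2)[OF H.\<mu>.graded_map_axioms 1, of w d, OF w'])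
  have "emb (H ?k) (massey_sum H \<mu> d w 1 n) = massey H.\<mu>.L (shifted_deg d) v 1 n"
  proof (rule trans)
    show "emb (H ?k) (massey_sum H \<mu> d w 1 n) =
        massey H.\<mu>.L (shifted_deg d) (\<lambda>i j. emb (H (massey_deg d i j)) (w i j)) 1 n"
      by (rule H.emb_massey_sum(1)[OF H.\<mu>.graded_map_axioms 1, of w d, OF w'])
  qed (rule massey_cong, simp add: v proper_def)
  moreover have "emb (A ?k) (massey_sum A \<delta> d Y 1 n) = A.curv (shifted_deg d) y 1 n"
  proof (rule trans)
    show "emb (A ?k) (massey_sum A \<delta> d Y 1 n) =
        massey A.\<delta>.L (shifted_deg d) (\<lambda>i j. emb (A (massey_deg d i j)) (Y i j)) 1 n"
      by (rule A.emb_massey_sum(1)[OF A.\<delta>.graded_map_axioms 1, of Y d, OF Y'])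
  qed (unfold A.massey_curv[OF 1], rule A.curv_cong, simp add: y proper_def)
  moreover obtain z' where z': "z' \<in> carrier (A (?k - 1))" "z = emb (A (?k - 1)) z'"
    using z by (auto simp: homg_def massey_deg_shifted_deg add.commute)
  ultimately have "emb (A ?k) (massey_sum A \<delta> d Y 1 n) =
     emb (A ?k) (f [(?k, massey_sum H \<mu> d w 1 n)]) + A.b1 (?k - 2) (emb (A (?k - 1)) z')"
    using eq f_emb[OF ms] by (simp add: massey_deg_shifted_deg add.commute)
  moreover have "massey_sum A \<delta> d Y 1 n \<in> carrier (A ?k)"
    by (rule A.emb_massey_sum(2)[OF A.\<delta>.graded_map_axioms 1, of Y d, OF Y'])
  ultimately show ?thesis
    by (intro A.cls_eqI[OF _ f1_in[OF ms] z'(1)])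
qed

text \<open>The cocycles \<open>a i\<close> and f_1 of \<open>x i\<close> represent the same class,
  and \<open>g i\<close> is a cochain whose boundary is their difference. It provides the diagonal
  of the gauge transformation.\<close>

lemma diagonal:
  obtains g where "\<And>i. g i \<in> homg A (d i - 2)"
    "\<And>i. i \<in> {1..n} \<Longrightarrow>
       emb (A (d i)) (a i) = emb (A (d i)) (f [(d i, x i)]) + A.b1 (d i - 2) (g i)"
proof -
  have "\<exists>g. g \<in> homg A (d i - 2) \<and> (i \<in> {1..n} \<longrightarrow>
       emb (A (d i)) (a i) = emb (A (d i)) (f [(d i, x i)]) + A.b1 (d i - 2) g)" for i
  proof (cases "i \<in> {1..n}")
    case True
    obtain c where "c \<in> carrier (A (d i - 1))"
      "emb (A (d i)) (a i) = emb (A (d i)) (f [(d i, x i)]) + A.b1 (d i - 2) (emb (A (d i - 1)) c)"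
      using A.cls_eqD[OF A.ZZ_closed(1)[OF a[OF True]] f1_in[OF x[OF True]] ax[OF True]] by blast
    then show ?thesis
      using A.emb_homg[of c "d i - 1"] by (intro exI[of _ "emb (A (d i - 1)) c"]) (simp add: diff_diff_eq)
  next
    case False
    \<comment> \<open>Outside {1..n} only the degree of \<open>g i\<close> matters, and zero has
      every degree.\<close>
    then show ?thesis using A.homg_zero by blast
  qed
  then show ?thesis using that by metis
qed

lemma solution_to_defining_system:
  assumes w: "solution n d x w"
  obtains Y where "defining_system A \<delta> n d a Y"
    "A.cls (massey_deg d 1 n + 1) (massey_sum A \<delta> d Y 1 n) =
     A.cls (massey_deg d 1 n + 1) (f [(massey_deg d 1 n + 1, massey_sum H \<mu> d w 1 n)])"
proof -
  obtain g where g: "\<And>i. g i \<in> homg A (d i - 2)" "\<And>i. i \<in> {1..n} \<Longrightarrow>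
       emb (A (d i)) (a i) = emb (A (d i)) (f [(d i, x i)]) + A.b1 (d i - 2) (g i)"
    using diagonal by metis
  have wc: "w p q \<in> carrier (H (massey_deg d p q))"
    and wm: "massey_sum H \<mu> d w p q = \<zero>\<^bsub>H (massey_deg d p q + 1)\<^esub>" if "proper n p q" for p q
    using w that by (auto simp: solution_def)
  define v where "v p q = emb (H (massey_deg d p q)) (w p q)" for p q
  have m0: "massey H.\<mu>.L (shifted_deg d) v p q = 0" if "1 \<le> p" "p < q" "q \<le> n" "(p, q) \<noteq> (1, n)" for p q
  proof -
    have pr: "proper n p q" using that by (simp add: proper_def)
    have "emb (H (massey_deg d p q + 1)) (massey_sum H \<mu> d w p q) = massey H.\<mu>.L (shifted_deg d) v p q"
      unfolding v_def using that
      by (intro H.emb_massey_sum(1)[OF H.\<mu>.graded_map_axioms] wc) (auto simp: proper_def)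
    then show ?thesis using wm[OF pr] by simp
  qed
  have g': "g i \<in> homg A (shifted_deg d i i - 1)" for i using g(1)[of i] by simp
  have n2: "2 \<le> n" using n by simp
  obtain y z where y: "\<And>i. y i i = f.L [(shifted_deg d i i, v i i)] + A.b1 (shifted_deg d i i - 1) (g i)"
    "\<And>p q. p \<le> q \<Longrightarrow> y p q \<in> homg A (shifted_deg d p q)"
    "\<And>p q. 1 \<le> p \<Longrightarrow> p \<le> q \<Longrightarrow> q \<le> n \<Longrightarrow> (p, q) \<noteq> (1, n) \<Longrightarrow>
        A.b1 (shifted_deg d p q) (y p q) = - A.curv (shifted_deg d) y p q"
    "z \<in> homg A (shifted_deg d 1 n)"
    "A.curv (shifted_deg d) y 1 n = f.L [(shifted_deg d 1 n + 1, massey H.\<mu>.L (shifted_deg d) v 1 n)] + A.b1 (shifted_deg d 1 n) z"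
    using push_defining_system[of "shifted_deg d" n v g, OF shifted_deg_add m0 g' n2] by blast
  \<comment> \<open>On the diagonal the prescribed cocycles are taken verbatim; that
    \<open>y\<close> agrees with them is the purpose of \<open>g\<close>.\<close>
  define Y where "Y p q = (if p = q then a p else proj (A (massey_deg d p q)) (y p q))" for p q
  have Yy: "Y p q \<in> carrier (A (massey_deg d p q)) \<and> y p q = emb (A (massey_deg d p q)) (Y p q)"
    if "proper n p q" for p q
  proof (cases "p = q")
    case True
    then have p: "p \<in> {1..n}" using that by (simp add: proper_def)
    have "w p p = x p" using w p by (auto simp: solution_def)
    then have "f.L [(shifted_deg d p p, v p p)] = emb (A (d p)) (f [(d p, x p)])"
      using f_emb[OF x[OF p]] by (simp add: v_def massey_deg_shifted_deg)
    then have "y p p = emb (A (d p)) (a p)" using g(2)[OF p] by (simp add: y(1))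
    then show ?thesis using True A.ZZ_closed(1)[OF a[OF p]] by (simp add: Y_def massey_deg_shifted_deg)
  next
    case False
    then show ?thesis
      using A.homg_emb_proj[OF y(2)[of p q]] that by (simp add: Y_def massey_deg_shifted_deg proper_def)
  qed
  have "defining_system A \<delta> n d a Y"
    unfolding defining_system_def
  proof (intro conjI ballI allI impI)
    show "Y i i = a i" for i by (simp add: Y_def)
    fix i j assume ij: "1 \<le> i \<and> i \<le> j \<and> j \<le> n \<and> (i, j) \<noteq> (1, n)"
    let ?k = "massey_deg d i j"
    have pr: "proper n i j" using ij by (simp add: proper_def)
    show Yc: "Y i j \<in> carrier (A ?k)" using Yy[OF pr] by blast
    have sub: "proper n p q" if "i \<le> p" "p \<le> q" "q \<le> j" "(p, q) \<noteq> (i, j)" for p q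
      using that ij by (auto simp: proper_def)
    have ijle: "i \<le> j" using ij by simp
    have Ys: "Y p q \<in> carrier (A (massey_deg d p q))" if "i \<le> p" "p \<le> q" "q \<le> j" "(p, q) \<noteq> (i, j)" for p q
      using Yy[OF sub[OF that]] by blast
    have "emb (A (?k + 1)) (massey_sum A \<delta> d Y i j) = A.curv (shifted_deg d) y i j"
    proof (rule trans)
      show "emb (A (?k + 1)) (massey_sum A \<delta> d Y i j) =
          massey A.\<delta>.L (shifted_deg d) (\<lambda>i j. emb (A (massey_deg d i j)) (Y i j)) i j"
        by (rule A.emb_massey_sum(1)[OF A.\<delta>.graded_map_axioms ijle, of Y d, OF Ys])
    qed (unfold A.massey_curv[OF ijle], rule A.curv_cong, use Yy sub in auto)
    moreover have ms: "massey_sum A \<delta> d Y i j \<in> carrier (A (?k + 1))"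
      by (rule A.emb_massey_sum(2)[OF A.\<delta>.graded_map_axioms ijle, of Y d, OF Ys])
    moreover have "A.b1 (shifted_deg d i j) (y i j) = - A.curv (shifted_deg d) y i j" using y(3) ij by blast
    moreover have "A.b1 (shifted_deg d i j) (y i j) = emb (A (?k + 1)) (\<delta> [(?k, Y i j)])"
      using A.b1_emb[OF Yc] Yy[OF pr] by (simp add: massey_deg_shifted_deg)
    ultimately have "emb (A (?k + 1)) (\<delta> [(?k, Y i j)]) = emb (A (?k + 1)) (\<ominus>\<^bsub>A (?k + 1)\<^esub> massey_sum A \<delta> d Y i j)"
      by (simp add: emb_minus)
    moreover have "\<ominus>\<^bsub>A (?k + 1)\<^esub> massey_sum A \<delta> d Y i j \<in> carrier (A (?k + 1))"
      by (rule abelian_group.a_inv_closed[OF A.abelian_group ms])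
    ultimately show "\<delta> [(?k, Y i j)] = \<ominus>\<^bsub>A (?k + 1)\<^esub> massey_sum A \<delta> d Y i j"
      using A.d_in[OF Yc] by (simp add: emb_inj)
  qed
  moreover have "A.cls (massey_deg d 1 n + 1) (massey_sum A \<delta> d Y 1 n) =
     A.cls (massey_deg d 1 n + 1) (f [(massey_deg d 1 n + 1, massey_sum H \<mu> d w 1 n)])"
    by (rule massey_class[of Y y w v z]) (use Yy wc v_def y(4,5) in auto)
  ultimately show ?thesis by (rule that)
qed

lemma defining_system_to_solution:
  assumes Y: "defining_system A \<delta> n d a Y"
  obtains w where "solution n d x w"
    "A.cls (massey_deg d 1 n + 1) (massey_sum A \<delta> d Y 1 n) =
     A.cls (massey_deg d 1 n + 1) (f [(massey_deg d 1 n + 1, massey_sum H \<mu> d w 1 n)])"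
proof -
  obtain g where g: "\<And>i. g i \<in> homg A (d i - 2)" "\<And>i. i \<in> {1..n} \<Longrightarrow>
       emb (A (d i)) (a i) = emb (A (d i)) (f [(d i, x i)]) + A.b1 (d i - 2) (g i)"
    using diagonal by metis
  have Yc: "Y p q \<in> carrier (A (massey_deg d p q))"
    and Yd: "\<delta> [(massey_deg d p q, Y p q)] = \<ominus>\<^bsub>A (massey_deg d p q + 1)\<^esub> massey_sum A \<delta> d Y p q"
    if "proper n p q" for p q
    using Y that by (auto simp: defining_system_def proper_def)
  have Ya: "Y i i = a i" if "i \<in> {1..n}" for i using Y that by (auto simp: defining_system_def)
  define y where "y p q = emb (A (massey_deg d p q)) (Y p q)" for p q
  \<comment> \<open>Zero outside {1..n}, where nothing is known about the degree of
    \<open>x i\<close>.\<close>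
  define v where "v i = (if i \<in> {1..n} then emb (H (d i)) (x i) else 0)" for i
  have yC: "y p q \<in> homg A (shifted_deg d p q)" if "1 \<le> p" "p \<le> q" "q \<le> n" "(p, q) \<noteq> (1, n)" for p q
    using A.emb_homg[OF Yc[of p q]] that by (simp add: y_def massey_deg_shifted_deg proper_def)
  have mc: "A.b1 (shifted_deg d p q) (y p q) = - A.curv (shifted_deg d) y p q" if pq: "1 \<le> p" "p \<le> q" "q \<le> n" "(p, q) \<noteq> (1, n)" for p q
  proof -
    let ?k = "massey_deg d p q"
    have pr: "proper n p q" using pq by (simp add: proper_def)
    have Ys: "Y i j \<in> carrier (A (massey_deg d i j))" if "p \<le> i" "i \<le> j" "j \<le> q" "(i, j) \<noteq> (p, q)" for i j
      using that pq by (intro Yc) (auto simp: proper_def)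
    have "emb (A (?k + 1)) (massey_sum A \<delta> d Y p q) = A.curv (shifted_deg d) y p q"
    proof (rule trans)
      show "emb (A (?k + 1)) (massey_sum A \<delta> d Y p q) =
          massey A.\<delta>.L (shifted_deg d) (\<lambda>i j. emb (A (massey_deg d i j)) (Y i j)) p q"
        by (rule A.emb_massey_sum(1)[OF A.\<delta>.graded_map_axioms pq(2), of Y d, OF Ys])
    qed (unfold A.massey_curv[OF pq(2)], rule A.curv_cong, simp add: y_def)
    moreover have ms: "massey_sum A \<delta> d Y p q \<in> carrier (A (?k + 1))"
      by (rule A.emb_massey_sum(2)[OF A.\<delta>.graded_map_axioms pq(2), of Y d, OF Ys])
    moreover have "A.b1 (shifted_deg d p q) (y p q) = emb (A (?k + 1)) (\<delta> [(?k, Y p q)])"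
      using A.b1_emb[OF Yc[OF pr]] by (simp add: y_def massey_deg_shifted_deg)
    ultimately show ?thesis by (simp add: Yd[OF pr] emb_minus)
  qed
  have vC: "v i \<in> homg H (shifted_deg d i i)" for i
    using H.emb_homg[OF x[of i]] H.homg_zero by (simp add: v_def)
  \<comment> \<open>The gauge transformation now starts at the given system and ends at the image,
    so \<open>g\<close> changes sign.\<close>
  have gC: "- g i \<in> homg A (shifted_deg d i i - 1)" for i using A.homg_minus[OF g(1)[of i]] by simp
  have diag: "f.L [(shifted_deg d i i, v i)] = y i i + A.b1 (shifted_deg d i i - 1) (- g i)" if "1 \<le> i" "i \<le> n" for i
  proof -
    have i: "i \<in> {1..n}" using that by simp
    have "f.L [(d i - 1, v i)] = emb (A (d i)) (f [(d i, x i)])" using f_emb[OF x[OF i]] i by (simp add: v_def)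
    then show ?thesis using g(2)[OF i] Ya[OF i]
      by (simp add: y_def massey_deg_shifted_deg additive.minus[OF A.b1_add])
  qed
  have n2: "2 \<le> n" using n by simp
  obtain w' z where w': "\<And>i. w' i i = v i" "\<And>p q. w' p q \<in> homg H (shifted_deg d p q)"
    "\<And>p q. 1 \<le> p \<Longrightarrow> p < q \<Longrightarrow> q \<le> n \<Longrightarrow> (p, q) \<noteq> (1, n) \<Longrightarrow> massey H.\<mu>.L (shifted_deg d) w' p q = 0"
    "z \<in> homg A (shifted_deg d 1 n)"
    "A.curv (shifted_deg d) y 1 n = f.L [(shifted_deg d 1 n + 1, massey H.\<mu>.L (shifted_deg d) w' 1 n)] + A.b1 (shifted_deg d 1 n) z"
    using lift_defining_system[of "shifted_deg d" n y v "\<lambda>i. - g i", OF shifted_deg_add yC mc vC gC diag n2] by blast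
  define w where "w p q = proj (H (massey_deg d p q)) (w' p q)" for p q
  have wc: "w p q \<in> carrier (H (massey_deg d p q))" for p q by (simp add: w_def)
  have ww: "w' p q = emb (H (massey_deg d p q)) (w p q)" for p q
    using H.homg_emb_proj[OF w'(2)] by (simp add: w_def massey_deg_shifted_deg)
  have "solution n d x w"
    unfolding solution_def
  proof (intro conjI ballI allI impI)
    show "w i i = x i" if i: "i \<in> {1..n}" for i
      using i x[OF i] by (simp add: w_def w'(1) v_def massey_deg_shifted_deg)
    show "w p q \<in> carrier (H (massey_deg d p q))" for p q by (rule wc)
    fix p q assume pq: "proper n p q"
    show "massey_sum H \<mu> d w p q = \<zero>\<^bsub>H (massey_deg d p q + 1)\<^esub>"
    proof (cases "p = q")
      case True
      then show ?thesis using H.massey_sum_same by simp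
    next
      case False
      have le: "p \<le> q" using pq by (simp add: proper_def)
      have "emb (H (massey_deg d p q + 1)) (massey_sum H \<mu> d w p q) = massey H.\<mu>.L (shifted_deg d) w' p q"
        unfolding H.emb_massey_sum(1)[OF H.\<mu>.graded_map_axioms le, of w d, OF wc]
        by (rule massey_cong) (simp add: ww)
      also have "\<dots> = 0" using False pq by (intro w'(3)) (auto simp: proper_def)
      finally show ?thesis
        using emb_eq_0[OF H.abelian_group] H.emb_massey_sum(2)[OF H.\<mu>.graded_map_axioms le, of w d, OF wc] by simp
    qed
  qed
  moreover have "A.cls (massey_deg d 1 n + 1) (massey_sum A \<delta> d Y 1 n) =
     A.cls (massey_deg d 1 n + 1) (f [(massey_deg d 1 n + 1, massey_sum H \<mu> d w 1 n)])"
    by (rule massey_class[of Y y w w' z]) (use Yc wc ww y_def w'(4,5) in auto)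
  ultimately show ?thesis by (rule that)
qed

theorem massey_product_eq:
  "massey_product A \<delta> n d a =
    {A.cls (massey_deg d 1 n + 1) (f [(massey_deg d 1 n + 1, massey_sum H \<mu> d w 1 n)]) | w. solution n d x w}"
  unfolding massey_product_def
proof (intro equalityI subsetI)
  fix C assume "C \<in> {A.cls (massey_deg d 1 n + 1) (massey_sum A \<delta> d Y 1 n) |Y. defining_system A \<delta> n d a Y}"
  then obtain Y where Y: "defining_system A \<delta> n d a Y" "C = A.cls (massey_deg d 1 n + 1) (massey_sum A \<delta> d Y 1 n)"
    by blast
  obtain w where "solution n d x w" "A.cls (massey_deg d 1 n + 1) (massey_sum A \<delta> d Y 1 n) =
     A.cls (massey_deg d 1 n + 1) (f [(massey_deg d 1 n + 1, massey_sum H \<mu> d w 1 n)])"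
    using defining_system_to_solution[OF Y(1)] by blast
  then show "C \<in> {A.cls (massey_deg d 1 n + 1) (f [(massey_deg d 1 n + 1, massey_sum H \<mu> d w 1 n)]) | w. solution n d x w}"
    using Y(2) by blast
next
  fix C assume "C \<in> {A.cls (massey_deg d 1 n + 1) (f [(massey_deg d 1 n + 1, massey_sum H \<mu> d w 1 n)]) | w. solution n d x w}"
  then obtain w where w: "solution n d x w" "C = A.cls (massey_deg d 1 n + 1) (f [(massey_deg d 1 n + 1, massey_sum H \<mu> d w 1 n)])"
    by blast
  obtain Y where "defining_system A \<delta> n d a Y" "A.cls (massey_deg d 1 n + 1) (massey_sum A \<delta> d Y 1 n) =
     A.cls (massey_deg d 1 n + 1) (f [(massey_deg d 1 n + 1, massey_sum H \<mu> d w 1 n)])"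
    using solution_to_defining_system[OF w(1)] by blast
  then show "C \<in> {A.cls (massey_deg d 1 n + 1) (massey_sum A \<delta> d Y 1 n) |Y. defining_system A \<delta> n d a Y}"
    using w(2) by blast
qed

end

end

section \<open>Polynomial dependence on the coordinates\<close>

context cring
begin

definition monomial_value :: "('v \<Rightarrow> 'a) \<Rightarrow> 'v multiset \<Rightarrow> 'a" where
  "monomial_value c m = (\<Otimes>v \<in> set_mset m. c v [^] count m v)"

lemma monomial_value_closed:
  "c \<in> I \<rightarrow> carrier R \<Longrightarrow> set_mset m \<subseteq> I \<Longrightarrow> monomial_value c m \<in> carrier R"
  unfolding monomial_value_def by (intro finprod_closed) auto

lemma monomial_value_empty: "monomial_value c {#} = \<one>"
  by (simp add: monomial_value_def)

lemma monomial_value_add: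
  assumes c: "c \<in> I \<rightarrow> carrier R" and "set_mset m \<subseteq> I" "v \<in> I"
  shows "monomial_value c (add_mset v m) = c v \<otimes> monomial_value c m"
proof -
  let ?S = "set_mset m - {v}"
  let ?p = "\<Otimes>u \<in> ?S. c u [^] count m u"
  have cl: "(\<lambda>u. c u [^] count m u) \<in> ?S \<rightarrow> carrier R" "c v \<in> carrier R" using assms by auto
  have p: "?p \<in> carrier R" using cl(1) by (rule finprod_closed)
  have "monomial_value c m = c v [^] count m v \<otimes> ?p"
  proof (cases "v \<in># m")
    case True
    then have "set_mset m = insert v ?S" by auto
    then have "monomial_value c m = (\<Otimes>u \<in> insert v ?S. c u [^] count m u)"
      by (simp add: monomial_value_def)
    also have "\<dots> = c v [^] count m v \<otimes> ?p" using cl by (intro finprod_insert) auto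
    finally show ?thesis .
  next
    case False
    then have "?S = set_mset m" "count m v = 0" by (auto simp: not_in_iff)
    then show ?thesis using p by (simp add: monomial_value_def)
  qed
  moreover have "monomial_value c (add_mset v m) = c v [^] Suc (count m v) \<otimes> ?p"
  proof -
    have "set_mset (add_mset v m) = insert v ?S" by auto
    then have "monomial_value c (add_mset v m) = (\<Otimes>u \<in> insert v ?S. c u [^] count (add_mset v m) u)"
      by (simp add: monomial_value_def)
    also have "\<dots> = c v [^] count (add_mset v m) v \<otimes> (\<Otimes>u \<in> ?S. c u [^] count (add_mset v m) u)"
      using assms by (intro finprod_insert) auto
    also have "(\<Otimes>u \<in> ?S. c u [^] count (add_mset v m) u) = ?p"
      by (rule finprod_cong'[OF refl cl(1)]) auto
    finally show ?thesis by simp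
  qed
  ultimately show ?thesis using p cl by (simp add: m_ac)
qed

text \<open>The value of a polynomial is a sum over its support, and a sum over an infinite set is
  zero by convention; finite support is what gives values their meaning.\<close>

lemma indexed_pset_support:
  assumes "P \<in> indexed_pset I (carrier R)"
  shows "finite {m. P m \<noteq> \<zero>}" and "P m \<noteq> \<zero> \<Longrightarrow> set_mset m \<subseteq> I" and "P m \<in> carrier R"
proof -
  show "P m \<in> carrier R" using indexed_pset_in_carrier[OF _ assms] by (simp add: carrier_coeff_def)
  have "finite {m. P m \<noteq> \<zero>} \<and> (\<forall>m. P m \<noteq> \<zero> \<longrightarrow> set_mset m \<subseteq> I)"
    using assms
  proof (induction P rule: indexed_pset.induct)
    case (indexed_const k)
    have "{m. indexed_const k m \<noteq> \<zero>} \<subseteq> {{#}}" by (auto simp: indexed_const_def)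
    then show ?case using finite_subset by (auto simp: indexed_const_def)
  next
    case (indexed_padd P Q)
    have "{m. indexed_padd P Q m \<noteq> \<zero>} \<subseteq> {m. P m \<noteq> \<zero>} \<union> {m. Q m \<noteq> \<zero>}"
      by (auto simp: indexed_padd_def)
    then have "finite {m. indexed_padd P Q m \<noteq> \<zero>}"
      using indexed_padd.IH finite_subset by (metis (no_types, lifting) finite_UnI)
    moreover have "set_mset m \<subseteq> I" if "indexed_padd P Q m \<noteq> \<zero>" for m
    proof -
      have "P m \<noteq> \<zero> \<or> Q m \<noteq> \<zero>" using that by (auto simp: indexed_padd_def)
      then show ?thesis using indexed_padd.IH by blast
    qed
    ultimately show ?case by blast
  next
    case (indexed_pmult P i)
    have s: "m \<in> add_mset i ` {m. P m \<noteq> \<zero>}" if "indexed_pmult P i m \<noteq> \<zero>" for m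
    proof -
      have "i \<in># m" "P (m - {#i#}) \<noteq> \<zero>" using that by (auto simp: indexed_pmult_def split: if_splits)
      then show ?thesis by (intro image_eqI[of _ _ "m - {#i#}"]) auto
    qed
    have "finite {m. indexed_pmult P i m \<noteq> \<zero>}"
    proof (rule finite_subset)
      show "{m. indexed_pmult P i m \<noteq> \<zero>} \<subseteq> add_mset i ` {m. P m \<noteq> \<zero>}"
        by (rule subsetI, rule s, rule CollectD)
      show "finite (add_mset i ` {m. P m \<noteq> \<zero>})" using indexed_pmult.IH by (intro finite_imageI) (rule conjunct1)
    qed
    moreover have "set_mset m \<subseteq> I" if "indexed_pmult P i m \<noteq> \<zero>" for m
    proof -
      obtain m' where m': "m = add_mset i m'" "P m' \<noteq> \<zero>" using s[OF \<open>indexed_pmult P i m \<noteq> \<zero>\<close>] by auto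
      then have "set_mset m' \<subseteq> I" using indexed_pmult.IH by blast
      then show ?thesis using m'(1) indexed_pmult.hyps(2) by simp
    qed
    ultimately show ?case by blast
  qed
  then show "finite {m. P m \<noteq> \<zero>}" "P m \<noteq> \<zero> \<Longrightarrow> set_mset m \<subseteq> I" by blast+
qed

text \<open>Two polynomials and their sum may have different supports; on a common finite superset
  their values can be added termwise.\<close>

lemma indexed_value_superset:
  assumes c: "c \<in> I \<rightarrow> carrier R" and S: "finite S" "{m. P m \<noteq> \<zero>} \<subseteq> S" "\<And>m. m \<in> S \<Longrightarrow> set_mset m \<subseteq> I"
    and P: "\<And>m. P m \<in> carrier R"
  shows "indexed_value R P c = (\<Oplus>m\<in>S. P m \<otimes> monomial_value c m)"
  unfolding indexed_value_def monomial_value_def[symmetric]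
  by (rule add.finprod_mono_neutral_cong_left)
     (use S P monomial_value_closed[OF c] in \<open>auto\<close>)

context
  fixes I :: "'v set" and c :: "'v \<Rightarrow> 'a"
  assumes c: "c \<in> I \<rightarrow> carrier R"
begin

lemma indexed_value_closed:
  assumes "P \<in> indexed_pset I (carrier R)"
  shows "indexed_value R P c \<in> carrier R"
  unfolding indexed_value_def monomial_value_def[symmetric]
  by (intro finsum_closed Pi_I m_closed monomial_value_closed[OF c])
     (use indexed_pset_support[OF assms] in auto)

lemma indexed_value_const:
  assumes "k \<in> carrier R"
  shows "indexed_value R (indexed_const k) c = k"
proof -
  have "indexed_value R (indexed_const k) c = (\<Oplus>m\<in>{{#}}. indexed_const k m \<otimes> monomial_value c m)"
    by (rule indexed_value_superset[OF c]) (use assms in \<open>auto simp: indexed_const_def\<close>)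
  then show ?thesis using assms by (simp add: indexed_const_def monomial_value_empty)
qed

lemma indexed_value_add:
  assumes P: "P \<in> indexed_pset I (carrier R)" and Q: "Q \<in> indexed_pset I (carrier R)"
  shows "indexed_value R (indexed_padd P Q) c = indexed_value R P c \<oplus> indexed_value R Q c"
proof -
  let ?S = "{m. P m \<noteq> \<zero>} \<union> {m. Q m \<noteq> \<zero>}"
  note sP = indexed_pset_support[OF P] and sQ = indexed_pset_support[OF Q]
  have S: "finite ?S" "\<And>m. m \<in> ?S \<Longrightarrow> set_mset m \<subseteq> I" using sP sQ by auto
  have mv: "monomial_value c m \<in> carrier R" if "m \<in> ?S" for m using monomial_value_closed[OF c S(2)[OF that]] .
  have "indexed_value R (indexed_padd P Q) c = (\<Oplus>m\<in>?S. indexed_padd P Q m \<otimes> monomial_value c m)"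
    by (rule indexed_value_superset[OF c S(1) _ S(2)]) (use sP(3) sQ(3) in \<open>auto simp: indexed_padd_def\<close>)
  also have "\<dots> = (\<Oplus>m\<in>?S. P m \<otimes> monomial_value c m \<oplus> Q m \<otimes> monomial_value c m)"
    by (rule finsum_cong') (use mv sP(3) sQ(3) in \<open>auto simp: indexed_padd_def l_distr\<close>)
  also have "\<dots> = (\<Oplus>m\<in>?S. P m \<otimes> monomial_value c m) \<oplus> (\<Oplus>m\<in>?S. Q m \<otimes> monomial_value c m)"
    by (rule finsum_addf) (use mv sP(3) sQ(3) in auto)
  also have "(\<Oplus>m\<in>?S. P m \<otimes> monomial_value c m) = indexed_value R P c"
    by (rule indexed_value_superset[OF c S(1) _ S(2), symmetric]) (use sP(3) in auto)
  also have "(\<Oplus>m\<in>?S. Q m \<otimes> monomial_value c m) = indexed_value R Q c"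
    by (rule indexed_value_superset[OF c S(1) _ S(2), symmetric]) (use sQ(3) in auto)
  finally show ?thesis .
qed

text \<open>Multiplication by a variable shifts monomials by the injective map
  \<open>add_mset i\<close> and keeps the coefficients.\<close>

lemma indexed_value_pmult:
  assumes P: "P \<in> indexed_pset I (carrier R)" and i: "i \<in> I"
  shows "indexed_value R (indexed_pmult P i) c = c i \<otimes> indexed_value R P c"
proof -
  let ?S = "{m. P m \<noteq> \<zero>}"
  note sP = indexed_pset_support[OF P]
  have mv: "monomial_value c m \<in> carrier R" if "m \<in> ?S" for m using monomial_value_closed[OF c sP(2)] that by auto
  have ci: "c i \<in> carrier R" using c i by auto
  have sub: "set_mset m \<subseteq> I" if "m \<in> add_mset i ` ?S" for m
  proof -
    obtain m' where m': "m = add_mset i m'" "P m' \<noteq> \<zero>" using \<open>m \<in> add_mset i ` ?S\<close> by auto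
    have "set_mset m' \<subseteq> I" by (rule sP(2)[OF m'(2)])
    then show ?thesis using m'(1) i by simp
  qed
  have "indexed_value R (indexed_pmult P i) c = (\<Oplus>m\<in>add_mset i ` ?S. indexed_pmult P i m \<otimes> monomial_value c m)"
  proof (rule indexed_value_superset[OF c])
    show "{m. indexed_pmult P i m \<noteq> \<zero>} \<subseteq> add_mset i ` ?S"
    proof
      fix m assume "m \<in> {m. indexed_pmult P i m \<noteq> \<zero>}"
      then have "i \<in># m" "P (m - {#i#}) \<noteq> \<zero>" by (auto simp: indexed_pmult_def split: if_splits)
      then show "m \<in> add_mset i ` ?S" by (intro image_eqI[of _ _ "m - {#i#}"]) auto
    qed
    show "set_mset m \<subseteq> I" if "m \<in> add_mset i ` ?S" for m by (rule sub[OF that])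
  qed (use sP(1,3) in \<open>auto simp: indexed_pmult_def\<close>)
  also have "\<dots> = (\<Oplus>m\<in>?S. indexed_pmult P i (add_mset i m) \<otimes> monomial_value c (add_mset i m))"
  proof (rule finsum_reindex)
    show "(\<lambda>m. indexed_pmult P i m \<otimes> monomial_value c m) \<in> add_mset i ` ?S \<rightarrow> carrier R"
    proof (rule Pi_I)
      fix m assume "m \<in> add_mset i ` ?S"
      then have "set_mset m \<subseteq> I" by (rule sub)
      then show "indexed_pmult P i m \<otimes> monomial_value c m \<in> carrier R"
        using sP(3) monomial_value_closed[OF c] by (auto simp: indexed_pmult_def)
    qed
  qed (auto simp: inj_on_def)
  also have "\<dots> = (\<Oplus>m\<in>?S. c i \<otimes> (P m \<otimes> monomial_value c m))"
  proof (rule finsum_cong')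
    fix m assume m: "m \<in> ?S"
    have "monomial_value c (add_mset i m) = c i \<otimes> monomial_value c m"
      by (rule monomial_value_add[OF c _ i]) (use sP(2) m in auto)
    then show "indexed_pmult P i (add_mset i m) \<otimes> monomial_value c (add_mset i m) =
        c i \<otimes> (P m \<otimes> monomial_value c m)"
      using sP(3) mv[OF m] ci by (simp add: indexed_pmult_def m_lcomm)
  qed (use mv sP(3) ci in auto)
  also have "\<dots> = c i \<otimes> (\<Oplus>m\<in>?S. P m \<otimes> monomial_value c m)"
    by (rule finsum_rdistr[symmetric]) (use mv sP ci in auto)
  finally show ?thesis by (simp add: indexed_value_def monomial_value_def)
qed

end

text \<open>Polynomials are generated by constants, sums and multiplication by a variable; a scalar
  factor is pushed through the latter two down to the constants.\<close>

lemma indexed_pset_scale: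
  assumes "P \<in> indexed_pset I (carrier R)" "r \<in> carrier R"
  shows "\<exists>Q\<in>indexed_pset I (carrier R). \<forall>c\<in>I \<rightarrow> carrier R. indexed_value R Q c = r \<otimes> indexed_value R P c"
  using assms(1)
proof (induction P rule: indexed_pset.induct)
  case (indexed_const k)
  then show ?case
    using assms(2) by (intro bexI[of _ "indexed_const (r \<otimes> k)"])
      (auto simp: indexed_value_const intro: indexed_pset.indexed_const)
next
  case (indexed_padd P Q)
  then obtain P' Q' where "P' \<in> indexed_pset I (carrier R)" "Q' \<in> indexed_pset I (carrier R)"
    "\<And>c. c \<in> I \<rightarrow> carrier R \<Longrightarrow> indexed_value R P' c = r \<otimes> indexed_value R P c"
    "\<And>c. c \<in> I \<rightarrow> carrier R \<Longrightarrow> indexed_value R Q' c = r \<otimes> indexed_value R Q c"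
    by blast
  then show ?case
    using indexed_padd.hyps assms(2) by (intro bexI[of _ "indexed_padd P' Q'"])
      (auto simp: indexed_value_add indexed_value_closed r_distr intro: indexed_pset.indexed_padd)
next
  case (indexed_pmult P i)
  then obtain P' where "P' \<in> indexed_pset I (carrier R)"
    "\<And>c. c \<in> I \<rightarrow> carrier R \<Longrightarrow> indexed_value R P' c = r \<otimes> indexed_value R P c"
    by blast
  then show ?case
    using indexed_pmult.hyps assms(2) by (intro bexI[of _ "indexed_pmult P' i"])
      (auto simp: indexed_value_pmult indexed_value_closed Pi_iff m_lcomm intro: indexed_pset.indexed_pmult)
qed

end

section \<open>Vectors with polynomial coordinates\<close>

locale polynomial_vectors = module R V
  for R :: "('r, 's) ring_scheme" and V :: "('r, 'a) module" +
  fixes B :: "'a set" and I :: "'v set"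
  assumes finite_B: "finite B" and B: "B \<subseteq> carrier V"
    and gen: "\<And>v. v \<in> carrier V \<Longrightarrow> \<exists>a. a \<in> B \<rightarrow> carrier R \<and> v = lincomb a B"
begin

text \<open>The polynomials are chosen once for all \<open>c\<close>. As \<open>B\<close> spans the
  module, constant vectors qualify, and the closure properties below then reach every expression in
  a Massey sum.\<close>

definition poly_vec :: "(('v \<Rightarrow> 'r) \<Rightarrow> 'a) \<Rightarrow> bool" where
  "poly_vec G \<longleftrightarrow> (\<exists>P. (\<forall>b\<in>B. P b \<in> indexed_pset I (carrier R)) \<and>
     (\<forall>c\<in>I \<rightarrow> carrier R. G c = lincomb (\<lambda>b. indexed_value R (P b) c) B))"

lemma poly_vec_closed: "poly_vec G \<Longrightarrow> c \<in> I \<rightarrow> carrier R \<Longrightarrow> G c \<in> carrier V"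
  unfolding poly_vec_def using B by (auto intro!: lincomb_closed R.indexed_value_closed)

lemma poly_vec_cong: "poly_vec G \<Longrightarrow> (\<And>c. c \<in> I \<rightarrow> carrier R \<Longrightarrow> G' c = G c) \<Longrightarrow> poly_vec G'"
  unfolding poly_vec_def by auto

lemma poly_vec_const:
  assumes "v \<in> carrier V"
  shows "poly_vec (\<lambda>c. v)"
proof -
  obtain a where a: "a \<in> B \<rightarrow> carrier R" "v = lincomb a B" using gen[OF assms] by blast
  show ?thesis
    unfolding poly_vec_def
  proof (rule exI[of _ "\<lambda>b. R.indexed_const (a b)"], intro conjI ballI)
    show "R.indexed_const (a b) \<in> indexed_pset I (carrier R)" if "b \<in> B" for b
      using a that by (auto intro: R.indexed_pset.indexed_const)
    show "v = lincomb (\<lambda>b. indexed_value R (R.indexed_const (a b)) c) B" if "c \<in> I \<rightarrow> carrier R" for c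
      unfolding a(2)
      by (rule lincomb_cong) (use B a(1) R.indexed_value_const[OF that] in \<open>auto simp: Pi_iff\<close>)
  qed
qed

lemma poly_vec_add:
  assumes "poly_vec G" "poly_vec G'"
  shows "poly_vec (\<lambda>c. G c \<oplus>\<^bsub>V\<^esub> G' c)"
proof -
  obtain P where P: "\<And>b. b \<in> B \<Longrightarrow> P b \<in> indexed_pset I (carrier R)"
    "\<And>c. c \<in> I \<rightarrow> carrier R \<Longrightarrow> G c = lincomb (\<lambda>b. indexed_value R (P b) c) B"
    using assms(1) unfolding poly_vec_def by blast
  obtain Q where Q: "\<And>b. b \<in> B \<Longrightarrow> Q b \<in> indexed_pset I (carrier R)"
    "\<And>c. c \<in> I \<rightarrow> carrier R \<Longrightarrow> G' c = lincomb (\<lambda>b. indexed_value R (Q b) c) B"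
    using assms(2) unfolding poly_vec_def by blast
  show ?thesis
    unfolding poly_vec_def
  proof (rule exI[of _ "\<lambda>b. R.indexed_padd (P b) (Q b)"], intro conjI ballI)
    show "R.indexed_padd (P b) (Q b) \<in> indexed_pset I (carrier R)" if "b \<in> B" for b
      using P(1) Q(1) that by (intro R.indexed_pset.indexed_padd)
    fix c assume c: "c \<in> I \<rightarrow> carrier R"
    have cl: "indexed_value R (P b) c \<in> carrier R" "indexed_value R (Q b) c \<in> carrier R" "b \<in> carrier V" if "b \<in> B" for b
      using R.indexed_value_closed[OF c] P(1) Q(1) B that by auto
    have "lincomb (\<lambda>b. indexed_value R (R.indexed_padd (P b) (Q b)) c) B =
        (\<Oplus>\<^bsub>V\<^esub>b\<in>B. indexed_value R (P b) c \<odot>\<^bsub>V\<^esub> b \<oplus>\<^bsub>V\<^esub> indexed_value R (Q b) c \<odot>\<^bsub>V\<^esub> b)"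
      unfolding lincomb_def
      by (rule M.finsum_cong') (use cl P(1) Q(1) R.indexed_value_add[OF c] in \<open>auto simp: smult_l_distr\<close>)
    also have "\<dots> = G c \<oplus>\<^bsub>V\<^esub> G' c"
      unfolding P(2)[OF c] Q(2)[OF c] lincomb_def by (rule M.finsum_addf) (use cl in auto)
    finally show "G c \<oplus>\<^bsub>V\<^esub> G' c = lincomb (\<lambda>b. indexed_value R (R.indexed_padd (P b) (Q b)) c) B" ..
  qed
qed

lemma poly_vec_var:
  assumes "poly_vec G" "i \<in> I"
  shows "poly_vec (\<lambda>c. c i \<odot>\<^bsub>V\<^esub> G c)"
proof -
  obtain P where P: "\<And>b. b \<in> B \<Longrightarrow> P b \<in> indexed_pset I (carrier R)"
    "\<And>c. c \<in> I \<rightarrow> carrier R \<Longrightarrow> G c = lincomb (\<lambda>b. indexed_value R (P b) c) B"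
    using assms(1) unfolding poly_vec_def by blast
  show ?thesis
    unfolding poly_vec_def
  proof (rule exI[of _ "\<lambda>b. R.indexed_pmult (P b) i"], intro conjI ballI)
    show "R.indexed_pmult (P b) i \<in> indexed_pset I (carrier R)" if "b \<in> B" for b
      using P(1) assms(2) that by (intro R.indexed_pset.indexed_pmult)
    fix c assume c: "c \<in> I \<rightarrow> carrier R"
    have cl: "indexed_value R (P b) c \<in> carrier R" if "b \<in> B" for b
      using R.indexed_value_closed[OF c] P(1) that by auto
    have ci: "c i \<in> carrier R" using c assms(2) by auto
    have "lincomb (\<lambda>b. indexed_value R (R.indexed_pmult (P b) i) c) B =
        lincomb (\<lambda>b. c i \<otimes>\<^bsub>R\<^esub> indexed_value R (P b) c) B"
      by (rule lincomb_cong) (use B cl ci P(1) R.indexed_value_pmult[OF c _ assms(2)] in auto)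
    also have "\<dots> = c i \<odot>\<^bsub>V\<^esub> G c"
      unfolding P(2)[OF c] by (rule lincomb_smult) (use B cl ci in auto)
    finally show "c i \<odot>\<^bsub>V\<^esub> G c = lincomb (\<lambda>b. indexed_value R (R.indexed_pmult (P b) i) c) B" ..
  qed
qed

lemma poly_vec_scale:
  assumes "poly_vec G" "r \<in> carrier R"
  shows "poly_vec (\<lambda>c. r \<odot>\<^bsub>V\<^esub> G c)"
proof -
  obtain P where P: "\<And>b. b \<in> B \<Longrightarrow> P b \<in> indexed_pset I (carrier R)"
    "\<And>c. c \<in> I \<rightarrow> carrier R \<Longrightarrow> G c = lincomb (\<lambda>b. indexed_value R (P b) c) B"
    using assms(1) unfolding poly_vec_def by blast
  have "\<forall>b\<in>B. \<exists>Q. Q \<in> indexed_pset I (carrier R) \<and>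
      (\<forall>c\<in>I \<rightarrow> carrier R. indexed_value R Q c = r \<otimes>\<^bsub>R\<^esub> indexed_value R (P b) c)"
  proof
    fix b assume "b \<in> B"
    from R.indexed_pset_scale[OF P(1)[OF this] assms(2)]
    show "\<exists>Q. Q \<in> indexed_pset I (carrier R) \<and>
      (\<forall>c\<in>I \<rightarrow> carrier R. indexed_value R Q c = r \<otimes>\<^bsub>R\<^esub> indexed_value R (P b) c)"
      by (simp only: Bex_def)
  qed
  from bchoice[OF this] obtain Q where "\<forall>b\<in>B. Q b \<in> indexed_pset I (carrier R) \<and>
      (\<forall>c\<in>I \<rightarrow> carrier R. indexed_value R (Q b) c = r \<otimes>\<^bsub>R\<^esub> indexed_value R (P b) c)"
    by (elim exE)
  then have Q: "\<And>b. b \<in> B \<Longrightarrow> Q b \<in> indexed_pset I (carrier R)"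
    "\<And>b c. b \<in> B \<Longrightarrow> c \<in> I \<rightarrow> carrier R \<Longrightarrow> indexed_value R (Q b) c = r \<otimes>\<^bsub>R\<^esub> indexed_value R (P b) c"
    by simp_all
  show ?thesis
    unfolding poly_vec_def
  proof (rule exI[of _ "Q"], intro conjI ballI)
    show "Q b \<in> indexed_pset I (carrier R)" if "b \<in> B" for b using Q(1) that .
    fix c assume c: "c \<in> I \<rightarrow> carrier R"
    have cl: "indexed_value R (P b) c \<in> carrier R" if "b \<in> B" for b
      using R.indexed_value_closed[OF c] P(1) that by auto
    have "lincomb (\<lambda>b. indexed_value R (Q b) c) B = lincomb (\<lambda>b. r \<otimes>\<^bsub>R\<^esub> indexed_value R (P b) c) B"
      by (rule lincomb_cong) (use B cl assms(2) Q(2) c in auto)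
    also have "\<dots> = r \<odot>\<^bsub>V\<^esub> G c"
      unfolding P(2)[OF c] by (rule lincomb_smult) (use B cl assms(2) in auto)
    finally show "r \<odot>\<^bsub>V\<^esub> G c = lincomb (\<lambda>b. indexed_value R (Q b) c) B" ..
  qed
qed

lemma poly_vec_signed:
  assumes "poly_vec G"
  shows "poly_vec (\<lambda>c. signed V n (G c))"
proof (cases "even n")
  case True
  then show ?thesis using assms by (simp add: signed_def)
next
  case False
  have "poly_vec (\<lambda>c. (\<ominus>\<^bsub>R\<^esub> \<one>\<^bsub>R\<^esub>) \<odot>\<^bsub>V\<^esub> G c)" by (rule poly_vec_scale[OF assms]) simp
  then show ?thesis
    by (rule poly_vec_cong) (simp add: signed_def False smult_l_minus poly_vec_closed[OF assms])
qed

lemma poly_vec_sum: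
  assumes "finite S" "\<And>j. j \<in> S \<Longrightarrow> poly_vec (G j)"
  shows "poly_vec (\<lambda>c. \<Oplus>\<^bsub>V\<^esub>j\<in>S. G j c)"
  using assms
proof (induction S)
  case empty
  then show ?case by (simp add: poly_vec_const)
next
  case (insert j S)
  have "poly_vec (\<lambda>c. G j c \<oplus>\<^bsub>V\<^esub> (\<Oplus>\<^bsub>V\<^esub>j\<in>S. G j c))"
    using insert by (intro poly_vec_add) auto
  then show ?case
  proof (rule poly_vec_cong)
    fix c assume "c \<in> I \<rightarrow> carrier R"
    then show "(\<Oplus>\<^bsub>V\<^esub>j\<in>insert j S. G j c) = G j c \<oplus>\<^bsub>V\<^esub> (\<Oplus>\<^bsub>V\<^esub>j\<in>S. G j c)"
      using insert poly_vec_closed by (intro M.finsum_insert) auto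
  qed
qed

end

lemma (in graded_map) multilinear_zero:
  assumes "homog A us" "homog A ws"
  shows "\<phi> (us @ (k, \<zero>\<^bsub>A k\<^esub>) # ws) = \<zero>\<^bsub>B (out_deg e (us @ (k, \<zero>\<^bsub>A k\<^esub>) # ws))\<^esub>"
proof -
  interpret M: module R "A k" by simp
  let ?xs = "us @ (k, \<zero>\<^bsub>A k\<^esub>) # ws"
  interpret N: module R "B (out_deg e ?xs)" by simp
  have h: "homog A ?xs" using assms by simp
  have "\<phi> (us @ (k, \<zero>\<^bsub>R\<^esub> \<odot>\<^bsub>A k\<^esub> \<zero>\<^bsub>A k\<^esub>) # ws) = \<zero>\<^bsub>R\<^esub> \<odot>\<^bsub>B (out_deg e ?xs)\<^esub> \<phi> ?xs"
    by (rule multilinear_smult[OF h]) simp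
  then show ?thesis using closed[OF _ h] by simp
qed

lemma (in graded_map) multilinear_lincomb:
  assumes "finite S" "S \<subseteq> carrier (A k)" "a \<in> S \<rightarrow> carrier R" "homog A us" "homog A ws"
    and K: "K = out_deg e (us @ (k, \<zero>\<^bsub>A k\<^esub>) # ws)"
  shows "\<phi> (us @ (k, module.lincomb (A k) a S) # ws) = (\<Oplus>\<^bsub>B K\<^esub>b\<in>S. a b \<odot>\<^bsub>B K\<^esub> \<phi> (us @ (k, b) # ws))"
  using assms(1-3)
proof (induction S)
  case empty
  interpret M: module R "A k" by simp
  interpret N: module R "B K" by simp
  show ?case using multilinear_zero[OF assms(4,5), of k, folded K] by (simp add: M.lincomb_def)
next
  case (insert b S)
  interpret M: module R "A k" by simp
  interpret N: module R "B K" by simp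
  have o: "out_deg e (us @ (k, v) # ws) = K" for v by (simp add: K out_deg_def)
  have b: "b \<in> carrier (A k)" "a b \<in> carrier R" "a b \<odot>\<^bsub>A k\<^esub> b \<in> carrier (A k)" using insert.prems by auto
  have l: "M.lincomb a S \<in> carrier (A k)" using insert.prems by (intro M.lincomb_closed) auto
  have cl: "\<phi> (us @ (k, v) # ws) \<in> carrier (B K)" if "v \<in> carrier (A k)" for v
    using closed[of "us @ (k, v) # ws"] o[of v] that assms(4,5) by simp
  have "M.lincomb a (insert b S) = a b \<odot>\<^bsub>A k\<^esub> b \<oplus>\<^bsub>A k\<^esub> M.lincomb a S"
    unfolding M.lincomb_def using insert by (intro M.finsum_insert) auto
  then have "\<phi> (us @ (k, M.lincomb a (insert b S)) # ws) =
      \<phi> (us @ (k, a b \<odot>\<^bsub>A k\<^esub> b) # ws) \<oplus>\<^bsub>B K\<^esub> \<phi> (us @ (k, M.lincomb a S) # ws)"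
    using multilinear_add[of us k "a b \<odot>\<^bsub>A k\<^esub> b" ws "M.lincomb a S"] b l assms(4,5) o by simp
  also have "\<phi> (us @ (k, a b \<odot>\<^bsub>A k\<^esub> b) # ws) = a b \<odot>\<^bsub>B K\<^esub> \<phi> (us @ (k, b) # ws)"
    using multilinear_smult[of us k b ws "a b"] b assms(4,5) o by simp
  also have "\<phi> (us @ (k, M.lincomb a S) # ws) = (\<Oplus>\<^bsub>B K\<^esub>b\<in>S. a b \<odot>\<^bsub>B K\<^esub> \<phi> (us @ (k, b) # ws))"
    using insert by auto
  finally show ?case
    using insert cl by (subst N.finsum_insert) auto
qed

section \<open>Massey sums in coordinates\<close>

locale massey_bases = graded_mod R H + \<mu>: graded_map R H H 2 \<mu>
  for R :: "('r, 's) ring_scheme" and H :: "('r, 'a) graded" and \<mu> +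
  fixes n :: nat and d :: "nat \<Rightarrow> int" and x :: "nat \<Rightarrow> 'a" and Bs :: "int \<Rightarrow> 'a set"
  assumes field: "field R" and fin_dim: "vectorspace.fin_dim R (H k)"
    and basis: "vectorspace.basis R (H k) (Bs k)"
    and x: "i \<in> {1..n} \<Longrightarrow> x i \<in> carrier (H (d i))"
begin

lemma vectorspace: "vectorspace R (H k)"
  using field module by (simp add: vectorspace_def)

text \<open>Finite dimension makes every basis finite, so expansions are sums over all of
  \<open>Bs k\<close>; independence turns the vanishing of a vector into that of all its
  coordinates.\<close>

lemma basis_facts: "finite (Bs k)" "Bs k \<subseteq> carrier (H k)"
  and lincomb_exists: "v \<in> carrier (H k) \<Longrightarrow> \<exists>a. a \<in> Bs k \<rightarrow> carrier R \<and> v = module.lincomb (H k) a (Bs k)"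
  and lincomb_zero_iff: "a \<in> Bs k \<rightarrow> carrier R \<Longrightarrow>
    module.lincomb (H k) a (Bs k) = \<zero>\<^bsub>H k\<^esub> \<longleftrightarrow> (\<forall>b\<in>Bs k. a b = \<zero>\<^bsub>R\<^esub>)"
proof -
  interpret V: vectorspace R "H k" by (rule vectorspace)
  have b: "\<not> V.lin_dep (Bs k)" "V.span (Bs k) = carrier (H k)" and sub: "Bs k \<subseteq> carrier (H k)"
    using basis[of k] by (auto simp: V.basis_def)
  show fin: "finite (Bs k)" by (rule V.fin_dim_li_fin[OF fin_dim b(1) sub])
  show "Bs k \<subseteq> carrier (H k)" by (rule sub)
  show "\<exists>a. a \<in> Bs k \<rightarrow> carrier R \<and> v = V.lincomb a (Bs k)" if "v \<in> carrier (H k)"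
    using V.finite_in_span[OF fin sub, of v] b(2) that by auto
  show "V.lincomb a (Bs k) = \<zero>\<^bsub>H k\<^esub> \<longleftrightarrow> (\<forall>b\<in>Bs k. a b = \<zero>\<^bsub>R\<^esub>)" if a: "a \<in> Bs k \<rightarrow> carrier R"
  proof
    assume "V.lincomb a (Bs k) = \<zero>\<^bsub>H k\<^esub>"
    then show "\<forall>b\<in>Bs k. a b = \<zero>\<^bsub>R\<^esub>"
      using V.lin_dep_crit[OF fin subset_refl a] b(1) by blast
  next
    assume z: "\<forall>b\<in>Bs k. a b = \<zero>\<^bsub>R\<^esub>"
    have "V.lincomb a (Bs k) = (\<Oplus>\<^bsub>H k\<^esub>b\<in>Bs k. \<zero>\<^bsub>H k\<^esub>)"
      unfolding V.lincomb_def
      by (rule V.M.finsum_cong') (use z sub in auto)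
    then show "V.lincomb a (Bs k) = \<zero>\<^bsub>H k\<^esub>" by simp
  qed
qed

abbreviation "I \<equiv> massey_vars n d Bs"
abbreviation "entry \<equiv> massey_entry H d Bs x"

lemma polynomial_vectors: "polynomial_vectors R (H k) (Bs k)"
  by (intro polynomial_vectors.intro polynomial_vectors_axioms.intro module basis_facts lincomb_exists)

lemma entry_closed:
  assumes "c \<in> I \<rightarrow> carrier R" "1 \<le> p" "p \<le> q" "q \<le> n" "(p, q) \<noteq> (1, n)"
  shows "entry c p q \<in> carrier (H (massey_deg d p q))"
proof (cases "p = q")
  case True
  then show ?thesis using x[of p] assms by (simp add: massey_entry_def massey_deg_def)
next
  case False
  interpret module R "H (massey_deg d p q)" by simp
  have "(\<lambda>b. c (p, q, b)) \<in> Bs (massey_deg d p q) \<rightarrow> carrier R"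
    using assms False by (auto simp: massey_vars_def)
  then show ?thesis using False basis_facts(2) by (auto simp: massey_entry_def intro!: lincomb_closed)
qed

text \<open>Arguments are expanded from left to right: \<open>us\<close> holds those already fixed,
  \<open>L\<close> those that may depend on \<open>c\<close>. A diagonal entry at the head of
  \<open>L\<close> is constant and moves to \<open>us\<close>; any other is expanded in the basis,
  which gives a sum of variables times values of the same shape with a longer \<open>us\<close>.
  Once \<open>L\<close> is empty the value is constant.\<close>

lemma poly_vec_mu:
  assumes "\<And>i j. (i, j) \<in> set L \<Longrightarrow> 1 \<le> i \<and> i \<le> j \<and> j \<le> n \<and> (i, j) \<noteq> (1, n)"
    and "homog H us" "us \<noteq> [] \<or> L \<noteq> []"
    and "k = 2 - int (length us + length L) + (\<Sum>u\<leftarrow>us. fst u) + (\<Sum>(i, j)\<leftarrow>L. massey_deg d i j)"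
  shows "polynomial_vectors.poly_vec R (H k) (Bs k) I
     (\<lambda>c. \<mu> (us @ map (\<lambda>(i, j). (massey_deg d i j, entry c i j)) L))"
  using assms
proof (induction L arbitrary: us)
  case Nil
  interpret P: polynomial_vectors R "H k" "Bs k" I by (rule polynomial_vectors)
  have "\<mu> us \<in> carrier (H k)"
    using \<mu>.closed[of us] Nil by (simp add: out_deg_def)
  then show ?case by (simp add: P.poly_vec_const)
next
  case (Cons u L)
  interpret P: polynomial_vectors R "H k" "Bs k" I by (rule polynomial_vectors)
  obtain i j where u: "u = (i, j)" by (cases u) auto
  have ij: "1 \<le> i" "i \<le> j" "j \<le> n" "(i, j) \<noteq> (1, n)" using Cons.prems(1)[of i j] u by auto
  let ?k = "massey_deg d i j"
  let ?L = "\<lambda>c. map (\<lambda>(i, j). (massey_deg d i j, entry c i j)) L"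
  have IH: "P.poly_vec (\<lambda>c. \<mu> ((us @ [(?k, v)]) @ ?L c))" if "v \<in> carrier (H ?k)" for v
    by (rule Cons.IH) (use Cons.prems that u in \<open>auto simp: algebra_simps\<close>)
  show ?case
  proof (cases "i = j")
    case True
    have "x i \<in> carrier (H ?k)" using x[of i] ij True by (simp add: massey_deg_def)
    from IH[OF this] show ?thesis using True u by (simp add: massey_entry_def)
  next
    case False
    have "P.poly_vec (\<lambda>c. \<Oplus>\<^bsub>H k\<^esub>b\<in>Bs ?k. c (i, j, b) \<odot>\<^bsub>H k\<^esub> \<mu> ((us @ [(?k, b)]) @ ?L c))"
    proof (intro P.poly_vec_sum P.poly_vec_var IH)
      show "finite (Bs ?k)" by (rule basis_facts)
      fix b assume b: "b \<in> Bs ?k"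
      then show "b \<in> carrier (H ?k)" using basis_facts(2) by blast
      show "(i, j, b) \<in> I" using b ij False by (simp add: massey_vars_def)
    qed
    then show ?thesis
    proof (rule P.poly_vec_cong)
      fix c assume c: "c \<in> I \<rightarrow> carrier R"
      have a: "(\<lambda>b. c (i, j, b)) \<in> Bs ?k \<rightarrow> carrier R"
        using c ij False by (auto simp: massey_vars_def)
      have h: "homog H (?L c)"
        using Cons.prems(1) entry_closed[OF c] by (auto simp: homog_def)
      have K: "k = out_deg 2 (us @ (?k, \<zero>\<^bsub>H ?k\<^esub>) # ?L c)"
        using Cons.prems(4) u by (simp add: out_deg_def o_def case_prod_unfold algebra_simps)
      show "\<mu> (us @ map (\<lambda>(i, j). (massey_deg d i j, entry c i j)) (u # L)) =
         (\<Oplus>\<^bsub>H k\<^esub>b\<in>Bs ?k. c (i, j, b) \<odot>\<^bsub>H k\<^esub> \<mu> ((us @ [(?k, b)]) @ ?L c))"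
        using \<mu>.multilinear_lincomb[OF basis_facts(1,2) a Cons.prems(2) h K] u False
        by (simp add: massey_entry_def)
    qed
  qed
qed

lemma poly_vec_massey_sum:
  assumes pq: "1 \<le> p" "p < q" "q \<le> n"
  shows "polynomial_vectors.poly_vec R (H (massey_deg d p q + 1)) (Bs (massey_deg d p q + 1)) I
     (\<lambda>c. massey_sum H \<mu> d (entry c) p q)"
proof -
  let ?K = "massey_deg d p q + 1"
  interpret P: polynomial_vectors R "H ?K" "Bs ?K" I by (rule polynomial_vectors)
  let ?J = "{js. js \<noteq> [] \<and> sorted_wrt (<) js \<and> set js \<subseteq> {p..<q}}"
  let ?y = "\<lambda>js c. map (\<lambda>(i, j). (massey_deg d i j, entry c i j)) (blocks p js q)"
  have pq': "p \<le> q" using pq by simp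
  have fin: "finite ?J"
    using bij_betw_finite[OF blocks_bij[OF pq']] by simp
  have "P.poly_vec (\<lambda>c. \<Oplus>\<^bsub>H ?K\<^esub>js\<in>?J. snd (shifted H 2 \<mu> (?y js c)))"
  proof (rule P.poly_vec_sum[OF fin])
    fix js assume js: "js \<in> ?J"
    have b: "blocks p js q \<in> parts p q - {[(p, q)]}"
      using bij_betwE[OF blocks_bij[OF pq']] js by blast
    have pr: "1 \<le> i \<and> i \<le> j \<and> j \<le> n \<and> (i, j) \<noteq> (1, n)" if "(i, j) \<in> set (blocks p js q)" for i j
      using parts_proper[of "blocks p js q" p q i j] b that pq by auto
    have ne: "blocks p js q \<noteq> []" using parts_ne_Nil[OF pq'] b by auto
    \<comment> \<open>Only degrees matter in this computation, so the entries are dummies.\<close>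
    have "tdeg (args (shifted_deg d) (\<lambda>i j. ()) (blocks p js q)) = shifted_deg d p q"
      using b pq' by (intro tdeg_args[of "shifted_deg d", OF shifted_deg_add]) (auto simp: parts_def)
    moreover have "tdeg (args (shifted_deg d) (\<lambda>i j. ()) L) = (\<Sum>(i, j)\<leftarrow>L. massey_deg d i j) - int (length L)" for L
      by (induction L) (auto simp: massey_deg_shifted_deg)
    ultimately have deg: "?K = 2 - int (length (blocks p js q)) + (\<Sum>(i, j)\<leftarrow>blocks p js q. massey_deg d i j)"
      by (simp add: massey_deg_shifted_deg)
    have o: "out_deg 2 (?y js c) = ?K" for c
      unfolding out_deg_def deg by (simp add: o_def case_prod_unfold)
    \<comment> \<open>The sign of the shift is the same for all \<open>c\<close>, so it acts as one
      scalar.\<close>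
    obtain s where s: "\<And>c. sign_exp (?y js c) = s"
    proof (rule that)
      show "sign_exp (?y js c) = sign_exp (?y js (\<lambda>_. undefined))" for c
        by (rule sign_exp_cong) auto
    qed
    have "P.poly_vec (\<lambda>c. \<mu> ([] @ ?y js c))"
      by (rule poly_vec_mu) (use pr ne deg in auto)
    then have "P.poly_vec (\<lambda>c. signed (H ?K) s (\<mu> (?y js c)))" by (intro P.poly_vec_signed) simp
    then show "P.poly_vec (\<lambda>c. snd (shifted H 2 \<mu> (?y js c)))"
      by (rule P.poly_vec_cong) (simp add: shifted_sign_exp o s)
  qed
  then show ?thesis by (simp add: massey_sum_def blocks_def)
qed

lemma massey_sum_polynomial:
  assumes pq: "1 \<le> p" "p < q" "q \<le> n"
  shows "\<exists>P. (\<forall>b\<in>Bs (massey_deg d p q + 1). P b \<in> ring.indexed_pset R I (carrier R)) \<and>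
    (\<forall>c\<in>I \<rightarrow> carrier R.
       massey_sum H \<mu> d (entry c) p q =
         module.lincomb (H (massey_deg d p q + 1)) (\<lambda>b. indexed_value R (P b) c) (Bs (massey_deg d p q + 1)) \<and>
       (massey_sum H \<mu> d (entry c) p q = \<zero>\<^bsub>H (massey_deg d p q + 1)\<^esub> \<longleftrightarrow>
        (\<forall>b\<in>Bs (massey_deg d p q + 1). indexed_value R (P b) c = \<zero>\<^bsub>R\<^esub>)))"
proof -
  let ?K = "massey_deg d p q + 1"
  interpret P: polynomial_vectors R "H ?K" "Bs ?K" I by (rule polynomial_vectors)
  obtain P where P: "\<forall>b\<in>Bs ?K. P b \<in> ring.indexed_pset R I (carrier R)"
    "\<And>c. c \<in> I \<rightarrow> carrier R \<Longrightarrow> massey_sum H \<mu> d (entry c) p q = P.lincomb (\<lambda>b. indexed_value R (P b) c) (Bs ?K)"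
    using poly_vec_massey_sum[OF pq] unfolding P.poly_vec_def by blast
  have "(\<lambda>b. indexed_value R (P b) c) \<in> Bs ?K \<rightarrow> carrier R" if "c \<in> I \<rightarrow> carrier R" for c
    using P.R.indexed_value_closed[OF that] P(1) by auto
  then show ?thesis
    using P lincomb_zero_iff by (intro exI[of _ P]) auto
qed

end

theorem corollary2p15:
  fixes R :: "('r, 's) ring_scheme"
    and A :: "int \<Rightarrow> ('r, 'a) module"
    and \<delta> :: "(int \<times> 'a) list \<Rightarrow> 'a"
    and H :: "int \<Rightarrow> ('r, 'a set) module"
  assumes "field R"
    and "dga R A \<delta>"
    and "H = cohomology A \<delta>"
    and "\<forall>k. vectorspace.fin_dim R (H k)"
  shows
    "(\<exists>\<mu> f. a_inf_algebra R H \<mu> \<and> zero_differential H \<mu> \<and> a_inf_quasi_iso R H \<mu> A \<delta> f) \<and>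
     (\<forall>\<mu> f. a_inf_algebra R H \<mu> \<and> zero_differential H \<mu> \<and> a_inf_quasi_iso R H \<mu> A \<delta> f \<longrightarrow>
       (\<forall>(n::nat) (d :: nat \<Rightarrow> int) (x :: nat \<Rightarrow> 'a set) (Bs :: int \<Rightarrow> 'a set set).
          3 \<le> n \<and> (\<forall>i\<in>{1..n}. x i \<in> carrier (H (d i))) \<and>
          (\<forall>k. vectorspace.basis R (H k) (Bs k)) \<longrightarrow>
          (\<forall>a :: nat \<Rightarrow> 'a.
             (\<forall>i\<in>{1..n}. a i \<in> cocycles A \<delta> (d i) \<and>
                coh_class A \<delta> (d i) (a i) = coh_map A \<delta> f (d i) (coh_class H \<mu> (d i) (x i))) \<longrightarrow>
             massey_product A \<delta> n d a =
             coh_map A \<delta> f (massey_deg d 1 n + 1) `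
               {coh_class H \<mu> (massey_deg d 1 n + 1)
                  (massey_sum H \<mu> d (massey_entry H d Bs x c) 1 n) | c.
                  c \<in> massey_vars n d Bs \<rightarrow> carrier R \<and>
                  (\<forall>p q. 1 \<le> p \<and> p < q \<and> q \<le> n \<and> (p, q) \<noteq> (1, n) \<longrightarrow>
                     massey_sum H \<mu> d (massey_entry H d Bs x c) p q =
                     \<zero>\<^bsub>H (massey_deg d p q + 1)\<^esub>)}) \<and>
          (\<forall>p q. 1 \<le> p \<and> p < q \<and> q \<le> n \<longrightarrow>
             (\<exists>P :: 'a set \<Rightarrow> (nat \<times> nat \<times> 'a set) multiset \<Rightarrow> 'r.
                (\<forall>b \<in> Bs (massey_deg d p q + 1).
                   P b \<in> ring.indexed_pset R (massey_vars n d Bs) (carrier R)) \<and>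
                (\<forall>c \<in> massey_vars n d Bs \<rightarrow> carrier R.
                   massey_sum H \<mu> d (massey_entry H d Bs x c) p q =
                     module.lincomb (H (massey_deg d p q + 1))
                       (\<lambda>b. indexed_value R (P b) c) (Bs (massey_deg d p q + 1)) \<and>
                   (massey_sum H \<mu> d (massey_entry H d Bs x c) p q =
                      \<zero>\<^bsub>H (massey_deg d p q + 1)\<^esub> \<longleftrightarrow>
                    (\<forall>b \<in> Bs (massey_deg d p q + 1). indexed_value R (P b) c = \<zero>\<^bsub>R\<^esub>)))))))"
proof -
  have gA: "graded_mod R A"
    using assms(2) by (simp add: graded_mod_def dga_def a_inf_algebra_def)
  interpret A: dg_algebra_field R A \<delta>
    by (intro dg_algebra_field.intro dg_algebra.intro gA dg_algebra_axioms.intro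
        dg_algebra_field_axioms.intro assms)
  have gH: "graded_mod R H" using A.graded_mod_HH assms(3) by simp
  show ?thesis
  proof (intro conjI allI impI)
    show "\<exists>\<mu> f. a_inf_algebra R H \<mu> \<and> zero_differential H \<mu> \<and> a_inf_quasi_iso R H \<mu> A \<delta> f"
      using A.minimal_model_exists assms(3) by simp
  next
    fix \<mu> f and n :: nat and d :: "nat \<Rightarrow> int" and x Bs and a :: "nat \<Rightarrow> 'a"
    assume *: "a_inf_algebra R H \<mu> \<and> zero_differential H \<mu> \<and> a_inf_quasi_iso R H \<mu> A \<delta> f"
      and nx: "3 \<le> n \<and> (\<forall>i\<in>{1..n}. x i \<in> carrier (H (d i))) \<and> (\<forall>k. vectorspace.basis R (H k) (Bs k))"
      and a: "\<forall>i\<in>{1..n}. a i \<in> cocycles A \<delta> (d i) \<and>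
                coh_class A \<delta> (d i) (a i) = coh_map A \<delta> f (d i) (coh_class H \<mu> (d i) (x i))"
    have fg: "graded_map R H A 1 f"
      using * gH gA by (simp add: graded_map_def graded_map_axioms_def a_inf_quasi_iso_def a_inf_morphism_def)
    have min: "minimal_a_inf R H \<mu>"
      using * gH by (simp add: minimal_a_inf_def minimal_a_inf_axioms_def)
    interpret M: minimal_model R A \<delta> H \<mu> f
      by (intro minimal_model.intro A.dg_algebra_axioms min fg minimal_model_axioms.intro) (use * in blast)
    interpret B: massey_bases R H \<mu> n d x Bs
      by (intro massey_bases.intro massey_bases_axioms.intro gH M.H.\<mu>.graded_map_axioms) (use assms nx in auto)
    have n: "3 \<le> n" and x: "\<And>i. i \<in> {1..n} \<Longrightarrow> x i \<in> carrier (H (d i))" using nx by auto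
    \<comment> \<open>Classes over \<open>H\<close> are singletons, so the identification of the
      class of \<open>a i\<close> with that of \<open>x i\<close> is a statement about f_1 of
      \<open>x i\<close>.\<close>
    have ai: "\<And>i. i \<in> {1..n} \<Longrightarrow> a i \<in> A.ZZ (d i)"
      and ax: "\<And>i. i \<in> {1..n} \<Longrightarrow> A.cls (d i) (a i) = A.cls (d i) (f [(d i, x i)])"
      using a x by (auto simp: M.H.class_eq M.H.coh_map_eq)
    let ?K = "massey_deg d 1 n + 1"
    have cls: "coh_map A \<delta> f ?K (coh_class H \<mu> ?K (massey_sum H \<mu> d w 1 n)) =
        A.cls ?K (f [(?K, massey_sum H \<mu> d w 1 n)])"
      if w: "\<And>i j. 1 \<le> i \<Longrightarrow> i \<le> j \<Longrightarrow> j \<le> n \<Longrightarrow> (i, j) \<noteq> (1, n) \<Longrightarrow> w i j \<in> carrier (H (massey_deg d i j))" for w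
    proof -
      have "massey_sum H \<mu> d w 1 n \<in> carrier (H ?K)"
        by (rule M.H.emb_massey_sum(2)[OF M.H.\<mu>.graded_map_axioms _ w]) (use n in auto)
      then show ?thesis by (simp add: M.H.class_eq M.H.coh_map_eq)
    qed
    define good where "good c \<longleftrightarrow> c \<in> B.I \<rightarrow> carrier R \<and>
        (\<forall>p q. 1 \<le> p \<and> p < q \<and> q \<le> n \<and> (p, q) \<noteq> (1, n) \<longrightarrow>
           massey_sum H \<mu> d (B.entry c) p q = \<zero>\<^bsub>H (massey_deg d p q + 1)\<^esub>)" for c
    have "massey_product A \<delta> n d a = {A.cls ?K (f [(?K, massey_sum H \<mu> d w 1 n)]) | w. M.solution n d x w}"
      by (rule M.massey_product_eq[OF n x ai ax])
    also have "\<dots> = {coh_map A \<delta> f ?K (coh_class H \<mu> ?K (massey_sum H \<mu> d (B.entry c) 1 n)) | c. good c}"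
    proof (intro equalityI subsetI)
      fix C assume "C \<in> {A.cls ?K (f [(?K, massey_sum H \<mu> d w 1 n)]) | w. M.solution n d x w}"
      then obtain w where w: "M.solution n d x w" and C: "C = A.cls ?K (f [(?K, massey_sum H \<mu> d w 1 n)])" by blast
      have ww: "w p q \<in> carrier (H (massey_deg d p q))" "massey_sum H \<mu> d w p q = \<zero>\<^bsub>H (massey_deg d p q + 1)\<^esub>"
        if "1 \<le> p" "p \<le> q" "q \<le> n" "(p, q) \<noteq> (1, n)" for p q
      proof -
        have "proper n p q" using that by (simp add: proper_def)
        then show "w p q \<in> carrier (H (massey_deg d p q))" "massey_sum H \<mu> d w p q = \<zero>\<^bsub>H (massey_deg d p q + 1)\<^esub>"
          using w unfolding M.solution_def by simp_all
      qed
      have wx: "w i i = x i" if "i \<in> {1..n}" for i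
        using w that by (auto simp: M.solution_def)
      \<comment> \<open>The guard makes a coefficient function exist for every pair, so that all of
        them can be chosen at once.\<close>
      have "\<exists>e. 1 \<le> p \<and> p < q \<and> q \<le> n \<and> (p, q) \<noteq> (1, n) \<longrightarrow>
          e \<in> Bs (massey_deg d p q) \<rightarrow> carrier R \<and>
          w p q = module.lincomb (H (massey_deg d p q)) e (Bs (massey_deg d p q))" for p q
        using B.lincomb_exists[OF ww(1)[of p q]] by (cases "1 \<le> p \<and> p < q \<and> q \<le> n \<and> (p, q) \<noteq> (1, n)") auto
      then obtain e where e: "\<And>p q. 1 \<le> p \<and> p < q \<and> q \<le> n \<and> (p, q) \<noteq> (1, n) \<longrightarrow>
          e p q \<in> Bs (massey_deg d p q) \<rightarrow> carrier R \<and>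
          w p q = module.lincomb (H (massey_deg d p q)) (e p q) (Bs (massey_deg d p q))"
        by metis
      define c where "c = (\<lambda>(p, q, b). e p q b)"
      have c: "c \<in> B.I \<rightarrow> carrier R"
      proof
        fix v assume "v \<in> B.I"
        then obtain p q b where v: "v = (p, q, b)" "1 \<le> p \<and> p < q \<and> q \<le> n \<and> (p, q) \<noteq> (1, n)"
          "b \<in> Bs (massey_deg d p q)" by (auto simp: massey_vars_def)
        then show "c v \<in> carrier R" using e[of p q] by (auto simp: c_def)
      qed
      \<comment> \<open>Agreement on proper intervals suffices: no Massey sum within {1..n} involves
        the entry of the full interval.\<close>
      have ew: "B.entry c p q = w p q" if "1 \<le> p" "p \<le> q" "q \<le> n" "(p, q) \<noteq> (1, n)" for p q
        using e[of p q] wx[of p] that by (cases "p = q") (auto simp: massey_entry_def c_def)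
      have ms: "massey_sum H \<mu> d (B.entry c) p q = massey_sum H \<mu> d w p q" if pq: "1 \<le> p" "p \<le> q" "q \<le> n" for p q
      proof (rule M.H.massey_sum_cong[OF M.H.\<mu>.graded_map_axioms pq(2)])
        fix i j assume "p \<le> i" "i \<le> j" "j \<le> q" "(i, j) \<noteq> (p, q)"
        then have ij: "1 \<le> i" "i \<le> j" "j \<le> n" "(i, j) \<noteq> (1, n)" using pq by auto
        show "B.entry c i j = w i j" by (rule ew[OF ij])
        then show "B.entry c i j \<in> carrier (H (massey_deg d i j))" using ww(1)[OF ij] by simp
      qed
      have "good c" unfolding good_def using c ms ww(2) by auto
      moreover have "C = coh_map A \<delta> f ?K (coh_class H \<mu> ?K (massey_sum H \<mu> d (B.entry c) 1 n))"
        using C cls[of w, OF ww(1)] ms[of 1 n] n by simp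
      ultimately show "C \<in> {coh_map A \<delta> f ?K (coh_class H \<mu> ?K (massey_sum H \<mu> d (B.entry c) 1 n)) | c. good c}"
        by blast
    next
      fix C assume "C \<in> {coh_map A \<delta> f ?K (coh_class H \<mu> ?K (massey_sum H \<mu> d (B.entry c) 1 n)) | c. good c}"
      then obtain c where c: "good c" and C: "C = coh_map A \<delta> f ?K (coh_class H \<mu> ?K (massey_sum H \<mu> d (B.entry c) 1 n))"
        by blast
      have cR: "c \<in> B.I \<rightarrow> carrier R" using c by (simp add: good_def)
      have "M.solution n d x (B.entry c)"
        unfolding M.solution_def
      proof (intro conjI ballI allI impI)
        show "B.entry c i i = x i" for i by (simp add: massey_entry_def)
        fix p q assume "proper n p q"
        then have pq: "1 \<le> p" "p \<le> q" "q \<le> n" "(p, q) \<noteq> (1, n)" by (auto simp: proper_def)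
        show "B.entry c p q \<in> carrier (H (massey_deg d p q))" by (rule B.entry_closed[OF cR pq])
        show "massey_sum H \<mu> d (B.entry c) p q = \<zero>\<^bsub>H (massey_deg d p q + 1)\<^esub>"
          using c pq M.H.massey_sum_same[of \<mu> d "B.entry c" p] by (cases "p = q") (auto simp: good_def)
      qed
      moreover have "C = A.cls ?K (f [(?K, massey_sum H \<mu> d (B.entry c) 1 n)])"
        unfolding C by (rule cls) (rule B.entry_closed[OF cR])
      ultimately show "C \<in> {A.cls ?K (f [(?K, massey_sum H \<mu> d w 1 n)]) | w. M.solution n d x w}" by blast
    qed
    also have "\<dots> = coh_map A \<delta> f ?K ` {coh_class H \<mu> ?K (massey_sum H \<mu> d (B.entry c) 1 n) | c. good c}"
      by blast
    finally show "massey_product A \<delta> n d a =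
        coh_map A \<delta> f ?K ` {coh_class H \<mu> ?K (massey_sum H \<mu> d (B.entry c) 1 n) | c.
          c \<in> B.I \<rightarrow> carrier R \<and>
          (\<forall>p q. 1 \<le> p \<and> p < q \<and> q \<le> n \<and> (p, q) \<noteq> (1, n) \<longrightarrow>
           massey_sum H \<mu> d (B.entry c) p q = \<zero>\<^bsub>H (massey_deg d p q + 1)\<^esub>)}"
      unfolding good_def .
  next
    fix \<mu> f and n :: nat and d :: "nat \<Rightarrow> int" and x Bs and p q :: nat
    assume *: "a_inf_algebra R H \<mu> \<and> zero_differential H \<mu> \<and> a_inf_quasi_iso R H \<mu> A \<delta> f"
      and nx: "3 \<le> n \<and> (\<forall>i\<in>{1..n}. x i \<in> carrier (H (d i))) \<and> (\<forall>k. vectorspace.basis R (H k) (Bs k))"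
      and pq: "1 \<le> p \<and> p < q \<and> q \<le> n"
    have "minimal_a_inf R H \<mu>"
      using * gH by (simp add: minimal_a_inf_def minimal_a_inf_axioms_def)
    then interpret min: minimal_a_inf R H \<mu> .
    interpret B: massey_bases R H \<mu> n d x Bs
      by (intro massey_bases.intro massey_bases_axioms.intro gH min.\<mu>.graded_map_axioms) (use assms nx in auto)
    show "\<exists>P :: 'a set \<Rightarrow> (nat \<times> nat \<times> 'a set) multiset \<Rightarrow> 'r.
                (\<forall>b \<in> Bs (massey_deg d p q + 1).
                   P b \<in> ring.indexed_pset R (massey_vars n d Bs) (carrier R)) \<and>
                (\<forall>c \<in> massey_vars n d Bs \<rightarrow> carrier R.
                   massey_sum H \<mu> d (massey_entry H d Bs x c) p q =
                     module.lincomb (H (massey_deg d p q + 1))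
                       (\<lambda>b. indexed_value R (P b) c) (Bs (massey_deg d p q + 1)) \<and>
                   (massey_sum H \<mu> d (massey_entry H d Bs x c) p q =
                      \<zero>\<^bsub>H (massey_deg d p q + 1)\<^esub> \<longleftrightarrow>
                    (\<forall>b \<in> Bs (massey_deg d p q + 1). indexed_value R (P b) c = \<zero>\<^bsub>R\<^esub>)))"
      using pq by (intro B.massey_sum_polynomial) auto
  qed
qed

end
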